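(* Let $H=H_n$ be a sequence of graphs with $|V(H_n)|\le n$, let $p=p_n\in(0,1)$ with $p=\Omega(1)$, let $\Delta=\max_{i\in V(H)}\deg_H(i)$ and $m=|E(H)|$. Let $\mathbb{Q}=G(n,p)$ and let $\mathbb{P}$ be the planted-$H$ distribution. Then the following hold for testing $\mathbb{P}$ against $\mathbb{Q}$. (i) If $\Delta=O\left(\left(n\frac{p}{1-p}\right)^{1/2}\right)$, then the optimal test among constant-degree polynomials is to count signed edges, i.e. $f=\sum_{\{i,j\}\in\binom{[n]}{2}}\chi_{\{i,j\}}$. In particular, some constant-degree polynomial strongly separates $\mathbb{P}$ and $\mathbb{Q}$ if and only if $m=\omega\left(n\left(\frac{p}{1-p}\right)^{1/2}\right)$. (ii) If $\Delta\ge\left(n\frac{p}{1-p}\right)^{1/2+\varepsilon}$ for some constant $\varepsilon>0$, then the optimal test among constant-degree polynomials is to count signed large stars, i.e. $f=\sum_{S\subseteq\binom{[n]}{2}:\,S\cong\mathbf{K}_{1,t}}\chi_S$ for a large enough constant $t$; moreover, it is always possible to set $t=\lceil\frac{3}{2\varepsilon}\rceil+1$ so that this $f$ achieves strong separation. (iii) Moreover, for any $D=O(1)$, the optimal test among degree-$D$ polynomial tests for testing $\mathbb{P}$ against $\mathbb{Q}$ is either to count signed edges or to count signed $D$-edge stars $\mathbf{K}_{1,D}$.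
   Context: Asymptotics are as $n\to\infty$. $a_n=o(b_n)$ means $a_n/b_n\to0$, and $a_n=\omega(b_n)$ means $b_n=o(a_n)$. $p=\Omega(1)$ means $\liminf_n p_n>0$. A constant-degree polynomial means a (sequence of) polynomial(s) of degree $O(1)$; a degree-$D$ polynomial means a polynomial of degree at most $D$. Graphs on vertex set $[n]$ are identified with vectors $G=(G_{\{i,j\}})\in\{0,1\}^{\binom n2}$ of edge indicators. $G(n,p)$ is the Erdős–Rényi random graph. Planted subgraph detection task: under the null $\mathbb{Q}=G(n,p)$ one observes $G(n,p)$; under the planted-$H$ distribution $\mathbb{P}$ one observes the union of $G(n,p)$ with an independent random copy of $H$, chosen uniformly among all labelled copies of $H$ in the complete graph $K_n$ (i.e. the image of $H$ under a uniformly random injection $V(H)\to[n]$). A (sequence of) polynomial(s) $f$ in the $\binom n2$ variables $G_{\{i,j\}}$ strongly separates $\mathbb{P}$ and $\mathbb{Q}$ (achieves strong separation) if $\max\{\sqrt{\mathrm{Var}_{\mathbb{P}}(f)},\sqrt{\mathrm{Var}_{\mathbb{Q}}(f)}\}=o(|\mathbb{E}_{\mathbb{P}}f-\mathbb{E}_{\mathbb{Q}}f|)$. A test $T$ is the optimal test among a class $\mathcal{T}$ of tests if, whenever some $\tilde T\in\mathcal{T}$ strongly separates $\mathbb{P}$ and $\mathbb{Q}$, the test $T$ also does so. For $S\subseteq\binom{[n]}{2}$, $\chi_S(G)=\prod_{\{i,j\}\in S}\frac{G_{\{i,j\}}-p}{\sqrt{p(1-p)}}$. For a graph $\mathbf{S}$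 without isolated vertices, its signed count is $f_{\mathbf{S}}(G)=\sum_{S\subseteq\binom{[n]}{2}:\,S\cong\mathbf{S}}\chi_S(G)$, where $\cong$ denotes graph isomorphism. $\mathbf{K}_{1,t}$ is the star with $t$ edges. Counting signed edges means using the test $f_{\mathbf{K}_{1,1}}$, and counting signed $D$-edge stars means using the test $f_{\mathbf{K}_{1,D}}$.
   Formalization: In (iii) the choice between counting signed edges and counting signed D-edge stars may depend on n; a single choice for the whole sequence can fail when H_n alternates between stars and sparse near-regular graphs. *)

theory Defs
  imports
    "HOL-Probability.Probability"
    "HOL-Library.Landau_Symbols"
    "HOL-Library.Ramsey"
    "HOL-Library.Poly_Mapping"
begin

text \<open>
  A graph is a pair of a vertex set and a set of two-element subsets of it; \<open>nsets V 2\<close> is the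
  set of all two-element subsets of \<open>V\<close>.
\<close>

type_synonym 'a graph = "'a set \<times> 'a set set"

definition simple_graph :: "'a graph \<Rightarrow> bool" where
  "simple_graph H \<longleftrightarrow> finite (fst H) \<and> snd H \<subseteq> nsets (fst H) 2"

definition vertex_degree :: "'a graph \<Rightarrow> 'a \<Rightarrow> nat" where
  "vertex_degree H v = card {e \<in> snd H. v \<in> e}"

text \<open>The inserted 0 only matters for the graph without vertices.\<close>

definition max_degree :: "'a graph \<Rightarrow> nat" where
  "max_degree H = Max (insert 0 (vertex_degree H ` fst H))"

definition graph_iso :: "'a graph \<Rightarrow> 'b graph \<Rightarrow> bool" where
  "graph_iso A B \<longleftrightarrow> (\<exists>\<phi>. bij_betw \<phi> (fst A) (fst B) \<and> (\<lambda>e. \<phi> ` e) ` snd A = snd B)"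

definition star :: "nat \<Rightarrow> nat graph" where
  "star t = ({0..t}, {{0, i} | i. i \<in> {1..t}})"

text \<open>
  The potential edges of a graph on \<open>{1..n}\<close>. Such a graph is encoded by its vector of edge
  indicators, which is \<open>False\<close> outside of \<open>potential_edges n\<close>.
\<close>

abbreviation potential_edges :: "nat \<Rightarrow> nat set set" where
  "potential_edges n \<equiv> nsets {1..n} 2"

type_synonym edge_vector = "nat set \<Rightarrow> bool"

definition erdos_renyi :: "nat \<Rightarrow> real \<Rightarrow> edge_vector pmf" where
  "erdos_renyi n p = Pi_pmf (potential_edges n) False (\<lambda>_. bernoulli_pmf p)"

definition injections :: "'a set \<Rightarrow> 'b set \<Rightarrow> ('a \<Rightarrow> 'b) set" where
  "injections V W = {\<phi> \<in> V \<rightarrow>\<^sub>E W. inj_on \<phi> V}"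

definition planted :: "nat \<Rightarrow> real \<Rightarrow> 'a graph \<Rightarrow> edge_vector pmf" where
  "planted n p H =
     map_pmf (\<lambda>(G, \<phi>). \<lambda>e. G e \<or> e \<in> (\<lambda>d. \<phi> ` d) ` snd H)
       (pair_pmf (erdos_renyi n p) (pmf_of_set (injections (fst H) {1..n})))"

text \<open>A test is a sequence of real-valued functions, the \<open>n\<close>-th one on graphs on \<open>{1..n}\<close>.\<close>

type_synonym test = "nat \<Rightarrow> edge_vector \<Rightarrow> real"

text \<open>
  The notation $a_n = o(b_n)$ for $a_n / b_n \to 0$ presupposes $b_n \neq 0$ for large $n$.
  This has to be required separately, since \<open>0 \<in> o(0)\<close> in the library (and \<open>0 / 0 = 0\<close>);
  otherwise constant tests would separate any two distributions.
\<close>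

definition strongly_separates ::
    "(nat \<Rightarrow> edge_vector pmf) \<Rightarrow> (nat \<Rightarrow> edge_vector pmf) \<Rightarrow> test \<Rightarrow> bool" where
  "strongly_separates P Q f \<longleftrightarrow>
     (let gap = (\<lambda>n. \<bar>measure_pmf.expectation (P n) (f n) - measure_pmf.expectation (Q n) (f n)\<bar>)
      in (\<forall>\<^sub>F n in sequentially. gap n \<noteq> 0) \<and>
         (\<lambda>n. max (sqrt (measure_pmf.variance (P n) (f n))) (sqrt (measure_pmf.variance (Q n) (f n))))
           \<in> o(gap))"

definition optimal_test ::
    "(nat \<Rightarrow> edge_vector pmf) \<Rightarrow> (nat \<Rightarrow> edge_vector pmf) \<Rightarrow> test set \<Rightarrow> test \<Rightarrow> bool" where
  "optimal_test P Q \<T> f \<longleftrightarrow>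
     ((\<exists>g\<in>\<T>. strongly_separates P Q g) \<longrightarrow> strongly_separates P Q f)"

text \<open>
  Multivariate real polynomials: a monomial is a finitely supported exponent vector, a polynomial
  a finitely supported family of coefficients.
\<close>

type_synonym 'x mpoly = "('x \<Rightarrow>\<^sub>0 nat) \<Rightarrow>\<^sub>0 real"

definition mpoly_vars :: "'x mpoly \<Rightarrow> 'x set" where
  "mpoly_vars q = (\<Union>\<mu>\<in>Poly_Mapping.keys q. Poly_Mapping.keys \<mu>)"

definition mpoly_degree_le :: "'x mpoly \<Rightarrow> nat \<Rightarrow> bool" where
  "mpoly_degree_le q d \<longleftrightarrow>
     (\<forall>\<mu>\<in>Poly_Mapping.keys q. (\<Sum>x\<in>Poly_Mapping.keys \<mu>. Poly_Mapping.lookup \<mu> x) \<le> d)"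

definition mpoly_eval :: "'x mpoly \<Rightarrow> ('x \<Rightarrow> real) \<Rightarrow> real" where
  "mpoly_eval q a =
     (\<Sum>\<mu>\<in>Poly_Mapping.keys q.
        Poly_Mapping.lookup q \<mu> * (\<Prod>x\<in>Poly_Mapping.keys \<mu>. a x ^ Poly_Mapping.lookup \<mu> x))"

definition polynomial_tests :: "(nat \<Rightarrow> nat) \<Rightarrow> test set" where
  "polynomial_tests D =
     {f. \<forall>n. \<exists>q. mpoly_vars q \<subseteq> potential_edges n \<and> mpoly_degree_le q (D n) \<and>
                (\<forall>G. f n G = mpoly_eval q (\<lambda>e. of_bool (G e)))}"

definition constant_degree_tests :: "test set" where
  "constant_degree_tests = (\<Union>D \<in> {D. (\<lambda>n. real (D n)) \<in> O(\<lambda>_. 1)}. polynomial_tests D)"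

definition chi :: "real \<Rightarrow> nat set set \<Rightarrow> edge_vector \<Rightarrow> real" where
  "chi p S G = (\<Prod>e\<in>S. (of_bool (G e) - p) / sqrt (p * (1 - p)))"

text \<open>
  An edge set \<open>S\<close> is regarded as the graph on the vertices it covers, so the pattern \<open>A\<close> is meant
  to have no isolated vertices.
\<close>

definition signed_count :: "'a graph \<Rightarrow> nat \<Rightarrow> real \<Rightarrow> edge_vector \<Rightarrow> real" where
  "signed_count A n p G = (\<Sum>S | S \<subseteq> potential_edges n \<and> graph_iso (\<Union>S, S) A. chi p S G)"

definition signed_stars :: "nat \<Rightarrow> nat \<Rightarrow> real \<Rightarrow> edge_vector \<Rightarrow> real" where
  "signed_stars t = signed_count (star t)"

definition signed_edges :: "nat \<Rightarrow> real \<Rightarrow> edge_vector \<Rightarrow> real" where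
  "signed_edges = signed_count (star 1)"

lemma star_1: "star 1 = ({0, 1}, {{0, 1}})"
proof -
  have "{0..1} = {0, 1::nat}" by auto
  thus ?thesis by (simp add: star_def)
qed

lemma graph_iso_star_1_iff:
  assumes "S \<subseteq> potential_edges n"
  shows "graph_iso (\<Union>S, S) (star 1) \<longleftrightarrow> (\<exists>e\<in>potential_edges n. S = {e})"
proof
  assume "graph_iso (\<Union>S, S) (star 1)"
  then obtain \<phi> where inj: "inj_on \<phi> (\<Union>S)" and img: "(\<lambda>e. \<phi> ` e) ` S = {{0, 1::nat}}"
    unfolding graph_iso_def star_1 bij_betw_def fst_conv snd_conv by blast
  have eq: "x = y" if "x \<in> S" "y \<in> S" for x y
  proof -
    have "\<phi> ` x \<in> {{0, 1}}" "\<phi> ` y \<in> {{0, 1}}"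
      using that unfolding img[symmetric] by (auto intro: imageI)
    hence "\<phi> ` x = \<phi> ` y" by (simp only: singleton_iff)
    thus ?thesis
      using inj_on_image_eq_iff[OF inj Union_upper[OF that(1)] Union_upper[OF that(2)]] by simp
  qed
  have "S \<noteq> {}" using img by (metis image_empty insert_not_empty)
  then obtain e where "e \<in> S" by blast
  hence "S = {e}" using eq by blast
  thus "\<exists>e\<in>potential_edges n. S = {e}" using assms by blast
next
  assume "\<exists>e\<in>potential_edges n. S = {e}"
  then obtain e where e: "e \<in> potential_edges n" "S = {e}" by blast
  then obtain a b where ab: "e = {a, b}" "a \<noteq> b"
    unfolding nsets_def mem_Collect_eq card_2_iff by blast
  define \<phi> where "\<phi> = (\<lambda>x. if x = a then 0 else 1::nat)"
  have 1: "\<phi> ` {a, b} = {0, 1}" and "inj_on \<phi> {a, b}"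
    using ab(2) by (simp_all add: \<phi>_def insert_commute)
  thus "graph_iso (\<Union>S, S) (star 1)"
    unfolding graph_iso_def star_1 bij_betw_def e(2) ab(1)
    by (intro exI[of _ \<phi>]) simp
qed

lemma signed_edges_eq: "signed_edges n p G = (\<Sum>e\<in>potential_edges n. chi p {e} G)"
proof -
  have "{S. S \<subseteq> potential_edges n \<and> graph_iso (\<Union>S, S) (star 1)} = (\<lambda>e. {e}) ` potential_edges n"
  proof (intro equalityI subsetI)
    fix S assume "S \<in> {S. S \<subseteq> potential_edges n \<and> graph_iso (\<Union>S, S) (star 1)}"
    thus "S \<in> (\<lambda>e. {e}) ` potential_edges n"
      unfolding mem_Collect_eq image_iff using graph_iso_star_1_iff[of S n] by (elim conjE) simp
  next
    fix S assume "S \<in> (\<lambda>e. {e}) ` potential_edges n"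
    then obtain e where e: "e \<in> potential_edges n" "S = {e}" by (elim imageE)
    from e have sub: "S \<subseteq> potential_edges n" by simp
    have "graph_iso (\<Union>S, S) (star 1)"
      unfolding graph_iso_star_1_iff[OF sub] by (rule bexI) (rule e)+
    with sub show "S \<in> {S. S \<subseteq> potential_edges n \<and> graph_iso (\<Union>S, S) (star 1)}"
      by (intro CollectI conjI)
  qed
  moreover have "inj_on (\<lambda>e. {e}) (potential_edges n)" by (rule inj_onI) simp
  ultimately show ?thesis
    unfolding signed_edges_def signed_count_def by (simp only: sum.reindex o_def)
qed

end

theory Submission
  imports Defs
begin

text \<open>
  Write \<open>r = tilt p\<close>, so that \<open>r\<^sup>2 = (1 - p) / p\<close>. The signed monomials \<open>chi p S\<close> are orthonormal
  under the null distribution, and under the planted distribution \<open>chi p S\<close> has expectation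
  \<open>r ^ card S\<close> times the probability that the planted copy contains \<open>S\<close>. By the Cauchy-Schwarz
  inequality (\<open>gap_le_variance_times_advantage\<close>), a test of degree \<open>D\<close> can only separate if the sum
  of the squares of these expectations over the sets \<open>S\<close> with between 1 and \<open>D\<close> edges, the advantage,
  tends to infinity.

  The point of the proof is that this sum is governed by the degrees of the planted graph alone.
  Containing \<open>S\<close> requires a homomorphism from \<open>S\<close> to \<open>H\<close>, and the resulting weights are
  submultiplicative over connected components (\<open>hom_weight_sum_le\<close>), so that only connected sets
  matter. If a homomorphism of a connected graph with \<open>j + 1\<close> vertices is rooted at a vertex whose
  image \<open>y\<close> has the largest degree, then each of the \<open>j\<close> remaining vertices has at most \<open>deg y\<close>
  possible images. There are therefore, up to a constant, at most as many homomorphisms as for the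
  star with \<open>j\<close> edges, namely the sum of \<open>deg y ^ j\<close> over the vertices (\<open>card_connected_homs_le\<close>).
  Edges beyond a spanning tree only contribute powers of \<open>r\<close>, which is bounded because \<open>p\<close> is
  bounded away from 0.
  Consequently the advantage is bounded in terms of the moments of the scaled degrees
  \<open>x y = r * deg y / sqrt n\<close> of orders 1 to \<open>D\<close> (\<open>advantage_le\<close>).

  As \<open>x ^ j \<le> x + x ^ D\<close> for \<open>1 \<le> j \<le> D\<close>, these moments are dominated by those of orders 1 and \<open>D\<close>, which
  are, up to constants, the ratios of gap and null standard deviation of the edge count and of the
  \<open>D\<close>-edge star count (\<open>scaled_degree_moment_le_signals\<close>); call this ratio the signal. If \<open>x\<close> is bounded, that is, if the
  maximal degree is \<open>O(sqrt (n * p / (1 - p)))\<close>, then the first moment alone suffices. If the maximal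
  degree is larger by a power, a single vertex makes the signal of large stars diverge.

  Conversely, a star count with diverging signal separates
  (\<open>signed_stars_gap_and_variance\<close>): its conditional mean is the same for every position of the
  planted copy, so the variance under
  the planted distribution is an average of conditional variances. These are governed by the moments
  of \<open>x\<close> of even order below \<open>2 * t\<close>, which interpolate between the number \<open>n\<close> of vertices and the
  moment of order \<open>2 * t\<close>. The former is negligible because the signal diverges, the latter is at
  most the square of the moment of order \<open>t\<close>, that is, of the order of the squared gap, and for
  orders strictly below \<open>2 * t\<close> the interpolation gains a factor that tends to infinity.
\<close>

section \<open>Fourier analysis of the null and of the planted distribution\<close>

text \<open>
  The value of a normalised edge indicator at an edge that is present; this is what a planted edge
  contributes to a signed monomial.
\<close>

definition tilt :: "real \<Rightarrow> real" where
  "tilt p = sqrt ((1 - p) / p)"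

definition plant :: "nat set set \<Rightarrow> edge_vector \<Rightarrow> edge_vector" where
  "plant M G = (\<lambda>e. G e \<or> e \<in> M)"

lemma finite_potential_edges: "finite (potential_edges n)"
  by (simp add: finite_imp_finite_nsets)

declare finite_imp_finite_nsets [simp]

lemma finite_set_erdos_renyi [simp]: "finite (set_pmf (erdos_renyi n p))"
  unfolding erdos_renyi_def by (subst set_Pi_pmf) (auto intro!: finite_PiE_dflt)

lemma integrable_erdos_renyi [simp]: "integrable (measure_pmf (erdos_renyi n p)) (f :: _ \<Rightarrow> real)"
  by (rule integrable_measure_pmf_finite) simp

lemma expectation_prod_erdos_renyi:
  fixes f :: "nat set \<Rightarrow> bool \<Rightarrow> real"
  assumes "0 < p" "p < 1"
  shows "measure_pmf.expectation (erdos_renyi n p) (\<lambda>G. \<Prod>e\<in>potential_edges n. f e (G e))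
           = (\<Prod>e\<in>potential_edges n. f e True * p + f e False * (1 - p))"
proof -
  let ?M = "erdos_renyi n p"
  have indep: "prob_space.indep_vars (measure_pmf ?M) (\<lambda>_. borel)
                 (\<lambda>e G. f e (G e)) (potential_edges n)"
    using prob_space.indep_vars_compose2[OF measure_pmf.prob_space_axioms indep_vars_Pi_pmf[OF finite_potential_edges[of n]],
        of f "\<lambda>_. borel" False "\<lambda>_. bernoulli_pmf p"]
    unfolding erdos_renyi_def by simp
  have "measure_pmf.expectation ?M (\<lambda>G. \<Prod>e\<in>potential_edges n. f e (G e))
      = (\<Prod>e\<in>potential_edges n. measure_pmf.expectation ?M (\<lambda>G. f e (G e)))"
    using indep by (intro prob_space.indep_vars_lebesgue_integral[OF measure_pmf.prob_space_axioms]) auto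
  also have "\<dots> = (\<Prod>e\<in>potential_edges n. f e True * p + f e False * (1 - p))"
  proof (intro prod.cong refl)
    fix e assume e: "e \<in> potential_edges n"
    have "bernoulli_pmf p = map_pmf (\<lambda>G. G e) ?M"
      using Pi_pmf_component[OF finite_potential_edges[of n], where x = e and dflt = False and p = "\<lambda>_. bernoulli_pmf p"] e
      unfolding erdos_renyi_def by simp
    hence "measure_pmf.expectation ?M (\<lambda>G. f e (G e)) = measure_pmf.expectation (bernoulli_pmf p) (f e)"
      by simp
    thus "measure_pmf.expectation ?M (\<lambda>G. f e (G e)) = f e True * p + f e False * (1 - p)"
      using assms by simp
  qed
  finally show ?thesis .
qed

lemma expectation_chi_mult_chi:
  assumes p: "0 < p" "p < 1" and S: "S \<subseteq> potential_edges n" and T: "T \<subseteq> potential_edges n"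
  shows "measure_pmf.expectation (erdos_renyi n p) (\<lambda>G. chi p S G * chi p T G) = of_bool (S = T)"
proof -
  define h where "h b = (of_bool b - p) / sqrt (p * (1 - p))" for b
  define f where "f e b = (if e \<in> S then h b else 1) * (if e \<in> T then h b else 1)" for e b
  have chi: "chi p X G = (\<Prod>e\<in>potential_edges n. if e \<in> X then h (G e) else 1)"
    if "X \<subseteq> potential_edges n" for X G
  proof -
    have "potential_edges n \<inter> {e. e \<in> X} = X" using that by auto
    thus ?thesis unfolding chi_def h_def
      by (subst prod.If_cases) (simp_all del: One_nat_def)
  qed
  have f_prod: "chi p S G * chi p T G = (\<Prod>e\<in>potential_edges n. f e (G e))" for G
    using S T by (simp add: chi f_def prod.distrib)
  have 0: "h True * p + h False * (1 - p) = 0"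
    by (simp add: h_def field_simps)
  have sq: "sqrt (p * (1 - p)) * sqrt (p * (1 - p)) = p * (1 - p)" "p * (1 - p) \<noteq> 0"
    using p by auto
  have "h True * h True * p + h False * h False * (1 - p)
      = ((1 - p)\<^sup>2 * p + p\<^sup>2 * (1 - p)) / (p * (1 - p))"
    by (simp add: h_def times_divide_times_eq sq(1) power2_eq_square add_divide_distrib del: real_sqrt_mult_self)
  also have "\<dots> = 1" using sq(2) by (simp add: power2_eq_square field_simps)
  finally have 1: "h True * h True * p + h False * h False * (1 - p) = 1" .
  have f: "f e True * p + f e False * (1 - p) = of_bool (e \<in> S \<longleftrightarrow> e \<in> T)" for e
    using 0 1 by (simp add: f_def)
  have "measure_pmf.expectation (erdos_renyi n p) (\<lambda>G. chi p S G * chi p T G)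
      = (\<Prod>e\<in>potential_edges n. of_bool (e \<in> S \<longleftrightarrow> e \<in> T))"
    unfolding f_prod expectation_prod_erdos_renyi[OF p] f by simp
  also have "\<dots> = of_bool (S = T)"
  proof (cases "S = T")
    case False
    then obtain e where "e \<in> S \<longleftrightarrow> e \<notin> T" by blast
    moreover from this have "e \<in> potential_edges n" using S T by auto
    ultimately have "(\<Prod>e\<in>potential_edges n. of_bool (e \<in> S \<longleftrightarrow> e \<in> T) :: real) = 0"
      by (intro prod_zero finite_potential_edges bexI[of _ e]) auto
    thus ?thesis using False by simp
  qed simp
  finally show ?thesis .
qed

lemma expectation_chi:
  assumes "0 < p" "p < 1" "S \<subseteq> potential_edges n"
  shows "measure_pmf.expectation (erdos_renyi n p) (chi p S) = of_bool (S = {})"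
  using expectation_chi_mult_chi[OF assms, of "{}"] by (simp add: chi_def[of p "{}"])

lemma expectation_chi_sum_square:
  assumes p: "0 < p" "p < 1" and \<C>: "\<C> \<subseteq> Pow (potential_edges n)"
  shows "measure_pmf.expectation (erdos_renyi n p) (\<lambda>G. (\<Sum>S\<in>\<C>. a S * chi p S G)\<^sup>2)
           = (\<Sum>S\<in>\<C>. (a S)\<^sup>2)"
proof -
  have fin: "finite \<C>" using \<C> by (rule finite_subset) simp
  have "measure_pmf.expectation (erdos_renyi n p) (\<lambda>G. (\<Sum>S\<in>\<C>. a S * chi p S G)\<^sup>2)
      = (\<Sum>S\<in>\<C>. \<Sum>T\<in>\<C>. a S * a T *
           measure_pmf.expectation (erdos_renyi n p) (\<lambda>G. chi p S G * chi p T G))"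
    by (simp add: power2_eq_square sum_product Bochner_Integration.integral_sum mult_ac)
  also have "\<dots> = (\<Sum>S\<in>\<C>. \<Sum>T\<in>\<C>. a S * a T * of_bool (S = T))"
  proof (intro sum.cong refl)
    fix S T assume "S \<in> \<C>" "T \<in> \<C>"
    hence "S \<subseteq> potential_edges n" "T \<subseteq> potential_edges n" using \<C> by blast+
    thus "a S * a T * measure_pmf.expectation (erdos_renyi n p) (\<lambda>G. chi p S G * chi p T G)
        = a S * a T * of_bool (S = T)"
      by (simp only: expectation_chi_mult_chi[OF p])
  qed
  also have "\<dots> = (\<Sum>S\<in>\<C>. (a S)\<^sup>2)"
    using fin by (intro sum.cong refl) (simp add: of_bool_def sum.delta' power2_eq_square if_distrib cong: if_cong)
  finally show ?thesis .
qed

lemma chi_plant: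
  assumes p: "0 < p" "p < 1" and fin: "finite S"
  shows "chi p S (plant M G) = tilt p ^ card (S \<inter> M) * chi p (S - M) G"
proof -
  have "(1 - p) / sqrt (p * (1 - p)) = tilt p"
    using p by (simp add: tilt_def real_sqrt_mult real_sqrt_divide real_div_sqrt)
       (smt (verit) real_div_sqrt divide_divide_eq_left mult.commute)
  hence M: "(of_bool (plant M G e) - p) / sqrt (p * (1 - p)) = tilt p" if "e \<in> M" for e
    using that by (simp add: plant_def)
  have "S = (S \<inter> M) \<union> (S - M)" by blast
  hence "chi p S (plant M G) = chi p ((S \<inter> M) \<union> (S - M)) (plant M G)" by simp
  also have "\<dots> = chi p (S \<inter> M) (plant M G) * chi p (S - M) (plant M G)"
    unfolding chi_def using fin by (subst prod.union_disjoint) auto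
  also have "chi p (S \<inter> M) (plant M G) = tilt p ^ card (S \<inter> M)"
    unfolding chi_def using M by simp
  also have "chi p (S - M) (plant M G) = chi p (S - M) G"
    unfolding chi_def by (simp add: plant_def)
  finally show ?thesis .
qed

lemma expectation_chi_plant:
  assumes p: "0 < p" "p < 1" and S: "S \<subseteq> potential_edges n"
  shows "measure_pmf.expectation (erdos_renyi n p) (\<lambda>G. chi p S (plant M G))
           = tilt p ^ card S * of_bool (S \<subseteq> M)"
proof -
  have fin: "finite S" using S finite_subset[OF _ finite_potential_edges] by blast
  have "S - M \<subseteq> potential_edges n" using S by auto
  thus ?thesis
    by (auto simp: chi_plant[OF p fin] expectation_chi[OF p] Int_absorb2)
qed

lemma finite_injections: "finite V \<Longrightarrow> finite W \<Longrightarrow> finite (injections V W)"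
  unfolding injections_def by (rule finite_subset[of _ "V \<rightarrow>\<^sub>E W"]) (auto intro: finite_PiE)

lemma injections_nonempty:
  assumes "finite V" "finite W" "card V \<le> card W"
  shows "injections V W \<noteq> {}"
proof -
  obtain f where "f ` V \<subseteq> W" "inj_on f V" using card_le_inj[OF assms] by blast
  hence "restrict f V \<in> injections V W" by (auto simp: injections_def)
  thus ?thesis by blast
qed

text \<open>
  The planted distribution is a mixture: first choose where the graph goes, then add noise.
\<close>

lemma expectation_planted:
  fixes f :: "edge_vector \<Rightarrow> real"
  assumes "finite (fst H)" "card (fst H) \<le> n"
  shows "measure_pmf.expectation (planted n p H) f
    = (\<Sum>\<phi>\<in>injections (fst H) {1..n}.
         measure_pmf.expectation (erdos_renyi n p) (\<lambda>G. f (plant ((`) \<phi> ` snd H) G)))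
      / card (injections (fst H) {1..n})"
proof -
  let ?I = "injections (fst H) {1..n}"
  have I: "?I \<noteq> {}" "finite ?I"
    using assms by (intro injections_nonempty finite_injections; simp)+
  have "planted n p H = pmf_of_set ?I \<bind> (\<lambda>\<phi>. map_pmf (plant ((`) \<phi> ` snd H)) (erdos_renyi n p))"
    unfolding planted_def pair_pmf_def map_pmf_def plant_def bind_assoc_pmf
    by (subst bind_commute_pmf) (simp add: bind_return_pmf)
  thus ?thesis
    using I by (simp add: pmf_expectation_bind_pmf_of_set sum_divide_distrib divide_inverse mult.commute sum_distrib_left)
qed

lemma finite_set_planted [simp]:
  assumes "finite (fst H)" "card (fst H) \<le> n"
  shows "finite (set_pmf (planted n p H))"
proof -
  have "injections (fst H) {1..n} \<noteq> {}" "finite (injections (fst H) {1..n})"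
    using assms by (intro injections_nonempty finite_injections; simp)+
  thus ?thesis unfolding planted_def by simp
qed

section \<open>Polynomials of low degree\<close>

lemma monomial_fourier_expansion:
  assumes p: "0 < p" "p < 1" and fin: "finite T"
  shows "(\<Prod>e\<in>T. of_bool (G e))
    = (\<Sum>S\<in>Pow T. (sqrt (p * (1 - p)) ^ card S * p ^ card (T - S)) * chi p S G)"
proof -
  let ?\<sigma> = "sqrt (p * (1 - p))"
  have \<sigma>: "?\<sigma> \<noteq> 0" using p by simp
  have "(\<Prod>e\<in>T. of_bool (G e)) = (\<Prod>e\<in>T. ?\<sigma> * ((of_bool (G e) - p) / ?\<sigma>) + p)"
    using \<sigma> by (intro prod.cong) auto
  also have "\<dots> = (\<Sum>S\<in>Pow T. (\<Prod>e\<in>S. ?\<sigma> * ((of_bool (G e) - p) / ?\<sigma>)) * (\<Prod>e\<in>T-S. p))"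
    by (rule prod_add[OF fin])
  also have "\<dots> = (\<Sum>S\<in>Pow T. (?\<sigma> ^ card S * p ^ card (T - S)) * chi p S G)"
    by (intro sum.cong refl) (simp only: prod.distrib prod_constant chi_def mult_ac)
  finally show ?thesis .
qed

definition low_degree_sets :: "nat \<Rightarrow> nat \<Rightarrow> nat set set set" where
  "low_degree_sets n D = {S. S \<subseteq> potential_edges n \<and> card S \<le> D}"

lemma finite_low_degree_sets [simp]: "finite (low_degree_sets n D)"
  by (rule finite_subset[of _ "Pow (potential_edges n)"])
     (use finite_potential_edges in \<open>auto simp: low_degree_sets_def simp del: One_nat_def\<close>)

text \<open>
  On indicators every monomial is multilinear, and writing each indicator as an affine function of
  its normalisation only produces signed monomials over subsets of the same edges.
\<close>

lemma polynomial_fourier_expansion: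
  assumes p: "0 < p" "p < 1"
    and vars: "mpoly_vars q \<subseteq> potential_edges n" and deg: "mpoly_degree_le q D"
  shows "\<exists>c. \<forall>G. mpoly_eval q (\<lambda>e. of_bool (G e)) = (\<Sum>S\<in>low_degree_sets n D. c S * chi p S G)"
proof -
  define spanned where
    "spanned g \<longleftrightarrow> (\<exists>c. \<forall>G. g G = (\<Sum>S\<in>low_degree_sets n D. c S * chi p S G))" for g
  have spanned_chi: "spanned (\<lambda>G. a * chi p S G)" if "S \<in> low_degree_sets n D" for a S
    unfolding spanned_def
  proof (intro exI allI)
    fix G
    have "(\<Sum>T\<in>low_degree_sets n D. (if T = S then a else 0) * chi p T G)
        = (\<Sum>T\<in>low_degree_sets n D. if T = S then a * chi p S G else 0)"
      by (intro sum.cong) auto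
    thus "a * chi p S G = (\<Sum>T\<in>low_degree_sets n D. (if T = S then a else 0) * chi p T G)"
      using that by simp
  qed
  have spanned_sum: "spanned (\<lambda>G. \<Sum>i\<in>I. g i G)"
    if "finite I" "\<And>i. i \<in> I \<Longrightarrow> spanned (g i)" for I :: "'i set" and g
  proof -
    have "\<forall>i\<in>I. \<exists>c. \<forall>G. g i G = (\<Sum>S\<in>low_degree_sets n D. c S * chi p S G)"
      using that(2) by (auto simp: spanned_def)
    then obtain c where c: "\<And>i G. i \<in> I \<Longrightarrow> g i G = (\<Sum>S\<in>low_degree_sets n D. c i S * chi p S G)"
      by metis
    have "(\<Sum>i\<in>I. g i G) = (\<Sum>S\<in>low_degree_sets n D. (\<Sum>i\<in>I. c i S) * chi p S G)" for G
      by (simp add: c sum_distrib_right) (rule sum.swap)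
    thus ?thesis unfolding spanned_def by (intro exI[of _ "\<lambda>S. \<Sum>i\<in>I. c i S"]) simp
  qed
  have "spanned (\<lambda>G. Poly_Mapping.lookup q \<mu> *
          (\<Prod>x\<in>Poly_Mapping.keys \<mu>. of_bool (G x) ^ Poly_Mapping.lookup \<mu> x))"
    if \<mu>: "\<mu> \<in> Poly_Mapping.keys q" for \<mu>
  proof -
    let ?T = "Poly_Mapping.keys \<mu>"
    have T: "?T \<subseteq> potential_edges n" using vars \<mu> by (auto simp: mpoly_vars_def)
    have "card ?T = (\<Sum>x\<in>?T. 1)" by simp
    also have "\<dots> \<le> (\<Sum>x\<in>?T. Poly_Mapping.lookup \<mu> x)"
      by (intro sum_mono) (simp add: Suc_le_eq in_keys_iff)
    also have "\<dots> \<le> D" using deg \<mu> by (auto simp: mpoly_degree_le_def)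
    finally have card_T: "card ?T \<le> D" .
    have "(\<Prod>x\<in>?T. of_bool (G x) ^ Poly_Mapping.lookup \<mu> x) = (\<Prod>x\<in>?T. of_bool (G x) :: real)" for G
      by (intro prod.cong refl) (auto simp: in_keys_iff of_bool_def)
    hence eq: "(\<lambda>G. Poly_Mapping.lookup q \<mu> * (\<Prod>x\<in>?T. of_bool (G x) ^ Poly_Mapping.lookup \<mu> x))
      = (\<lambda>G. \<Sum>S\<in>Pow ?T. (Poly_Mapping.lookup q \<mu> * (sqrt (p * (1 - p)) ^ card S * p ^ card (?T - S)))
              * chi p S G)"
      using monomial_fourier_expansion[OF p, of ?T]
      by (simp only: sum_distrib_left finite_keys mult.assoc)
    have low: "S \<in> low_degree_sets n D" if "S \<in> Pow ?T" for S
      using that T card_T card_mono[of ?T S] by (force simp: low_degree_sets_def)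
    show ?thesis unfolding eq
      by (intro spanned_sum spanned_chi low) auto
  qed
  hence "spanned (\<lambda>G. mpoly_eval q (\<lambda>e. of_bool (G e)))"
    unfolding mpoly_eval_def by (intro spanned_sum) auto
  thus ?thesis by (simp add: spanned_def)
qed

text \<open>
  The squared norm of the low-degree projection of the likelihood ratio, without its constant term.
\<close>

definition advantage :: "nat \<Rightarrow> real \<Rightarrow> 'a graph \<Rightarrow> nat \<Rightarrow> real" where
  "advantage n p H D =
     (\<Sum>S\<in>low_degree_sets n D - {{}}. (measure_pmf.expectation (planted n p H) (chi p S))\<^sup>2)"

text \<open>
  The signed monomials of positive degree are orthonormal under the null distribution, so that the
  gap is an inner product to which the Cauchy-Schwarz inequality applies.
\<close>

lemma gap_le_variance_times_advantage:
  assumes p: "0 < p" "p < 1" and H: "finite (fst H)" "card (fst H) \<le> n"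
    and f: "\<And>G. f G = (\<Sum>S\<in>low_degree_sets n D. c S * chi p S G)"
  shows "(measure_pmf.expectation (planted n p H) f - measure_pmf.expectation (erdos_renyi n p) f)\<^sup>2
    \<le> measure_pmf.variance (erdos_renyi n p) f * advantage n p H D"
proof -
  let ?L = "low_degree_sets n D" and ?Q = "measure_pmf (erdos_renyi n p)"
    and ?P = "measure_pmf (planted n p H)"
  have 0: "{} \<in> ?L" by (simp add: low_degree_sets_def)
  have f': "f G = c {} + (\<Sum>S\<in>?L - {{}}. c S * chi p S G)" for G
    unfolding f using 0 by (subst sum.remove[of _ "{}"]) (auto simp: chi_def)
  have sub: "?L - {{}} \<subseteq> Pow (potential_edges n)" by (auto simp: low_degree_sets_def)
  have "integral\<^sup>L ?Q f = c {} + (\<Sum>S\<in>?L - {{}}. c S * integral\<^sup>L ?Q (chi p S))"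
    unfolding f' by (simp add: Bochner_Integration.integral_sum)
  also have "(\<Sum>S\<in>?L - {{}}. c S * integral\<^sup>L ?Q (chi p S)) = 0"
  proof (intro sum.neutral ballI)
    fix S assume S: "S \<in> ?L - {{}}"
    hence "S \<subseteq> potential_edges n" using sub by blast
    from expectation_chi[OF p this] S show "c S * integral\<^sup>L ?Q (chi p S) = 0" by simp
  qed
  finally have EQ: "integral\<^sup>L ?Q f = c {}" by simp
  have "measure_pmf.variance (erdos_renyi n p) f
      = integral\<^sup>L ?Q (\<lambda>G. (\<Sum>S\<in>?L - {{}}. c S * chi p S G)\<^sup>2)"
    unfolding EQ by (simp add: f')
  also have "\<dots> = (\<Sum>S\<in>?L - {{}}. (c S)\<^sup>2)"
    by (rule expectation_chi_sum_square[OF p sub])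
  finally have var: "measure_pmf.variance (erdos_renyi n p) f = (\<Sum>S\<in>?L - {{}}. (c S)\<^sup>2)" .
  have int: "integrable ?P (g :: _ \<Rightarrow> real)" for g
    by (rule integrable_measure_pmf_finite) (use H in simp)
  have "integral\<^sup>L ?P f = c {} + (\<Sum>S\<in>?L - {{}}. c S * integral\<^sup>L ?P (chi p S))"
    unfolding f' by (simp add: Bochner_Integration.integral_sum int)
  hence "integral\<^sup>L ?P f - integral\<^sup>L ?Q f = (\<Sum>S\<in>?L - {{}}. c S * integral\<^sup>L ?P (chi p S))"
    using EQ by simp
  thus ?thesis unfolding var advantage_def by (simp add: Cauchy_Schwarz_ineq_sum)
qed

lemma mpoly_eval_superset:
  assumes "finite A" "Poly_Mapping.keys q \<subseteq> A"
  shows "mpoly_eval q a = (\<Sum>\<mu>\<in>A. Poly_Mapping.lookup q \<mu> *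
           (\<Prod>x\<in>Poly_Mapping.keys \<mu>. a x ^ Poly_Mapping.lookup \<mu> x))"
  unfolding mpoly_eval_def using assms by (intro sum.mono_neutral_left) (auto simp: in_keys_iff)

lemma mpoly_eval_add: "mpoly_eval (q + r) a = mpoly_eval q a + mpoly_eval r a"
proof -
  let ?A = "Poly_Mapping.keys q \<union> Poly_Mapping.keys r"
  have "Poly_Mapping.keys (q + r) \<subseteq> ?A" by (rule Poly_Mapping.keys_add)
  thus ?thesis
    by (simp add: mpoly_eval_superset[of ?A] lookup_add algebra_simps sum.distrib)
qed

lemma signed_edges_polynomial: "(\<lambda>n. signed_edges n (p n)) \<in> polynomial_tests (\<lambda>_. 1)"
  unfolding polynomial_tests_def
proof (intro CollectI allI)
  fix n
  define \<sigma> where "\<sigma> = sqrt (p n * (1 - p n))"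
  define poly where "poly g \<longleftrightarrow> (\<exists>q. mpoly_vars q \<subseteq> potential_edges n \<and> mpoly_degree_le q 1 \<and>
                (\<forall>G. g G = mpoly_eval q (\<lambda>e. of_bool (G e))))" for g :: "edge_vector \<Rightarrow> real"
  have const: "poly (\<lambda>_. c)" for c
    unfolding poly_def
    by (intro exI[of _ "Poly_Mapping.single 0 c"])
       (auto simp: mpoly_vars_def mpoly_degree_le_def mpoly_eval_def lookup_single)
  have var: "poly (\<lambda>G. c * of_bool (G e))" if "e \<in> potential_edges n" for c e
    unfolding poly_def using that
    by (intro exI[of _ "Poly_Mapping.single (Poly_Mapping.single e 1) c"])
       (auto simp: mpoly_vars_def mpoly_degree_le_def mpoly_eval_def lookup_single)
  have add: "poly (\<lambda>G. g G + h G)" if gh: "poly g" "poly h" for g h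
  proof -
    obtain q r where q: "mpoly_vars q \<subseteq> potential_edges n" "mpoly_degree_le q 1"
        "\<And>G. g G = mpoly_eval q (\<lambda>e. of_bool (G e))"
      and r: "mpoly_vars r \<subseteq> potential_edges n" "mpoly_degree_le r 1"
        "\<And>G. h G = mpoly_eval r (\<lambda>e. of_bool (G e))"
      using gh by (auto simp: poly_def)
    have "Poly_Mapping.keys (q + r) \<subseteq> Poly_Mapping.keys q \<union> Poly_Mapping.keys r"
      by (rule Poly_Mapping.keys_add)
    hence "mpoly_vars (q + r) \<subseteq> mpoly_vars q \<union> mpoly_vars r" "mpoly_degree_le (q + r) 1"
      using q(2) r(2) unfolding mpoly_vars_def mpoly_degree_le_def by blast+
    thus ?thesis unfolding poly_def using q r
      by (intro exI[of _ "q + r"]) (auto simp: mpoly_eval_add)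
  qed
  have "poly (\<lambda>G. \<Sum>e\<in>A. (of_bool (G e) - p n) / \<sigma>)" if "A \<subseteq> potential_edges n" for A
  proof -
    have "finite A" using that finite_potential_edges by (rule finite_subset)
    thus ?thesis using that
    proof (induction A)
      case empty
      thus ?case using const[of 0] by simp
    next
      case (insert e A)
      have "poly (\<lambda>G. ((1 / \<sigma>) * of_bool (G e) + - p n / \<sigma>) + (\<Sum>e\<in>A. (of_bool (G e) - p n) / \<sigma>))"
        by (intro add var const) (use insert in auto)
      thus ?case using insert.hyps by (simp add: diff_divide_distrib)
    qed
  qed
  from this[of "potential_edges n"]
  have "poly (signed_edges n (p n))"
    by (simp add: signed_edges_eq[abs_def] chi_def \<sigma>_def)
  thus "\<exists>q. mpoly_vars q \<subseteq> potential_edges n \<and> mpoly_degree_le q 1 \<and>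
                (\<forall>G. signed_edges n (p n) G = mpoly_eval q (\<lambda>e. of_bool (G e)))"
    unfolding poly_def .
qed

section \<open>Connected edge sets and homomorphisms\<close>

definition homs :: "'b set set \<Rightarrow> 'a graph \<Rightarrow> ('b \<Rightarrow> 'a) set" where
  "homs S H = {\<psi> \<in> \<Union>S \<rightarrow>\<^sub>E fst H. \<forall>e\<in>S. \<psi> ` e \<in> snd H}"

lemma finite_homs: "finite (\<Union>S) \<Longrightarrow> finite (fst H) \<Longrightarrow> finite (homs S H)"
  unfolding homs_def by (rule finite_subset[of _ "\<Union>S \<rightarrow>\<^sub>E fst H"]) (auto intro: finite_PiE)

lemma homs_empty [simp]: "homs {} H = {\<lambda>_. undefined}"
  by (auto simp: homs_def)

lemma card_homs_disjoint_le:
  assumes disj: "\<Union>K \<inter> \<Union>R = {}" and fin: "finite (\<Union>K)" "finite (\<Union>R)" "finite (fst H)"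
  shows "card (homs (K \<union> R) H) \<le> card (homs K H) * card (homs R H)"
proof -
  let ?f = "\<lambda>\<psi>. (restrict \<psi> (\<Union>K), restrict \<psi> (\<Union>R))"
  have "inj_on ?f (homs (K \<union> R) H)"
  proof (rule inj_onI)
    fix \<psi> \<psi>' assume h: "\<psi> \<in> homs (K \<union> R) H" "\<psi>' \<in> homs (K \<union> R) H" and eq: "?f \<psi> = ?f \<psi>'"
    have "\<psi> x = \<psi>' x" for x
    proof (cases "x \<in> \<Union>K \<or> x \<in> \<Union>R")
      case True
      thus ?thesis using eq by (metis prod.inject restrict_apply')
    next
      case False
      hence "x \<notin> \<Union>(K \<union> R)" by auto
      thus ?thesis using h unfolding homs_def by (metis (no_types, lifting) PiE_arb mem_Collect_eq)
    qed
    thus "\<psi> = \<psi>'" by blast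
  qed
  moreover have "?f ` homs (K \<union> R) H \<subseteq> homs K H \<times> homs R H"
  proof (rule image_subsetI)
    fix \<psi> assume \<psi>: "\<psi> \<in> homs (K \<union> R) H"
    have "restrict \<psi> (\<Union>K) ` e = \<psi> ` e" if "e \<in> K" for e
      using that by (intro image_cong) auto
    moreover have "restrict \<psi> (\<Union>R) ` e = \<psi> ` e" if "e \<in> R" for e
      using that by (intro image_cong) auto
    ultimately show "?f \<psi> \<in> homs K H \<times> homs R H"
      using \<psi> by (auto simp: homs_def PiE_iff)
  qed
  ultimately have "card (homs (K \<union> R) H) \<le> card (homs K H \<times> homs R H)"
    using fin by (intro card_inj_on_le) (auto intro!: finite_cartesian_product finite_homs simp del: finite_Union)
  thus ?thesis by (simp add: card_cartesian_product)
qed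

text \<open>
  Connectedness as indivisibility: this form directly yields both the existence of components and
  the existence of an edge leaving a proper set of vertices.
\<close>

definition edge_connected :: "'b set set \<Rightarrow> bool" where
  "edge_connected K \<longleftrightarrow> K \<noteq> {} \<and>
     (\<forall>K1 K2. K = K1 \<union> K2 \<longrightarrow> \<Union>K1 \<inter> \<Union>K2 = {} \<longrightarrow> K1 = {} \<or> K2 = {})"

text \<open>
  A smallest nonempty part that shares no vertex with its complement cannot be divided further.
\<close>

lemma ex_connected_component:
  assumes "finite S" "S \<noteq> {}" "{} \<notin> S"
  shows "\<exists>K\<subseteq>S. edge_connected K \<and> \<Union>K \<inter> \<Union>(S - K) = {}"
proof -
  let ?P = "\<lambda>K. K \<subseteq> S \<and> K \<noteq> {} \<and> \<Union>K \<inter> \<Union>(S - K) = {}"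
  have "?P S" using assms by auto
  then obtain K where K: "?P K" and least: "\<And>L. ?P L \<Longrightarrow> card K \<le> card L"
    using ex_has_least_nat[of ?P S card] by blast
  have "K1 = {} \<or> K2 = {}" if split: "K = K1 \<union> K2" "\<Union>K1 \<inter> \<Union>K2 = {}" for K1 K2
  proof (rule ccontr)
    assume ne: "\<not> (K1 = {} \<or> K2 = {})"
    then obtain e where e: "e \<in> K2" by blast
    hence "e \<noteq> {}" using K split assms(3) by blast
    hence "e \<notin> K1" using e split(2) by blast
    hence "K1 \<subset> K" using e split(1) by blast
    hence "card K1 < card K" using K assms(1) by (meson finite_subset psubset_card_mono)
    moreover have "?P K1" using K split ne by blast
    ultimately show False using least[of K1] by simp
  qed
  hence "edge_connected K" using K by (auto simp: edge_connected_def)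
  thus ?thesis using K by blast
qed

text \<open>
  A connected edge set can be explored from any of its vertices, one crossing edge at a time.
\<close>

lemma edge_connected_induct [consumes 4, case_names root step]:
  assumes conn: "edge_connected K" and fin: "finite (\<Union>K)" and two: "\<forall>e\<in>K. card e = 2"
    and t: "t \<in> \<Union>K"
    and root: "P {t}"
    and step: "\<And>X a b. \<lbrakk>t \<in> X; X \<subseteq> \<Union>K; P X; {a, b} \<in> K; a \<in> X; b \<in> \<Union>K - X\<rbrakk> \<Longrightarrow> P (insert b X)"
  shows "P (\<Union>K)"
proof -
  have "P (\<Union>K)" if "t \<in> X" "X \<subseteq> \<Union>K" "P X" for X
    using that
  proof (induction "card (\<Union>K - X)" arbitrary: X rule: less_induct)
    case less
    show ?case
    proof (cases "X = \<Union>K")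
      case False
      have "\<exists>e\<in>K. e \<inter> X \<noteq> {} \<and> \<not> e \<subseteq> X"
      proof (rule ccontr)
        assume no: "\<not> (\<exists>e\<in>K. e \<inter> X \<noteq> {} \<and> \<not> e \<subseteq> X)"
        define K1 K2 where "K1 = {e \<in> K. e \<subseteq> X}" and "K2 = {e \<in> K. e \<inter> X = {}}"
        have "K = K1 \<union> K2" "\<Union>K1 \<inter> \<Union>K2 = {}" using no by (auto simp: K1_def K2_def)
        hence "K1 = {} \<or> K2 = {}" using conn unfolding edge_connected_def by blast
        moreover obtain e where "e \<in> K" "t \<in> e" using t by blast
        hence "e \<in> K1" using no less.prems by (auto simp: K1_def)
        moreover obtain y e' where "e' \<in> K" "y \<in> e'" "y \<notin> X" using False less.prems by blast
        hence "e' \<in> K2" using no by (auto simp: K2_def)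
        ultimately show False by blast
      qed
      then obtain e a b where e: "e \<in> K" "a \<in> e" "a \<in> X" "b \<in> e" "b \<notin> X" by blast
      have "a \<noteq> b" using e by blast
      moreover obtain u v where "e = {u, v}" using two e(1) unfolding card_2_iff by blast
      ultimately have e': "e = {a, b}" using e by blast
      have b: "b \<in> \<Union>K - X" using e by blast
      have "P (insert b X)" by (rule step[of X a b]) (use less.prems e e' b in auto)
      moreover have "card (\<Union>K - insert b X) < card (\<Union>K - X)"
        using b fin by (intro psubset_card_mono) auto
      ultimately show ?thesis using less.hyps[of "insert b X"] less.prems b by auto
    qed (use less.prems in auto)
  qed
  from this[of "{t}"] show ?thesis using t root by simp
qed

text \<open>
  During an exploration every vertex except for the root enters together with a new edge.
\<close>

lemma card_Union_le_card_Suc: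
  assumes "edge_connected K" "finite K" "finite (\<Union>K)" "\<And>e. e \<in> K \<Longrightarrow> card e = 2"
  shows "card (\<Union>K) \<le> card K + 1"
proof -
  obtain e where "e \<in> K" using assms(1) by (auto simp: edge_connected_def)
  moreover from this have "e \<noteq> {}" using assms(4) by force
  ultimately obtain t where t: "t \<in> \<Union>K" by blast
  have two: "\<forall>e\<in>K. card e = 2" using assms(4) by blast
  have "\<exists>K'\<subseteq>K. \<Union>K' \<subseteq> \<Union>K \<and> card (\<Union>K) \<le> card K' + 1"
    using assms(1,3) two t
  proof (induction rule: edge_connected_induct[where P = "\<lambda>X. \<exists>K'\<subseteq>K. \<Union>K' \<subseteq> X \<and> card X \<le> card K' + 1"])
    case root
    show ?case by (intro exI[of _ "{}"]) auto
  next
    case (step X a b)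
    then obtain K' where K': "K' \<subseteq> K" "\<Union>K' \<subseteq> X" "card X \<le> card K' + 1" by blast
    have fin: "finite X" "finite K'"
      using finite_subset[OF step.hyps(2) assms(3)] finite_subset[OF K'(1) assms(2)] .
    have "{a, b} \<notin> K'" using K' step.hyps by blast
    hence "card (insert b X) \<le> card (insert {a, b} K') + 1"
      using K' fin step.hyps by simp
    moreover have "insert {a, b} K' \<subseteq> K" "\<Union>(insert {a, b} K') \<subseteq> insert b X"
      using K' step.hyps by auto
    ultimately show ?case by blast
  qed
  then obtain K' where "K' \<subseteq> K" "card (\<Union>K) \<le> card K' + 1" by blast
  thus ?thesis using card_mono[OF assms(2), of K'] by simp
qed

lemma card_neighbours_le_degree:
  assumes H: "simple_graph H"
  shows "finite {w. {z, w} \<in> snd H}" "card {w. {z, w} \<in> snd H} \<le> vertex_degree H z"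
proof -
  have fin: "finite (snd H)"
    using H finite_subset unfolding simple_graph_def by (metis finite_imp_finite_nsets)
  have inj: "inj_on (\<lambda>w. {z, w}) {w. {z, w} \<in> snd H}"
    by (rule inj_onI) (metis doubleton_eq_iff)
  have sub: "(\<lambda>w. {z, w}) ` {w. {z, w} \<in> snd H} \<subseteq> {e \<in> snd H. z \<in> e}" by auto
  show "finite {w. {z, w} \<in> snd H}"
    using inj_on_finite[OF inj sub] fin by simp
  show "card {w. {z, w} \<in> snd H} \<le> vertex_degree H z"
    unfolding vertex_degree_def using card_inj_on_le[OF inj sub] fin by simp
qed

text \<open>
  In a homomorphism of a connected graph all of whose image vertices have degree at most \<open>d\<close>,
  every newly explored vertex has at most \<open>d\<close> possible images.
\<close>

lemma card_rooted_homs_le: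
  assumes H: "simple_graph H" and conn: "edge_connected K" and fin: "finite (\<Union>K)"
    and two: "\<And>e. e \<in> K \<Longrightarrow> card e = 2" and t: "t \<in> \<Union>K"
  shows "card {\<psi> \<in> homs K H. \<psi> t = y \<and> (\<forall>u\<in>\<Union>K. vertex_degree H (\<psi> u) \<le> d)}
           \<le> d ^ (card (\<Union>K) - 1)"
proof -
  define F where "F = {\<psi> \<in> homs K H. \<psi> t = y \<and> (\<forall>u\<in>\<Union>K. vertex_degree H (\<psi> u) \<le> d)}"
  have finF: "finite F"
    using H fin unfolding F_def simple_graph_def by (intro finite_Collect_conjI disjI1) (simp add: finite_homs del: finite_Union)
  have two': "\<forall>e\<in>K. card e = 2" using two by blast
  have "card ((\<lambda>\<psi>. restrict \<psi> (\<Union>K)) ` F) \<le> d ^ (card (\<Union>K) - 1)"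
    using conn fin two' t
  proof (induction rule: edge_connected_induct
          [where P = "\<lambda>X. card ((\<lambda>\<psi>. restrict \<psi> X) ` F) \<le> d ^ (card X - 1)"])
    case root
    have "(\<lambda>\<psi>. restrict \<psi> {t}) ` F \<subseteq> {restrict (\<lambda>_. y) {t}}"
      by (auto simp: F_def restrict_def fun_eq_iff)
    hence "card ((\<lambda>\<psi>. restrict \<psi> {t}) ` F) \<le> card {restrict (\<lambda>_. y) {t}}"
      by (intro card_mono) auto
    thus ?case by simp
  next
    case (step X a b)
    note hyps = \<open>t \<in> X\<close> \<open>X \<subseteq> \<Union>K\<close> \<open>{a, b} \<in> K\<close> \<open>a \<in> X\<close> \<open>b \<in> \<Union>K - X\<close>
    let ?R = "\<lambda>X \<psi>. restrict \<psi> X"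
    let ?N = "\<lambda>z. {w. {z, w} \<in> snd H}"
    have finX: "finite X" using hyps fin by (metis finite_subset)
    let ?g = "\<lambda>h. (restrict h X, h b)"
    have "inj_on ?g (?R (insert b X) ` F)"
    proof (rule inj_onI)
      fix h h' assume h: "h \<in> ?R (insert b X) ` F" "h' \<in> ?R (insert b X) ` F" and eq: "?g h = ?g h'"
      have "h x = h' x" for x
      proof (cases "x \<in> X \<or> x = b")
        case True
        thus ?thesis using eq by (metis prod.inject restrict_apply')
      qed (use h in auto)
      thus "h = h'" by blast
    qed
    moreover have "?g ` (?R (insert b X) ` F) \<subseteq> Sigma (?R X ` F) (\<lambda>g. ?N (g a))"
    proof (rule image_subsetI)
      fix h assume "h \<in> ?R (insert b X) ` F"
      then obtain \<psi> where h: "h = ?R (insert b X) \<psi>" and \<psi>: "\<psi> \<in> F" by (rule imageE)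
      have "\<psi> ` {a, b} \<in> snd H" using \<psi> hyps by (auto simp: F_def homs_def simp del: image_insert)
      moreover have "restrict (restrict \<psi> (insert b X)) X = restrict \<psi> X"
        by (auto simp: restrict_def)
      ultimately show "?g h \<in> Sigma (?R X ` F) (\<lambda>g. ?N (g a))"
        unfolding h using \<psi> hyps by auto
    qed
    moreover have "finite (Sigma (?R X ` F) (\<lambda>g. ?N (g a)))"
      using finF card_neighbours_le_degree[OF H] by (intro finite_SigmaI) auto
    ultimately have "card (?R (insert b X) ` F) \<le> card (Sigma (?R X ` F) (\<lambda>g. ?N (g a)))"
      by (rule card_inj_on_le)
    also have "\<dots> = (\<Sum>g\<in>?R X ` F. card (?N (g a)))"
      using finF card_neighbours_le_degree(1)[OF H] by (intro card_SigmaI) auto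
    also have "\<dots> \<le> (\<Sum>g\<in>?R X ` F. d)"
    proof (rule sum_mono)
      fix g assume "g \<in> ?R X ` F"
      then obtain \<psi> where "\<psi> \<in> F" "g a = \<psi> a" using hyps by auto
      moreover have "a \<in> \<Union>K" using hyps by blast
      ultimately have "vertex_degree H (g a) \<le> d" unfolding F_def by auto
      thus "card (?N (g a)) \<le> d" using card_neighbours_le_degree(2)[OF H, of "g a"] by simp
    qed
    also have "\<dots> = card (?R X ` F) * d" by simp
    also have "\<dots> \<le> d ^ (card X - 1) * d" by (intro mult_right_mono \<open>card ((\<lambda>\<psi>. restrict \<psi> X) ` F) \<le> d ^ (card X - 1)\<close>) simp
    also have "\<dots> = d ^ (card (insert b X) - 1)"
    proof -
      have "card X > 0" using hyps finX by (auto simp: card_gt_0_iff)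
      then obtain k where "card X = Suc k" using gr0_implies_Suc by blast
      moreover have "card (insert b X) = Suc (card X)" using hyps finX by simp
      ultimately show ?thesis by simp
    qed
    finally show ?case .
  qed
  moreover have "(\<lambda>\<psi>. restrict \<psi> (\<Union>K)) ` F = F"
  proof -
    have "restrict \<psi> (\<Union>K) = \<psi>" if "\<psi> \<in> F" for \<psi>
      using that by (auto simp: F_def homs_def PiE_iff extensional_restrict)
    thus ?thesis by auto
  qed
  ultimately show ?thesis unfolding F_def by simp
qed

text \<open>
  Rooting each homomorphism at a vertex whose image has maximal degree shows that, up to the
  number of choices for the root, no connected graph has more homomorphisms than the star with equally many
  vertices.
\<close>

lemma card_connected_homs_le:
  assumes H: "simple_graph H" and conn: "edge_connected K" and fin: "finite (\<Union>K)"
    and two: "\<And>e. e \<in> K \<Longrightarrow> card e = 2"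
  shows "card (homs K H) \<le> card (\<Union>K) * (\<Sum>y\<in>fst H. vertex_degree H y ^ (card (\<Union>K) - 1))"
proof -
  let ?d = "vertex_degree H"
  define F where "F t y = {\<psi> \<in> homs K H. \<psi> t = y \<and> (\<forall>u\<in>\<Union>K. ?d (\<psi> u) \<le> ?d y)}" for t y
  have finV: "finite (fst H)" using H by (simp add: simple_graph_def)
  have ne: "\<Union>K \<noteq> {}"
  proof -
    obtain e where "e \<in> K" using conn by (auto simp: edge_connected_def)
    moreover from this have "e \<noteq> {}" using two by force
    ultimately show ?thesis by blast
  qed
  have "homs K H \<subseteq> (\<Union>t\<in>\<Union>K. \<Union>y\<in>fst H. F t y)"
  proof
    fix \<psi> assume \<psi>: "\<psi> \<in> homs K H"
    obtain t where t: "t \<in> \<Union>K" "\<And>u. u \<in> \<Union>K \<Longrightarrow> ?d (\<psi> u) \<le> ?d (\<psi> t)"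
    proof -
      let ?m = "Max ((\<lambda>u. ?d (\<psi> u)) ` \<Union>K)"
      have "?m \<in> (\<lambda>u. ?d (\<psi> u)) ` \<Union>K" using fin ne by (intro Max_in) auto
      then obtain t where t: "?m = ?d (\<psi> t)" "t \<in> \<Union>K" by (rule imageE)
      have "?d (\<psi> u) \<le> ?d (\<psi> t)" if "u \<in> \<Union>K" for u
        unfolding t(1)[symmetric] using fin that by (intro Max_ge finite_imageI imageI)
      thus ?thesis using that t(2) by blast
    qed
    moreover have "\<psi> t \<in> fst H" using \<psi> t(1) by (auto simp: homs_def PiE_iff)
    ultimately show "\<psi> \<in> (\<Union>t\<in>\<Union>K. \<Union>y\<in>fst H. F t y)"
      using \<psi> unfolding F_def by blast
  qed
  moreover have "finite (\<Union>t\<in>\<Union>K. \<Union>y\<in>fst H. F t y)"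
  proof (rule finite_subset)
    show "(\<Union>t\<in>\<Union>K. \<Union>y\<in>fst H. F t y) \<subseteq> homs K H" by (auto simp: F_def)
  qed (use fin finV in \<open>simp add: finite_homs del: finite_Union\<close>)
  ultimately have "card (homs K H) \<le> card (\<Union>t\<in>\<Union>K. \<Union>y\<in>fst H. F t y)"
    by (intro card_mono)
  also have "\<dots> \<le> (\<Sum>t\<in>\<Union>K. card (\<Union>y\<in>fst H. F t y))" by (rule card_UN_le[OF fin])
  also have "\<dots> \<le> (\<Sum>t\<in>\<Union>K. \<Sum>y\<in>fst H. ?d y ^ (card (\<Union>K) - 1))"
  proof (rule sum_mono)
    fix t assume t: "t \<in> \<Union>K"
    have "card (\<Union>y\<in>fst H. F t y) \<le> (\<Sum>y\<in>fst H. card (F t y))" by (rule card_UN_le[OF finV])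
    also have "\<dots> \<le> (\<Sum>y\<in>fst H. ?d y ^ (card (\<Union>K) - 1))"
      unfolding F_def using card_rooted_homs_le[OF H conn fin two t] by (intro sum_mono) auto
    finally show "card (\<Union>y\<in>fst H. F t y) \<le> (\<Sum>y\<in>fst H. ?d y ^ (card (\<Union>K) - 1))" .
  qed
  finally show ?thesis by simp
qed

section \<open>The low-degree advantage\<close>

text \<open>
  Prescribing one more value of an injection reduces the number of injections by a factor of at
  least \<open>card W - card U \<ge> card W / 2\<close>, since all unused values are equally likely.
\<close>

lemma card_injections_prescribed_le:
  fixes \<psi> :: "'b \<Rightarrow> 'a"
  assumes V: "finite V" and W: "finite W" and U: "finite U" "U \<subseteq> W" "2 * card U \<le> card W"
    and \<psi>: "\<psi> ` U \<subseteq> V"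
  shows "card {\<phi> \<in> injections V W. \<forall>x\<in>U. \<phi> (\<psi> x) = x} * card W ^ card U
           \<le> card (injections V W) * 2 ^ card U"
  using U \<psi>
proof (induction U)
  case (insert x U)
  define X where "X = {\<phi> \<in> injections V W. \<forall>z\<in>U. \<phi> (\<psi> z) = z}"
  define Y where "Y u = {\<phi> \<in> X. \<phi> (\<psi> x) = u}" for u
  have U: "U \<subseteq> W" "x \<in> W" "2 * card U + 2 \<le> card W" using insert.prems insert.hyps by auto
  have IH: "card X * card W ^ card U \<le> card (injections V W) * 2 ^ card U"
    unfolding X_def by (rule insert.IH) (use U insert.prems in auto)
  have finX: "finite X" using finite_injections[OF V W] by (simp add: X_def)
  have xV: "\<psi> x \<in> V" and UV: "\<psi> ` U \<subseteq> V" using insert.prems by auto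
  have le: "card (Y x) \<le> card (Y u)" if u: "u \<in> W - U" for u
  proof -
    \<comment> \<open>Swapping the values \<open>x\<close> and \<open>u\<close> turns one prescription into the other.\<close>
    let ?g = "\<lambda>\<phi>. restrict (Transposition.transpose x u \<circ> \<phi>) V"
    have "inj_on ?g (Y x)"
    proof (rule inj_onI)
      fix \<phi> \<phi>' assume h: "\<phi> \<in> Y x" "\<phi>' \<in> Y x" and eq: "?g \<phi> = ?g \<phi>'"
      have "\<phi> v = \<phi>' v" for v
      proof (cases "v \<in> V")
        case True
        hence "Transposition.transpose x u (\<phi> v) = Transposition.transpose x u (\<phi>' v)"
          using fun_cong[OF eq, of v] by simp
        thus ?thesis by (rule injD[OF inj_transpose])
      next
        case False
        moreover have "\<phi> \<in> V \<rightarrow>\<^sub>E W" "\<phi>' \<in> V \<rightarrow>\<^sub>E W" using h by (auto simp: Y_def X_def injections_def)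
        ultimately show ?thesis by (metis PiE_arb)
      qed
      thus "\<phi> = \<phi>'" by blast
    qed
    moreover have "?g ` Y x \<subseteq> Y u"
    proof (rule image_subsetI)
      fix \<phi> assume "\<phi> \<in> Y x"
      hence \<phi>: "\<phi> \<in> V \<rightarrow>\<^sub>E W" "inj_on \<phi> V" "\<And>z. z \<in> U \<Longrightarrow> \<phi> (\<psi> z) = z" "\<phi> (\<psi> x) = x"
        by (auto simp: Y_def X_def injections_def)
      have "Transposition.transpose x u w \<in> W" if "w \<in> W" for w
        using that u insert.prems by (auto simp: Transposition.transpose_def)
      hence "?g \<phi> \<in> V \<rightarrow>\<^sub>E W" using PiE_mem[OF \<phi>(1)] by auto
      moreover have "inj_on (?g \<phi>) V"
        using comp_inj_on[OF \<phi>(2) inj_on_subset[OF inj_transpose subset_UNIV]]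
        by (simp add: inj_on_restrict_eq)
      moreover have "?g \<phi> (\<psi> z) = z" if "z \<in> U" for z
        using that \<phi>(3)[OF that] u insert.hyps UV by (auto simp: Transposition.transpose_def)
      moreover have "?g \<phi> (\<psi> x) = u" using xV \<phi>(4) by simp
      ultimately show "?g \<phi> \<in> Y u" by (simp add: Y_def X_def injections_def)
    qed
    ultimately show ?thesis
      using finX by (intro card_inj_on_le) (auto simp: Y_def)
  qed
  have "card (Y x) * (card W - card U) = (\<Sum>u\<in>W - U. card (Y x))"
    using card_Diff_subset[OF insert.hyps(1) U(1)] by simp
  also have "\<dots> \<le> (\<Sum>u\<in>W - U. card (Y u))" by (intro sum_mono le)
  also have "\<dots> = card (\<Union>u\<in>W - U. Y u)"
    using W finX by (intro card_UN_disjoint[symmetric]) (auto simp: Y_def)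
  also have "\<dots> \<le> card X" using finX by (intro card_mono) (auto simp: Y_def)
  finally have step: "card (Y x) * (card W - card U) \<le> card X" .
  have "card W \<le> 2 * (card W - card U)" using U(3) by simp
  hence "card (Y x) * card W \<le> card (Y x) * (2 * (card W - card U))" by (rule mult_left_mono) simp
  also have "\<dots> \<le> 2 * card X" using step by simp
  finally have "card (Y x) * card W \<le> 2 * card X" .
  hence "card (Y x) * card W * card W ^ card U \<le> 2 * card X * card W ^ card U"
    by (rule mult_right_mono) simp
  also have "\<dots> \<le> 2 * (card (injections V W) * 2 ^ card U)"
    using IH by simp
  finally have "card (Y x) * card W ^ Suc (card U) \<le> card (injections V W) * 2 ^ Suc (card U)"
    by (simp add: mult_ac)
  moreover have "Y x = {\<phi> \<in> injections V W. \<forall>z\<in>insert x U. \<phi> (\<psi> z) = z}"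
    by (auto simp: Y_def X_def)
  ultimately show ?case using insert.hyps by simp
qed simp

text \<open>
  If the planted copy contains \<open>S\<close>, then the inverse of the injection is a homomorphism on the
  vertices covered by \<open>S\<close>. The bound is a union bound over these homomorphisms.
\<close>

lemma containment_probability_le:
  assumes H: "simple_graph H" "card (fst H) \<le> n"
    and S: "S \<subseteq> potential_edges n" "2 * card (\<Union>S) \<le> n"
  shows "real (card {\<phi> \<in> injections (fst H) {1..n}. S \<subseteq> (`) \<phi> ` snd H})
           / card (injections (fst H) {1..n})
         \<le> card (homs S H) * (2 / n) ^ card (\<Union>S)"
proof -
  let ?I = "injections (fst H) {1..n}" and ?U = "\<Union>S"
  define A where "A \<psi> = {\<phi> \<in> ?I. \<forall>x\<in>?U. \<phi> (\<psi> x) = x}" for \<psi>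
  have finV: "finite (fst H)" and E: "snd H \<subseteq> nsets (fst H) 2" using H by (auto simp: simple_graph_def)
  have U: "?U \<subseteq> {1..n}" using S(1) by (auto simp: nsets_def)
  have finU: "finite ?U" by (rule finite_subset[OF U]) simp
  have finI: "finite ?I" using finV by (intro finite_injections) auto
  have I: "card ?I > 0" using finI injections_nonempty[of "fst H" "{1..n}"] finV H(2) by (simp add: card_gt_0_iff)
  have "{\<phi> \<in> ?I. S \<subseteq> (`) \<phi> ` snd H} \<subseteq> (\<Union>\<psi>\<in>homs S H. A \<psi>)"
  proof
    fix \<phi> assume \<phi>: "\<phi> \<in> {\<phi> \<in> ?I. S \<subseteq> (`) \<phi> ` snd H}"
    hence inj: "inj_on \<phi> (fst H)" by (simp add: injections_def)
    define \<psi> where "\<psi> = restrict (inv_into (fst H) \<phi>) ?U"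
    have edge: "\<exists>d\<in>snd H. d \<subseteq> fst H \<and> e = \<phi> ` d" if "e \<in> S" for e
    proof -
      have "e \<in> (`) \<phi> ` snd H" using that \<phi> by blast
      thus ?thesis using E by (auto simp: nsets_def)
    qed
    have img: "x \<in> \<phi> ` fst H" if "x \<in> ?U" for x
      using that edge by blast
    have "\<psi> ` e \<in> snd H" if e: "e \<in> S" for e
    proof -
      obtain d where d: "d \<in> snd H" "d \<subseteq> fst H" "e = \<phi> ` d" using edge[OF e] by blast
      have "\<psi> ` e = inv_into (fst H) \<phi> ` e" using e by (intro image_cong) (auto simp: \<psi>_def)
      also have "\<dots> = d" unfolding d(3) by (rule inv_into_image_cancel[OF inj d(2)])
      finally show ?thesis using d(1) by simp
    qed
    moreover have "\<psi> \<in> ?U \<rightarrow>\<^sub>E fst H"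
      using inv_into_into[OF img] unfolding \<psi>_def by (intro PiE_I) (auto simp del: Union_iff)
    ultimately have "\<psi> \<in> homs S H" by (simp add: homs_def)
    moreover have "\<phi> \<in> A \<psi>"
      using \<phi> f_inv_into_f[OF img] unfolding A_def \<psi>_def by (auto simp del: Union_iff)
    ultimately show "\<phi> \<in> (\<Union>\<psi>\<in>homs S H. A \<psi>)" by blast
  qed
  hence "card {\<phi> \<in> ?I. S \<subseteq> (`) \<phi> ` snd H} \<le> card (\<Union>\<psi>\<in>homs S H. A \<psi>)"
    using finI finV finU by (intro card_mono) (auto simp: A_def simp del: finite_Union intro!: finite_homs)
  also have "\<dots> \<le> (\<Sum>\<psi>\<in>homs S H. card (A \<psi>))"
    by (rule card_UN_le) (intro finite_homs finU finV)
  finally have "real (card {\<phi> \<in> ?I. S \<subseteq> (`) \<phi> ` snd H}) \<le> (\<Sum>\<psi>\<in>homs S H. real (card (A \<psi>)))"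
    by (simp flip: of_nat_sum)
  also have "\<dots> \<le> (\<Sum>\<psi>\<in>homs S H. real (card ?I) * (2 / n) ^ card ?U)"
  proof (rule sum_mono)
    fix \<psi> assume "\<psi> \<in> homs S H"
    hence "\<psi> ` ?U \<subseteq> fst H" by (auto simp: homs_def PiE_iff)
    hence "card (A \<psi>) * card {1..n} ^ card ?U \<le> card ?I * 2 ^ card ?U"
      unfolding A_def using finV finU U S(2) by (intro card_injections_prescribed_le) auto
    hence "card (A \<psi>) * n ^ card ?U \<le> card ?I * 2 ^ card ?U" by simp
    hence "real (card (A \<psi>)) * real n ^ card ?U \<le> real (card ?I) * 2 ^ card ?U"
      by (metis (mono_tags) of_nat_le_iff of_nat_mult of_nat_numeral of_nat_power)
    moreover have "real n ^ card ?U > 0"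
    proof (cases "n = 0")
      case True
      hence "?U = {}" using U by auto
      hence "card ?U = 0" by (simp only: card.empty)
      thus ?thesis by simp
    qed simp
    ultimately show "real (card (A \<psi>)) \<le> real (card ?I) * (2 / n) ^ card ?U"
      by (simp add: power_divide pos_le_divide_eq)
  qed
  also have "\<dots> = card (homs S H) * (2 / n) ^ card ?U * card ?I" by simp
  finally show ?thesis using I by (simp add: pos_divide_le_eq)
qed

text \<open>
  Up to a factor depending on \<open>card S\<close> only, \<open>hom_weight\<close> bounds the expectation of a signed
  monomial under the planted distribution; it is submultiplicative over vertex-disjoint parts.
\<close>

definition hom_weight :: "nat \<Rightarrow> real \<Rightarrow> 'a graph \<Rightarrow> nat set set \<Rightarrow> real" where
  "hom_weight n p H S = tilt p ^ card S * card (homs S H) / n ^ card (\<Union>S)"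

lemma tilt_pos: "0 < p \<Longrightarrow> p < 1 \<Longrightarrow> 0 < tilt p"
  by (simp add: tilt_def)

lemma hom_weight_nonneg: "0 < p \<Longrightarrow> p < 1 \<Longrightarrow> 0 \<le> hom_weight n p H S"
  unfolding hom_weight_def by (intro divide_nonneg_nonneg mult_nonneg_nonneg) (simp_all add: tilt_pos less_imp_le)

lemma finite_edge_set:
  assumes "S \<subseteq> potential_edges n"
  shows "finite S" "finite (\<Union>S)" "\<Union>S \<subseteq> {1..n}" "e \<in> S \<Longrightarrow> card e = 2" "{} \<notin> S"
proof -
  show "finite S" using assms finite_potential_edges by (rule finite_subset)
  show "\<Union>S \<subseteq> {1..n}" using assms by (auto simp: nsets_def)
  thus "finite (\<Union>S)" by (rule finite_subset) simp
  show "card e = 2" if "e \<in> S" for e using that assms by (auto simp: nsets_def)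
  from this[of "{}"] show "{} \<notin> S" by auto
qed

lemma card_Union_edges_le:
  assumes "S \<subseteq> potential_edges n"
  shows "card (\<Union>S) \<le> 2 * card S"
proof -
  have "card (\<Union>S) \<le> (\<Sum>e\<in>S. card e)" by (rule card_Union_le_sum_card)
  also have "\<dots> = (\<Sum>e\<in>S. 2)" using finite_edge_set(4)[OF assms] by (rule sum.cong[OF refl])
  finally show ?thesis by simp
qed

lemma expectation_chi_planted_bounds:
  assumes p: "0 < p" "p < 1" and H: "simple_graph H" "card (fst H) \<le> n"
    and S: "S \<subseteq> potential_edges n" "4 * card S \<le> n"
  shows "0 \<le> measure_pmf.expectation (planted n p H) (chi p S)"
    and "measure_pmf.expectation (planted n p H) (chi p S) \<le> 4 ^ card S * hom_weight n p H S"
proof -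
  let ?I = "injections (fst H) {1..n}" and ?r = "tilt p" and ?v = "card (\<Union>S)"
  have finV: "finite (fst H)" using H by (simp add: simple_graph_def)
  hence finI: "finite ?I" by (intro finite_injections) auto
  have "measure_pmf.expectation (planted n p H) (chi p S)
      = (\<Sum>\<phi>\<in>?I. ?r ^ card S * of_bool (S \<subseteq> (`) \<phi> ` snd H)) / card ?I"
    by (simp only: expectation_planted[OF finV H(2)] expectation_chi_plant[OF p S(1)])
  also have "\<dots> = ?r ^ card S * (card {\<phi> \<in> ?I. S \<subseteq> (`) \<phi> ` snd H} / card ?I)"
    using finI by (simp flip: sum_distrib_left add: sum.If_cases of_bool_def Int_def)
  finally have eq: "measure_pmf.expectation (planted n p H) (chi p S)
      = ?r ^ card S * (card {\<phi> \<in> ?I. S \<subseteq> (`) \<phi> ` snd H} / card ?I)" .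
  have r: "0 \<le> ?r ^ card S" using tilt_pos[OF p] by simp
  show "0 \<le> measure_pmf.expectation (planted n p H) (chi p S)"
    unfolding eq using r by simp
  have v: "?v \<le> 2 * card S" by (rule card_Union_edges_le[OF S(1)])
  have "measure_pmf.expectation (planted n p H) (chi p S) \<le> ?r ^ card S * (card (homs S H) * (2 / n) ^ ?v)"
    unfolding eq using containment_probability_le[OF H S(1)] v S(2) r by (intro mult_left_mono) auto
  also have "\<dots> = 2 ^ ?v * hom_weight n p H S"
    by (simp add: hom_weight_def power_divide)
  also have "\<dots> \<le> 2 ^ (2 * card S) * hom_weight n p H S"
    using v by (intro mult_right_mono power_increasing hom_weight_nonneg p) auto
  finally show "measure_pmf.expectation (planted n p H) (chi p S) \<le> 4 ^ card S * hom_weight n p H S"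
    by (simp add: power_mult)
qed

lemma hom_weight_component_le:
  assumes p: "0 < p" "p < 1" and H: "finite (fst H)"
    and S: "S \<subseteq> potential_edges n" and K: "K \<subseteq> S" "\<Union>K \<inter> \<Union>(S - K) = {}"
  shows "hom_weight n p H S \<le> hom_weight n p H K * hom_weight n p H (S - K)"
proof -
  let ?R = "S - K"
  have sub: "K \<subseteq> potential_edges n" "?R \<subseteq> potential_edges n" using S K by auto
  have S_eq: "S = K \<union> ?R" using K by blast
  have c: "card S = card K + card ?R"
    using finite_edge_set(1)[OF S] K by (metis card_Diff_subset card_mono finite_subset le_add_diff_inverse)
  have "\<Union>S = \<Union>K \<union> \<Union>?R" using K by blast
  hence v: "card (\<Union>S) = card (\<Union>K) + card (\<Union>?R)"
    using card_Un_disjoint[OF finite_edge_set(2)[OF sub(1)] finite_edge_set(2)[OF sub(2)] K(2)] by simp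
  have "card (homs S H) \<le> card (homs K H) * card (homs ?R H)"
    using card_homs_disjoint_le[OF K(2) finite_edge_set(2)[OF sub(1)] finite_edge_set(2)[OF sub(2)] H] S_eq
    by simp
  hence "real (card (homs S H)) \<le> real (card (homs K H)) * real (card (homs ?R H))"
    by (simp flip: of_nat_mult)
  hence "tilt p ^ card S * real (card (homs S H)) / n ^ card (\<Union>S)
       \<le> tilt p ^ card S * (real (card (homs K H)) * real (card (homs ?R H))) / n ^ card (\<Union>S)"
    using tilt_pos[OF p] by (intro divide_right_mono mult_left_mono) auto
  thus ?thesis unfolding hom_weight_def c v by (simp add: power_add mult_ac)
qed

text \<open>
  Splitting off one connected component at a time reduces the sum over all edge sets to the sum
  over the connected ones.
\<close>

lemma hom_weight_sum_le:
  assumes p: "0 < p" "p < 1" and H: "finite (fst H)" and k: "k \<le> D"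
    and \<kappa>: "(\<Sum>K | K \<in> low_degree_sets n D \<and> edge_connected K. (hom_weight n p H K)\<^sup>2) \<le> \<kappa>"
  shows "(\<Sum>S\<in>low_degree_sets n k. (hom_weight n p H S)\<^sup>2) \<le> (1 + \<kappa>) ^ k"
  using k
proof (induction k)
  case 0
  have "low_degree_sets n 0 = {{}}"
    using finite_edge_set(1)[of _ n] by (auto simp: low_degree_sets_def simp del: One_nat_def)
  thus ?case by (simp add: hom_weight_def)
next
  case (Suc k)
  let ?b = "hom_weight n p H" and ?L = "low_degree_sets n"
  let ?C = "{K \<in> ?L D. edge_connected K}"
  have \<kappa>0: "0 \<le> \<kappa>" using sum_nonneg[of ?C "\<lambda>K. (?b K)\<^sup>2"] \<kappa> by simp
  define comp where "comp S = (SOME K. K \<subseteq> S \<and> edge_connected K \<and> \<Union>K \<inter> \<Union>(S - K) = {})" for S :: "nat set set"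
  have comp: "comp S \<subseteq> S" "edge_connected (comp S)" "\<Union>(comp S) \<inter> \<Union>(S - comp S) = {}"
    if "S \<in> ?L (Suc k) - {{}}" for S
  proof -
    have "S \<subseteq> potential_edges n" "S \<noteq> {}" using that by (auto simp: low_degree_sets_def)
    from ex_connected_component[OF finite_edge_set(1)[OF this(1)] this(2) finite_edge_set(5)[OF this(1)]]
    have "\<exists>K. K \<subseteq> S \<and> edge_connected K \<and> \<Union>K \<inter> \<Union>(S - K) = {}" by blast
    from someI_ex[OF this]
    show "comp S \<subseteq> S" "edge_connected (comp S)" "\<Union>(comp S) \<inter> \<Union>(S - comp S) = {}"
      unfolding comp_def by blast+
  qed
  let ?f = "\<lambda>S. (comp S, S - comp S)"
  have inj: "inj_on ?f (?L (Suc k) - {{}})"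
  proof (rule inj_onI)
    fix S T assume "S \<in> ?L (Suc k) - {{}}" "T \<in> ?L (Suc k) - {{}}" "?f S = ?f T"
    thus "S = T" using comp(1)[of S] comp(1)[of T] by (metis Diff_partition prod.inject)
  qed
  have img: "?f ` (?L (Suc k) - {{}}) \<subseteq> ?C \<times> ?L k"
  proof (rule image_subsetI)
    fix S assume S: "S \<in> ?L (Suc k) - {{}}"
    have Sp: "S \<subseteq> potential_edges n" "card S \<le> Suc k" using S by (auto simp: low_degree_sets_def)
    have fin: "finite S" by (rule finite_edge_set(1)[OF Sp(1)])
    have ne: "comp S \<noteq> {}" using comp(2)[OF S] by (simp add: edge_connected_def)
    have "card (comp S) \<le> D" using card_mono[OF fin comp(1)[OF S]] Sp Suc.prems by simp
    moreover have "card (S - comp S) < card S"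
      using ne comp(1)[OF S] fin by (intro psubset_card_mono) auto
    hence "card (S - comp S) \<le> k" using Sp(2) by simp
    ultimately show "?f S \<in> ?C \<times> ?L k"
      using comp[OF S] Sp by (auto simp: low_degree_sets_def)
  qed
  have 0: "{} \<in> ?L (Suc k)" by (simp add: low_degree_sets_def)
  have "(\<Sum>S\<in>?L (Suc k). (?b S)\<^sup>2) = 1 + (\<Sum>S\<in>?L (Suc k) - {{}}. (?b S)\<^sup>2)"
    using 0 by (subst sum.remove[of _ "{}"]) (auto simp: hom_weight_def)
  also have "(\<Sum>S\<in>?L (Suc k) - {{}}. (?b S)\<^sup>2)
      \<le> (\<Sum>S\<in>?L (Suc k) - {{}}. (case ?f S of (K, R) \<Rightarrow> (?b K)\<^sup>2 * (?b R)\<^sup>2))"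
  proof (rule sum_mono)
    fix S assume S: "S \<in> ?L (Suc k) - {{}}"
    hence "?b S \<le> ?b (comp S) * ?b (S - comp S)"
      using comp[OF S] by (intro hom_weight_component_le p H) (auto simp: low_degree_sets_def)
    hence "(?b S)\<^sup>2 \<le> (?b (comp S) * ?b (S - comp S))\<^sup>2"
      by (intro power_mono hom_weight_nonneg p)
    thus "(?b S)\<^sup>2 \<le> (case ?f S of (K, R) \<Rightarrow> (?b K)\<^sup>2 * (?b R)\<^sup>2)" by (simp add: power_mult_distrib)
  qed
  also have "\<dots> = (\<Sum>(K, R)\<in>?f ` (?L (Suc k) - {{}}). (?b K)\<^sup>2 * (?b R)\<^sup>2)"
    by (simp add: sum.reindex[OF inj])
  also have "\<dots> \<le> (\<Sum>(K, R)\<in>?C \<times> ?L k. (?b K)\<^sup>2 * (?b R)\<^sup>2)"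
    using img by (intro sum_mono2) (auto intro!: finite_cartesian_product)
  also have "\<dots> = (\<Sum>K\<in>?C. (?b K)\<^sup>2) * (\<Sum>R\<in>?L k. (?b R)\<^sup>2)"
    by (simp add: sum_product sum.cartesian_product)
  also have "\<dots> \<le> \<kappa> * (1 + \<kappa>) ^ k"
    using Suc \<kappa> \<kappa>0 by (intro mult_mono sum_nonneg) auto
  also have "1 + \<kappa> * (1 + \<kappa>) ^ k \<le> (1 + \<kappa>) ^ Suc k"
    using \<kappa>0 by (simp add: algebra_simps)
  finally show ?case by simp
qed

text \<open>
  There are at most \<open>n ^ k\<close> vertex sets of size \<open>k\<close>, so each size contributes at most a constant:
  a set of at most \<open>v\<close> vertices has at most \<open>2 ^ 2 ^ v\<close> families of subsets.
\<close>

lemma sum_edge_sets_le: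
  assumes n: "0 < n" and \<C>: "\<And>K. K \<in> \<C> \<Longrightarrow> K \<subseteq> potential_edges n \<and> card (\<Union>K) \<le> v"
  shows "(\<Sum>K\<in>\<C>. (1 / real n) ^ card (\<Union>K)) \<le> (v + 1) * 2 ^ 2 ^ v"
proof -
  define \<U> where "\<U> = {U. U \<subseteq> {1..n} \<and> card U \<le> v}"
  have fin\<U>: "finite \<U>" by (rule finite_subset[of _ "Pow {1..n}"]) (auto simp: \<U>_def)
  have "\<C> \<subseteq> Pow (potential_edges n)" using \<C> by blast
  hence fin\<C>: "finite \<C>" by (rule finite_subset) (simp add: finite_potential_edges)
  have img: "Union ` \<C> \<subseteq> \<U>"
  proof (rule image_subsetI)
    fix K assume "K \<in> \<C>"
    thus "\<Union>K \<in> \<U>" using \<C>[of K] finite_edge_set(3)[of K n] by (simp add: \<U>_def)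
  qed
  have "(\<Sum>K\<in>\<C>. (1 / real n) ^ card (\<Union>K))
      = (\<Sum>U\<in>\<U>. \<Sum>K\<in>{K \<in> \<C>. \<Union>K = U}. (1 / real n) ^ card (\<Union>K))"
    by (rule sum.group[OF fin\<C> fin\<U> img, symmetric])
  also have "\<dots> \<le> (\<Sum>U\<in>\<U>. 2 ^ 2 ^ v * (1 / real n) ^ card U)"
  proof (rule sum_mono)
    fix U assume U: "U \<in> \<U>"
    hence finU: "finite U" by (auto simp: \<U>_def intro: finite_subset)
    have "card {K \<in> \<C>. \<Union>K = U} \<le> card (Pow (Pow U))"
      using finU by (intro card_mono) (simp, blast)
    also have "\<dots> = 2 ^ 2 ^ card U" using finU by (simp add: card_Pow)
    also have "\<dots> \<le> 2 ^ 2 ^ v" using U by (intro power_increasing) (simp_all add: \<U>_def)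
    finally have "real (card {K \<in> \<C>. \<Union>K = U}) \<le> real (2 ^ 2 ^ v)"
      by (rule of_nat_mono)
    hence "real (card {K \<in> \<C>. \<Union>K = U}) \<le> 2 ^ 2 ^ v"
      by (simp only: of_nat_power of_nat_numeral)
    moreover have "(\<Sum>K\<in>{K \<in> \<C>. \<Union>K = U}. (1 / real n) ^ card (\<Union>K))
        = real (card {K \<in> \<C>. \<Union>K = U}) * (1 / real n) ^ card U" by simp
    ultimately show "(\<Sum>K\<in>{K \<in> \<C>. \<Union>K = U}. (1 / real n) ^ card (\<Union>K)) \<le> 2 ^ 2 ^ v * (1 / real n) ^ card U"
      by (simp only:) (intro mult_right_mono; simp)
  qed
  also have "\<dots> = 2 ^ 2 ^ v * (\<Sum>U\<in>\<U>. (1 / real n) ^ card U)"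
    by (simp add: sum_distrib_left)
  also have "(\<Sum>U\<in>\<U>. (1 / real n) ^ card U) = (\<Sum>k\<in>{..v}. \<Sum>U\<in>{U \<in> \<U>. card U = k}. (1 / real n) ^ card U)"
    by (rule sum.group[OF fin\<U>, symmetric]) (auto simp: \<U>_def)
  also have "\<dots> \<le> (\<Sum>k\<in>{..v}. 1)"
  proof (rule sum_mono)
    fix k assume k: "k \<in> {..v}"
    hence "{U \<in> \<U>. card U = k} = {U. U \<subseteq> {1..n} \<and> card U = k}" by (auto simp: \<U>_def)
    hence "card {U \<in> \<U>. card U = k} = n choose k" using n_subsets[of "{1..n}" k] by simp
    hence "card {U \<in> \<U>. card U = k} \<le> n ^ k"
      by (cases "k \<le> n") (simp_all add: binomial_le_pow binomial_eq_0)
    hence "real (card {U \<in> \<U>. card U = k}) \<le> real n ^ k"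
      by (simp flip: of_nat_power)
    thus "(\<Sum>U\<in>{U \<in> \<U>. card U = k}. (1 / real n) ^ card U) \<le> 1"
      using n by (simp add: power_divide pos_divide_le_eq)
  qed
  finally show ?thesis by (simp add: algebra_simps)
qed

text \<open>
  The shift that planting causes in the expected degree of a vertex, in units of the standard
  deviation of a degree under the null distribution (up to the difference between \<open>n\<close> and
  \<open>n - 1\<close>).
\<close>

abbreviation scaled_degree :: "nat \<Rightarrow> real \<Rightarrow> 'a graph \<Rightarrow> 'a \<Rightarrow> real" where
  "scaled_degree n p H y \<equiv> tilt p * vertex_degree H y / sqrt n"

text \<open>
  A connected edge set with \<open>j + 1\<close> vertices has at least \<open>j\<close> edges, and at most as many
  homomorphisms as the star with \<open>j\<close> edges. The surplus edges only cost powers of \<open>tilt p\<close>, which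
  is where an upper bound on \<open>tilt p\<close>, that is, a lower bound on \<open>p\<close>, enters.
\<close>

lemma connected_hom_weight_le:
  assumes p: "0 < p" "p < 1" and H: "simple_graph H" and n: "0 < n"
    and r: "tilt p \<le> r" "1 \<le> r" and W: "0 \<le> W"
    and moments: "\<And>j. 1 \<le> j \<Longrightarrow> j \<le> D \<Longrightarrow> (\<Sum>y\<in>fst H. scaled_degree n p H y ^ j) \<le> W * sqrt n"
    and K: "K \<in> low_degree_sets n D" "edge_connected K"
  shows "(hom_weight n p H K)\<^sup>2 \<le> r ^ (2 * D) * (D + 1)\<^sup>2 * W\<^sup>2 * (1 / real n) ^ card (\<Union>K)"
proof -
  have Kp: "K \<subseteq> potential_edges n" "card K \<le> D" using K by (auto simp: low_degree_sets_def)
  note fin = finite_edge_set[OF Kp(1)]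
  obtain e where e: "e \<in> K" using K(2) by (auto simp: edge_connected_def)
  have "card e \<le> card (\<Union>K)" using fin(2) e by (intro card_mono) auto
  hence v2: "2 \<le> card (\<Union>K)" using fin(4)[OF e] by simp
  have vK: "card (\<Union>K) \<le> card K + 1" by (rule card_Union_le_card_Suc[OF K(2) fin(1,2)]) (rule fin(4))
  define j where "j = card (\<Union>K) - 1"
  have v: "card (\<Union>K) = Suc j" and j: "1 \<le> j" "j \<le> D" "j \<le> card K"
    using v2 vK Kp(2) by (auto simp: j_def)
  have t: "0 < tilt p" by (rule tilt_pos[OF p])
  have "tilt p ^ card K = tilt p ^ j * tilt p ^ (card K - j)" using j by (simp flip: power_add)
  also have "\<dots> \<le> tilt p ^ j * r ^ D"
  proof (intro mult_left_mono)
    have "tilt p ^ (card K - j) \<le> r ^ (card K - j)" using t r by (intro power_mono) auto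
    also have "\<dots> \<le> r ^ D" using r Kp(2) by (intro power_increasing) auto
    finally show "tilt p ^ (card K - j) \<le> r ^ D" .
  qed (use t in simp)
  finally have tK: "tilt p ^ card K \<le> tilt p ^ j * r ^ D" .
  have "card (homs K H) \<le> card (\<Union>K) * (\<Sum>y\<in>fst H. vertex_degree H y ^ (card (\<Union>K) - 1))"
    by (rule card_connected_homs_le[OF H K(2) fin(2) fin(4)])
  hence "card (homs K H) \<le> Suc j * (\<Sum>y\<in>fst H. vertex_degree H y ^ j)" by (simp only: v diff_Suc_1)
  also have "\<dots> \<le> (D + 1) * (\<Sum>y\<in>fst H. vertex_degree H y ^ j)" using j by (intro mult_right_mono) auto
  finally have "real (card (homs K H)) \<le> real ((D + 1) * (\<Sum>y\<in>fst H. vertex_degree H y ^ j))"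
    by (simp only: of_nat_le_iff)
  hence homs: "real (card (homs K H)) \<le> (D + 1) * (\<Sum>y\<in>fst H. real (vertex_degree H y) ^ j)"
    by (simp add: algebra_simps)
  have "tilt p ^ card K * card (homs K H)
      \<le> (tilt p ^ j * r ^ D) * ((D + 1) * (\<Sum>y\<in>fst H. real (vertex_degree H y) ^ j))"
    using tK homs t r by (intro mult_mono) auto
  also have "\<dots> = r ^ D * (D + 1) * (sqrt n ^ j * (\<Sum>y\<in>fst H. scaled_degree n p H y ^ j))"
    using n by (simp add: power_divide power_mult_distrib sum_distrib_left mult_ac)
  also have "\<dots> \<le> r ^ D * (D + 1) * (sqrt n ^ j * (W * sqrt n))"
    using moments[OF j(1,2)] r by (intro mult_left_mono) auto
  also have "\<dots> = r ^ D * (D + 1) * W * sqrt n ^ Suc j" by simp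
  finally have "hom_weight n p H K \<le> r ^ D * (D + 1) * W * sqrt n ^ Suc j / n ^ Suc j"
    unfolding hom_weight_def v by (rule divide_right_mono) simp
  hence "(hom_weight n p H K)\<^sup>2 \<le> (r ^ D * (D + 1) * W * sqrt n ^ Suc j / n ^ Suc j)\<^sup>2"
    by (rule power_mono) (rule hom_weight_nonneg[OF p])
  also have "\<dots> = r ^ (2 * D) * (D + 1)\<^sup>2 * W\<^sup>2 * ((sqrt n)\<^sup>2 ^ Suc j / (real n ^ Suc j)\<^sup>2)"
  proof -
    have "(r ^ D)\<^sup>2 = r ^ (2 * D)" "(sqrt n ^ Suc j)\<^sup>2 = (sqrt n)\<^sup>2 ^ Suc j"
      by (simp_all only: power_mult[symmetric] mult.commute[of _ 2])
    thus ?thesis by (simp only: power_mult_distrib power_divide times_divide_eq_right of_nat_power)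
  qed
  also have "(sqrt n)\<^sup>2 ^ Suc j / (real n ^ Suc j)\<^sup>2 = (1 / real n) ^ card (\<Union>K)"
    using n by (simp add: v power_divide power2_eq_square)
  finally show ?thesis .
qed

text \<open>
  The weight of a connected edge set on \<open>v\<close> vertices carries a factor \<open>1 / n ^ v\<close>, which cancels
  the number of such sets. Hence the connected sets contribute \<open>O(W\<^sup>2)\<close>, and all sets together a
  polynomial in \<open>W\<close>.
\<close>

lemma advantage_le:
  assumes p: "0 < p" "p < 1" and H: "simple_graph H" "card (fst H) \<le> n" and n: "0 < n" "4 * D \<le> n"
    and r: "tilt p \<le> r" "1 \<le> r" and W: "0 \<le> W"
    and moments: "\<And>j. 1 \<le> j \<Longrightarrow> j \<le> D \<Longrightarrow> (\<Sum>y\<in>fst H. scaled_degree n p H y ^ j) \<le> W * sqrt n"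
  shows "advantage n p H D
    \<le> 16 ^ D * (1 + r ^ (2 * D) * (D + 1)\<^sup>2 * ((D + 2) * 2 ^ 2 ^ (D + 1)) * W\<^sup>2) ^ D"
proof -
  let ?b = "hom_weight n p H" and ?L = "low_degree_sets n D"
  let ?C = "{K \<in> ?L. edge_connected K}"
  have V: "finite (fst H)" using H by (simp add: simple_graph_def)
  let ?c = "r ^ (2 * D) * (D + 1)\<^sup>2 * W\<^sup>2"
  have "(\<Sum>K\<in>?C. (?b K)\<^sup>2) \<le> (\<Sum>K\<in>?C. ?c * (1 / real n) ^ card (\<Union>K))"
    using connected_hom_weight_le[OF p H(1) n(1) r W moments] by (intro sum_mono) simp
  also have "\<dots> = ?c * (\<Sum>K\<in>?C. (1 / real n) ^ card (\<Union>K))" by (simp add: sum_distrib_left)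
  also have "\<dots> \<le> ?c * ((D + 1 + 1) * 2 ^ 2 ^ (D + 1))"
  proof (intro mult_left_mono)
    show "(\<Sum>K\<in>?C. (1 / real n) ^ card (\<Union>K)) \<le> (D + 1 + 1) * 2 ^ 2 ^ (D + 1)"
    proof (rule order_trans[OF sum_edge_sets_le[OF n(1)]])
      fix K assume K: "K \<in> ?C"
      hence Kp: "K \<subseteq> potential_edges n" "card K \<le> D" by (auto simp: low_degree_sets_def)
      note fin = finite_edge_set[OF Kp(1)]
      have "card (\<Union>K) \<le> card K + 1"
        by (rule card_Union_le_card_Suc[OF _ fin(1,2)]) (use K fin(4) in auto)
      thus "K \<subseteq> potential_edges n \<and> card (\<Union>K) \<le> D + 1" using Kp by simp
    qed simp
  qed (use r in simp)
  finally have \<kappa>: "(\<Sum>K\<in>?C. (?b K)\<^sup>2) \<le> r ^ (2 * D) * (D + 1)\<^sup>2 * ((D + 2) * 2 ^ 2 ^ (D + 1)) * W\<^sup>2"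
    by (simp add: mult_ac)
  have "advantage n p H D \<le> (\<Sum>S\<in>?L - {{}}. (4 ^ D * ?b S)\<^sup>2)"
    unfolding advantage_def
  proof (rule sum_mono)
    fix S assume "S \<in> ?L - {{}}"
    hence S: "S \<subseteq> potential_edges n" "card S \<le> D" by (auto simp: low_degree_sets_def)
    hence S4: "4 * card S \<le> n" using n by simp
    note bounds = expectation_chi_planted_bounds[OF p H S(1) S4]
    have "(4::real) ^ card S * ?b S \<le> 4 ^ D * ?b S"
      using S(2) by (intro mult_right_mono power_increasing hom_weight_nonneg p) auto
    thus "(measure_pmf.expectation (planted n p H) (chi p S))\<^sup>2 \<le> (4 ^ D * ?b S)\<^sup>2"
      using bounds by (intro power_mono) auto
  qed
  also have "\<dots> \<le> (\<Sum>S\<in>?L. (4 ^ D * ?b S)\<^sup>2)" by (intro sum_mono2) auto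
  also have "\<dots> = 16 ^ D * (\<Sum>S\<in>?L. (?b S)\<^sup>2)"
  proof -
    have "((4::real) ^ D)\<^sup>2 = 16 ^ D" by (simp add: power2_eq_square flip: power_mult_distrib)
    thus ?thesis by (simp add: power_mult_distrib sum_distrib_left)
  qed
  also have "\<dots> \<le> 16 ^ D * (1 + r ^ (2 * D) * (D + 1)\<^sup>2 * ((D + 2) * 2 ^ 2 ^ (D + 1)) * W\<^sup>2) ^ D"
    by (intro mult_left_mono hom_weight_sum_le[OF p V order_refl \<kappa>]) simp
  finally show ?thesis .
qed

section \<open>Signed stars\<close>

definition edge_stars :: "nat \<Rightarrow> 'b set set \<Rightarrow> 'b set set set" where
  "edge_stars t E = {S. S \<subseteq> E \<and> card S = t \<and> (\<exists>c. \<forall>e\<in>S. c \<in> e)}"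

lemma finite_edge_stars: "finite E \<Longrightarrow> finite (edge_stars t E)"
  by (rule finite_subset[of _ "Pow E"]) (auto simp: edge_stars_def)

lemma star_eq: "star t = ({0..t}, (\<lambda>i. {0, i}) ` {1..t})"
  by (simp only: star_def Setcompr_eq_image)

text \<open>
  This description of stars as edge sets with a common vertex replaces the isomorphism condition
  in all counting arguments.
\<close>

lemma graph_iso_star_iff:
  assumes t: "1 \<le> t" and S: "S \<subseteq> potential_edges n"
  shows "graph_iso (\<Union>S, S) (star t) \<longleftrightarrow> card S = t \<and> (\<exists>c. \<forall>e\<in>S. c \<in> e)"
proof
  assume "graph_iso (\<Union>S, S) (star t)"
  then obtain \<phi> where "bij_betw \<phi> (\<Union>S) {0..t} \<and> (\<lambda>e. \<phi> ` e) ` S = (\<lambda>i. {0, i}) ` {1..t}"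
    unfolding graph_iso_def star_eq fst_conv snd_conv by (rule exE)
  note bij = conjunct1[OF this] and img = conjunct2[OF this]
  have inj: "inj_on \<phi> (\<Union>S)" using bij by (rule bij_betw_imp_inj_on)
  have "inj_on (\<lambda>e. \<phi> ` e) S"
  proof (rule inj_onI)
    fix e e' assume "e \<in> S" "e' \<in> S" "\<phi> ` e = \<phi> ` e'"
    thus "e = e'" by (metis inj_on_image_eq_iff[OF inj Union_upper Union_upper])
  qed
  hence "card S = card ((\<lambda>e. \<phi> ` e) ` S)" by (rule card_image[symmetric])
  also have "\<dots> = t"
  proof -
    have "inj_on (\<lambda>i. {0, i}) {1..t}" by (rule inj_onI) (metis doubleton_eq_iff)
    thus ?thesis unfolding img by (simp add: card_image)
  qed
  finally have card: "card S = t" .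
  obtain c where c: "c \<in> \<Union>S" "\<phi> c = 0"
  proof -
    have "0 \<in> \<phi> ` \<Union>S" unfolding bij_betw_imp_surj_on[OF bij] by simp
    then obtain c where "0 = \<phi> c" "c \<in> \<Union>S" by (rule imageE)
    thus ?thesis by (intro that[of c]) simp_all
  qed
  have "c \<in> e" if e: "e \<in> S" for e
  proof -
    have "\<phi> ` e \<in> (\<lambda>i. {0, i}) ` {1..t}" unfolding img[symmetric] using e by (rule imageI)
    hence "0 \<in> \<phi> ` e" by (elim imageE) simp
    then obtain x where x: "0 = \<phi> x" "x \<in> e" by (rule imageE)
    have "x \<in> \<Union>S" using x e by blast
    moreover have "\<phi> x = \<phi> c" unfolding c(2) by (rule x(1)[symmetric])
    ultimately have "x = c" by (intro inj_onD[OF inj _ _ c(1)])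
    thus ?thesis using x by simp
  qed
  thus "card S = t \<and> (\<exists>c. \<forall>e\<in>S. c \<in> e)" using card by blast
next
  assume "card S = t \<and> (\<exists>c. \<forall>e\<in>S. c \<in> e)"
  then obtain c where card: "card S = t" and c: "\<And>e. e \<in> S \<Longrightarrow> c \<in> e" by blast
  define L where "L = \<Union>S - {c}"
  have edge: "\<exists>i\<in>L. e = {c, i}" if e: "e \<in> S" for e
  proof -
    obtain x y where "e = {x, y}" "x \<noteq> y"
      using finite_edge_set(4)[OF S e] unfolding card_2_iff by blast
    hence "e = {c, y} \<and> y \<noteq> c \<or> e = {c, x} \<and> x \<noteq> c" using c[OF e] by auto
    thus ?thesis using e unfolding L_def by blast
  qed
  have S_eq: "S = (\<lambda>i. {c, i}) ` L"
  proof (intro equalityI subsetI)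
    fix e assume "e \<in> (\<lambda>i. {c, i}) ` L"
    then obtain i where i: "i \<in> L" "e = {c, i}" by blast
    then obtain e' where e': "e' \<in> S" "i \<in> e'" "i \<noteq> c" unfolding L_def by blast
    obtain i' where "e' = {c, i'}" using edge[OF e'(1)] by blast
    hence "e' = {c, i}" using e'(2,3) by simp
    thus "e \<in> S" using e'(1) i(2) by simp
  qed (use edge in blast)
  have finL: "finite L" using finite_edge_set(2)[OF S] by (simp add: L_def)
  have "card L = t"
  proof -
    have "inj_on (\<lambda>i. {c, i}) L" by (rule inj_onI) (metis doubleton_eq_iff)
    hence "card ((\<lambda>i. {c, i}) ` L) = card L" by (rule card_image)
    thus ?thesis using card S_eq by metis
  qed
  then obtain h where h: "bij_betw h L {1..t}"
    using finite_same_card_bij[OF finL, of "{1..t}"] by auto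
  define \<phi> where "\<phi> = (\<lambda>x. if x = c then 0 else h x)"
  have "S \<noteq> {}" using card t by auto
  hence "c \<in> \<Union>S" using c by blast
  hence US: "\<Union>S = insert c L" unfolding L_def by blast
  have cL: "c \<notin> L" by (simp add: L_def)
  have "bij_betw \<phi> L {1..t}"
    using h by (rule bij_betw_cong[THEN iffD1, rotated]) (auto simp: \<phi>_def cL)
  moreover have "insert 0 {1..t} = {0..t}" by auto
  ultimately have "bij_betw \<phi> (\<Union>S) {0..t}"
    unfolding US using notIn_Un_bij_betw[of c L \<phi> "{1..t}"] cL by (simp add: \<phi>_def)
  moreover have "(\<lambda>e. \<phi> ` e) ` S = (\<lambda>i. {0, i}) ` {1..t}"
  proof -
    have "(\<lambda>e. \<phi> ` e) ` S = (\<lambda>i. {0, i}) ` (h ` L)"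
      unfolding S_eq image_image using cL by (intro image_cong) (auto simp: \<phi>_def)
    also have "h ` L = {1..t}" using h by (rule bij_betw_imp_surj_on)
    finally show ?thesis .
  qed
  ultimately show "graph_iso (\<Union>S, S) (star t)"
    unfolding graph_iso_def star_eq fst_conv snd_conv by (intro exI[of _ \<phi>] conjI)
qed

lemma signed_stars_eq:
  assumes "1 \<le> t"
  shows "signed_stars t n p G = (\<Sum>S\<in>edge_stars t (potential_edges n). chi p S G)"
  unfolding signed_stars_def signed_count_def edge_stars_def
  by (intro sum.cong Collect_cong refl) (use graph_iso_star_iff[OF assms] in blast)

text \<open>
  A star is a set of edges with a common vertex, so the stars with centre \<open>c\<close> are the \<open>t\<close>-element
  subsets of the edges at \<open>c\<close>. Each star is counted at most twice, because its centre is on any of its edges.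
\<close>

lemma sum_degree_choose_le:
  assumes H: "simple_graph H" and t: "1 \<le> t"
  shows "(\<Sum>c\<in>fst H. vertex_degree H c choose t) \<le> 2 * card (edge_stars t (snd H))"
proof -
  have V: "finite (fst H)" and E: "snd H \<subseteq> nsets (fst H) 2" using H by (auto simp: simple_graph_def)
  have finE: "finite (snd H)" using E by (rule finite_subset) (simp add: V)
  define B where "B c = {S. S \<subseteq> {e \<in> snd H. c \<in> e} \<and> card S = t}" for c
  define pick where "pick S = (SOME e. e \<in> S)" for S :: "'a set set"
  have pick: "pick S \<in> S" if "S \<in> edge_stars t (snd H)" for S
  proof -
    have "S \<noteq> {}" using that t by (auto simp: edge_stars_def)
    thus ?thesis unfolding pick_def by (simp add: some_in_eq)
  qed
  have pick2: "finite (pick S)" "card (pick S) = 2" if "S \<in> edge_stars t (snd H)" for S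
    using pick[OF that] that E by (auto simp: edge_stars_def nsets_def)
  have finB: "finite (B c)" for c
    by (rule finite_subset[of _ "Pow (snd H)"]) (auto simp: B_def finE)
  have "(\<Sum>c\<in>fst H. vertex_degree H c choose t) = (\<Sum>c\<in>fst H. card (B c))"
    unfolding vertex_degree_def B_def using finE by (intro sum.cong refl) (simp add: n_subsets)
  also have "\<dots> = card (Sigma (fst H) B)" using V finB by (intro card_SigmaI[symmetric]) auto
  also have "\<dots> \<le> card (Sigma (edge_stars t (snd H)) pick)"
  proof (rule card_inj_on_le)
    show "inj_on prod.swap (Sigma (fst H) B)" by simp
    show "prod.swap ` Sigma (fst H) B \<subseteq> Sigma (edge_stars t (snd H)) pick"
    proof clarsimp
      fix c S assume "c \<in> fst H" and S: "S \<in> B c"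
      have "S \<in> edge_stars t (snd H)" using S by (auto simp: B_def edge_stars_def)
      moreover from pick[OF this] have "c \<in> pick S" using S by (auto simp: B_def)
      ultimately show "S \<in> edge_stars t (snd H) \<and> c \<in> pick S" by simp
    qed
    show "finite (Sigma (edge_stars t (snd H)) pick)"
      using finite_edge_stars[OF finE] pick2(1) by (intro finite_SigmaI) auto
  qed
  also have "\<dots> = (\<Sum>S\<in>edge_stars t (snd H). card (pick S))"
    using finite_edge_stars[OF finE] pick2(1) by (intro card_SigmaI) auto
  also have "\<dots> = 2 * card (edge_stars t (snd H))" using pick2(2) by simp
  finally show ?thesis .
qed

lemma card_edge_stars_image:
  assumes inj: "inj_on \<phi> V" and E: "\<And>e. e \<in> E \<Longrightarrow> e \<subseteq> V" and t: "1 \<le> t"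
  shows "card (edge_stars t ((`) \<phi> ` E)) = card (edge_stars t E)"
proof -
  have inj1: "inj_on ((`) \<phi>) E"
    by (rule inj_onI) (use inj_on_image_eq_iff[OF inj] E in blast)
  have inj2: "inj_on ((`) ((`) \<phi>)) (edge_stars t E)"
    by (rule inj_onI) (use inj_on_image_eq_iff[OF inj1] in \<open>auto simp: edge_stars_def\<close>)
  have "edge_stars t ((`) \<phi> ` E) = (`) ((`) \<phi>) ` edge_stars t E"
  proof (intro equalityI subsetI)
    fix T assume T: "T \<in> (`) ((`) \<phi>) ` edge_stars t E"
    then obtain S where S: "S \<subseteq> E" "card S = t" "\<exists>c. \<forall>e\<in>S. c \<in> e" "T = (`) \<phi> ` S"
      by (auto simp: edge_stars_def)
    have "card T = t" unfolding S(4) using S(1,2) inj1 by (simp add: card_image inj_on_subset)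
    thus "T \<in> edge_stars t ((`) \<phi> ` E)" using S by (auto simp: edge_stars_def)
  next
    fix T assume "T \<in> edge_stars t ((`) \<phi> ` E)"
    then obtain c' where T: "T \<subseteq> (`) \<phi> ` E" "card T = t" and c': "\<And>e. e \<in> T \<Longrightarrow> c' \<in> e"
      by (auto simp: edge_stars_def)
    from T(1) obtain S where S: "S \<subseteq> E" "T = (`) \<phi> ` S" by (auto simp: subset_image_iff)
    have card: "card S = t" using T(2) unfolding S(2) using S(1) inj1 by (simp add: card_image inj_on_subset)
    then obtain e0 where e0: "e0 \<in> S" using t by (metis card.empty ex_in_conv not_one_le_zero)
    hence "c' \<in> \<phi> ` e0" using c' S(2) by blast
    then obtain c where c: "c \<in> e0" "c' = \<phi> c" by blast
    have "c \<in> e" if e: "e \<in> S" for e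
    proof -
      have "c' \<in> \<phi> ` e" using c' S(2) e by blast
      then obtain x where x: "x \<in> e" "\<phi> c = \<phi> x" using c by auto
      moreover have "c \<in> V" "x \<in> V" using c x e e0 E S(1) by blast+
      ultimately have "c = x" using inj by (auto dest: inj_onD)
      thus ?thesis using x by simp
    qed
    thus "T \<in> (`) ((`) \<phi>) ` edge_stars t E" using S card by (auto simp: edge_stars_def)
  qed
  thus ?thesis by (simp add: card_image[OF inj2])
qed

lemma card_edges_at_le: "card {e \<in> potential_edges n. c \<in> e} \<le> n"
proof -
  have "{e \<in> potential_edges n. c \<in> e} \<subseteq> (\<lambda>i. {c, i}) ` {1..n}"
  proof
    fix e assume e: "e \<in> {e \<in> potential_edges n. c \<in> e}"
    hence "e \<in> nsets {1..n} 2" by blast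
    then obtain x y where "e = {x, y}" "x \<in> {1..n}" "y \<in> {1..n}" unfolding nsets_2_eq by blast
    thus "e \<in> (\<lambda>i. {c, i}) ` {1..n}" using e by (cases "c = x") auto
  qed
  hence "card {e \<in> potential_edges n. c \<in> e} \<le> card ((\<lambda>i. {c, i}) ` {1..n})"
    by (rule card_mono[rotated]) simp
  also have "\<dots> \<le> card {1..n}" by (rule card_image_le) simp
  finally show ?thesis by simp
qed

lemma choose_le_power: "(n choose k) \<le> n ^ k"
  by (cases "k \<le> n") (simp_all add: binomial_le_pow binomial_eq_0)

lemma card_edge_stars_complete_le:
  assumes t: "1 \<le> t"
  shows "card (edge_stars t (potential_edges n)) \<le> n ^ (t + 1)"
proof -
  let ?B = "\<lambda>c. {S. S \<subseteq> {e \<in> potential_edges n. c \<in> e} \<and> card S = t}"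
  have fin: "finite (?B c)" for c
    by (rule finite_subset[of _ "Pow (potential_edges n)"]) (use finite_potential_edges in auto)
  have "edge_stars t (potential_edges n) \<subseteq> (\<Union>c\<in>{1..n}. ?B c)"
  proof
    fix S assume "S \<in> edge_stars t (potential_edges n)"
    then obtain c where S: "S \<subseteq> potential_edges n" "card S = t" and c: "\<And>e. e \<in> S \<Longrightarrow> c \<in> e"
      by (auto simp: edge_stars_def)
    obtain e where "e \<in> S" using S(2) t by (metis card.empty ex_in_conv not_one_le_zero)
    hence "c \<in> {1..n}" using c finite_edge_set(3)[OF S(1)] by blast
    thus "S \<in> (\<Union>c\<in>{1..n}. ?B c)" using S c by blast
  qed
  hence "card (edge_stars t (potential_edges n)) \<le> card (\<Union>c\<in>{1..n}. ?B c)"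
    using fin by (intro card_mono) auto
  also have "\<dots> \<le> (\<Sum>c\<in>{1..n}. card (?B c))" by (rule card_UN_le) simp
  also have "\<dots> \<le> (\<Sum>c\<in>{1..n}. n ^ t)"
  proof (rule sum_mono)
    fix c
    have "card (?B c) = card {e \<in> potential_edges n. c \<in> e} choose t"
      using finite_potential_edges by (intro n_subsets) auto
    also have "\<dots> \<le> card {e \<in> potential_edges n. c \<in> e} ^ t" by (rule choose_le_power)
    also have "\<dots> \<le> n ^ t" by (intro power_mono card_edges_at_le) simp
    finally show "card (?B c) \<le> n ^ t" .
  qed
  finally show ?thesis by simp
qed

text \<open>
  For a fixed position \<open>M\<close> of the planted graph, the signed star count is its mean plus a sum over
  the nonempty parts \<open>U\<close> of stars outside \<open>M\<close>. The coefficient of \<open>U\<close> collects the stars that complete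
  \<open>U\<close> inside \<open>M\<close>; their centres lie on every edge of \<open>U\<close>, which leaves at most two
  centres.
\<close>

lemma star_variance_given_position:
  fixes n t :: nat and p :: real and M :: "nat set set"
  defines "x \<equiv> scaled_degree n p ({1..n}, M)"
  assumes p: "0 < p" "p < 1" and n: "0 < n" and t: "1 \<le> t" and M: "M \<subseteq> potential_edges n"
  shows "measure_pmf.expectation (erdos_renyi n p)
           (\<lambda>G. (signed_stars t n p (plant M G) - tilt p ^ t * card (edge_stars t M))\<^sup>2)
         \<le> 2 * real n ^ t * (\<Sum>c\<in>{1..n}. \<Sum>i<t. x c ^ (2 * i))"
proof -
  let ?E = "potential_edges n" and ?r = "tilt p"
  define F where "F = edge_stars t ?E"
  define edges_at where "edges_at c X = {e \<in> X. c \<in> e}" for c :: nat and X :: "nat set set"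
  define d where "d c = card (edges_at c M)" for c
  define \<U> where "\<U> = Pow ?E - {{}}"
  \<comment> \<open>\<open>A U\<close> is the coefficient of \<open>U\<close>, and \<open>a c U\<close> the contribution of the stars with centre \<open>c\<close>.\<close>
  define A where "A U = (\<Sum>S\<in>{S \<in> F. S - M = U}. ?r ^ card (S \<inter> M))" for U
  define B where "B c U = {S. S \<subseteq> edges_at c ?E \<and> card S = t \<and> S - M = U}" for c U
  define a where "a c U = (\<Sum>S\<in>B c U. ?r ^ card (S \<inter> M))" for c U
  have r: "0 < ?r" by (rule tilt_pos[OF p])
  have finE: "finite ?E" by (rule finite_potential_edges)
  have finM: "finite M" using M finE by (rule finite_subset)
  have finF: "finite F" unfolding F_def by (rule finite_edge_stars[OF finE])
  have fin\<U>: "finite \<U>" using finE by (simp add: \<U>_def del: One_nat_def)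
  have fin_at: "finite (edges_at c X)" if "finite X" for c X using that by (simp add: edges_at_def)
  have finB: "finite (B c U)" for c U
    by (rule finite_subset[of _ "Pow ?E"]) (use finE in \<open>auto simp: B_def edges_at_def\<close>)
  have F_sub: "S \<subseteq> ?E" "finite S" "card S = t" if "S \<in> F" for S
    using that finite_subset[OF _ finE] by (auto simp: F_def edge_stars_def)
  have inside: "{S \<in> F. S \<subseteq> M} = edge_stars t M" using M by (auto simp: F_def edge_stars_def)
  have "signed_stars t n p (plant M G) - ?r ^ t * card (edge_stars t M) = (\<Sum>U\<in>\<U>. A U * chi p U G)" for G
  proof -
    have "signed_stars t n p (plant M G) = (\<Sum>S\<in>F. ?r ^ card (S \<inter> M) * chi p (S - M) G)"
      unfolding signed_stars_eq[OF t] F_def[symmetric]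
      by (intro sum.cong refl chi_plant p F_sub(2))
    also have "\<dots> = (\<Sum>S\<in>{S \<in> F. S \<subseteq> M}. ?r ^ card (S \<inter> M) * chi p (S - M) G)
                  + (\<Sum>S\<in>{S \<in> F. \<not> S \<subseteq> M}. ?r ^ card (S \<inter> M) * chi p (S - M) G)"
      using finF by (subst sum.union_disjoint[symmetric]) (auto intro!: sum.cong)
    also have "(\<Sum>S\<in>{S \<in> F. S \<subseteq> M}. ?r ^ card (S \<inter> M) * chi p (S - M) G) = (\<Sum>S\<in>{S \<in> F. S \<subseteq> M}. ?r ^ t)"
    proof (rule sum.cong[OF refl])
      fix S assume "S \<in> {S \<in> F. S \<subseteq> M}"
      hence "S \<inter> M = S" "S - M = {}" "card S = t" using F_sub(3) by auto
      thus "?r ^ card (S \<inter> M) * chi p (S - M) G = ?r ^ t"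
        by (simp only: chi_def prod.empty mult_1_right)
    qed
    also have "\<dots> = ?r ^ t * card (edge_stars t M)" unfolding inside by simp
    also have "(\<Sum>S\<in>{S \<in> F. \<not> S \<subseteq> M}. ?r ^ card (S \<inter> M) * chi p (S - M) G)
        = (\<Sum>U\<in>\<U>. \<Sum>S\<in>{S \<in> {S \<in> F. \<not> S \<subseteq> M}. S - M = U}. ?r ^ card (S \<inter> M) * chi p (S - M) G)"
    proof (rule sum.group[symmetric])
      show "(\<lambda>S. S - M) ` {S \<in> F. \<not> S \<subseteq> M} \<subseteq> \<U>"
        using F_sub(1) by (fastforce simp: \<U>_def simp del: One_nat_def)
    qed (use finF fin\<U> in auto)
    also have "\<dots> = (\<Sum>U\<in>\<U>. A U * chi p U G)"
    proof (rule sum.cong[OF refl])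
      fix U assume "U \<in> \<U>"
      hence "{S \<in> {S \<in> F. \<not> S \<subseteq> M}. S - M = U} = {S \<in> F. S - M = U}" by (auto simp: \<U>_def)
      thus "(\<Sum>S\<in>{S \<in> {S \<in> F. \<not> S \<subseteq> M}. S - M = U}. ?r ^ card (S \<inter> M) * chi p (S - M) G) = A U * chi p U G"
        by (simp add: A_def sum_distrib_right)
    qed
    finally show ?thesis by simp
  qed
  hence "measure_pmf.expectation (erdos_renyi n p)
           (\<lambda>G. (signed_stars t n p (plant M G) - ?r ^ t * card (edge_stars t M))\<^sup>2) = (\<Sum>U\<in>\<U>. (A U)\<^sup>2)"
    using expectation_chi_sum_square[OF p, of \<U> n A] by (simp add: \<U>_def)
  also have "\<dots> \<le> (\<Sum>U\<in>\<U>. 2 * (\<Sum>c\<in>{1..n}. (a c U)\<^sup>2))"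
  proof (rule sum_mono)
    fix U assume U: "U \<in> \<U>"
    then obtain e where e: "e \<in> U" "e \<in> ?E" unfolding \<U>_def by blast
    then obtain y z where yz: "e = {y, z}" "y \<noteq> z" "y \<in> {1..n}" "z \<in> {1..n}"
      unfolding nsets_2_eq by blast
    have "{S \<in> F. S - M = U} \<subseteq> B y U \<union> B z U"
    proof
      fix S assume S: "S \<in> {S \<in> F. S - M = U}"
      then obtain c where c: "\<And>e. e \<in> S \<Longrightarrow> c \<in> e" by (auto simp: F_def edge_stars_def)
      have "S \<in> B c U" using S c F_sub[of S] by (auto simp: B_def edges_at_def)
      moreover have "c \<in> e" using S e(1) c by blast
      ultimately show "S \<in> B y U \<union> B z U" using yz(1) by auto
    qed
    hence "A U \<le> (\<Sum>S\<in>B y U \<union> B z U. ?r ^ card (S \<inter> M))"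
      unfolding A_def using finB r by (intro sum_mono2) auto
    also have "\<dots> \<le> a y U + a z U"
      unfolding a_def using finB r by (subst sum_Un) (auto intro!: sum_nonneg)
    finally have A: "A U \<le> a y U + a z U" .
    have "0 \<le> A U" unfolding A_def using r by (intro sum_nonneg) auto
    hence "(A U)\<^sup>2 \<le> (a y U + a z U)\<^sup>2" using A by (intro power_mono)
    also have "\<dots> \<le> 2 * ((a y U)\<^sup>2 + (a z U)\<^sup>2)"
      using zero_le_power2[of "a y U - a z U"] by (simp add: power2_eq_square algebra_simps)
    also have "(a y U)\<^sup>2 + (a z U)\<^sup>2 = (\<Sum>c\<in>{y, z}. (a c U)\<^sup>2)" using yz(2) by simp
    also have "\<dots> \<le> (\<Sum>c\<in>{1..n}. (a c U)\<^sup>2)" using yz(3,4) by (intro sum_mono2) auto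
    finally show "(A U)\<^sup>2 \<le> 2 * (\<Sum>c\<in>{1..n}. (a c U)\<^sup>2)" by simp
  qed
  also have "\<dots> = 2 * (\<Sum>c\<in>{1..n}. \<Sum>U\<in>\<U>. (a c U)\<^sup>2)"
    by (simp only: sum_distrib_left[symmetric]) (simp only: sum.swap[of _ \<U>])
  also have "(\<Sum>c\<in>{1..n}. \<Sum>U\<in>\<U>. (a c U)\<^sup>2) \<le> (\<Sum>c\<in>{1..n}. real n ^ t * (\<Sum>i<t. x c ^ (2 * i)))"
  proof (rule sum_mono)
    fix c
    define \<W> where "\<W> = {U. U \<subseteq> edges_at c ?E \<and> card U \<in> {1..t}}"
    have fin\<W>: "finite \<W>"
      by (rule finite_subset[of _ "Pow ?E"]) (use finE in \<open>auto simp: \<W>_def edges_at_def\<close>)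
    have zero: "a c U = 0" if "U \<in> \<U> - \<W>" for U
    proof -
      have "B c U = {}"
      proof (rule ccontr)
        assume "B c U \<noteq> {}"
        then obtain S where S: "S \<subseteq> edges_at c ?E" "card S = t" "S - M = U" by (auto simp: B_def)
        have finS: "finite S" using S(1) fin_at[OF finE] by (rule finite_subset)
        have "U \<noteq> {}" using that by (simp add: \<U>_def)
        moreover have "finite U" using finS S(3) by auto
        ultimately have "1 \<le> card U" by (simp add: Suc_le_eq card_gt_0_iff)
        moreover have "card U \<le> t" unfolding S(2)[symmetric] using S(3) finS by (intro card_mono) auto
        ultimately have "U \<in> \<W>" using S by (auto simp: \<W>_def)
        thus False using that by simp
      qed
      thus ?thesis by (simp add: a_def)
    qed
    \<comment> \<open>A star with centre \<open>c\<close> and outer part \<open>U\<close> is completed by planted edges at \<open>c\<close>.\<close>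
    have a_le: "(a c U)\<^sup>2 \<le> (?r * d c) ^ (2 * (t - card U))" if U: "U \<in> \<W>" for U
    proof -
      let ?k = "t - card U"
      have split: "card (S \<inter> M) = ?k" if "S \<in> B c U" for S
      proof -
        have S: "S \<subseteq> edges_at c ?E" "card S = t" "S - M = U" using that by (auto simp: B_def)
        have finS: "finite S" using S(1) fin_at[OF finE] by (rule finite_subset)
        have "card S = card (S - M) + card (S \<inter> M)"
          using finS by (metis Diff_Diff_Int Diff_subset card_Diff_subset card_mono finite_Diff le_add_diff_inverse)
        thus ?thesis using S by simp
      qed
      have "card (B c U) \<le> card {W. W \<subseteq> edges_at c M \<and> card W = ?k}"
      proof (rule card_inj_on_le)
        show "inj_on (\<lambda>S. S \<inter> M) (B c U)"
        proof (rule inj_onI)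
          fix S T assume "S \<in> B c U" "T \<in> B c U" "S \<inter> M = T \<inter> M"
          thus "S = T" by (auto simp: B_def)
        qed
        show "(\<lambda>S. S \<inter> M) ` B c U \<subseteq> {W. W \<subseteq> edges_at c M \<and> card W = ?k}"
          using split by (auto simp: B_def edges_at_def)
        show "finite {W. W \<subseteq> edges_at c M \<and> card W = ?k}"
          by (rule finite_subset[of _ "Pow M"]) (use finM in \<open>auto simp: edges_at_def\<close>)
      qed
      also have "\<dots> = d c choose ?k" unfolding d_def by (rule n_subsets[OF fin_at[OF finM]])
      also have "\<dots> \<le> d c ^ ?k" by (rule choose_le_power)
      finally have "real (card (B c U)) \<le> real (d c) ^ ?k" by (simp flip: of_nat_power)
      moreover have "a c U = real (card (B c U)) * ?r ^ ?k" unfolding a_def using split by simp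
      ultimately have "a c U \<le> (?r * d c) ^ ?k"
        using r by (simp add: power_mult_distrib mult.commute mult_left_mono)
      moreover have "0 \<le> a c U" unfolding a_def using r by (intro sum_nonneg) auto
      ultimately have "(a c U)\<^sup>2 \<le> ((?r * d c) ^ ?k)\<^sup>2" by (intro power_mono)
      thus ?thesis by (simp only: power_mult[symmetric] mult.commute[of _ 2])
    qed
    \<comment> \<open>There are at most \<open>n ^ j\<close> parts \<open>U\<close> with \<open>j\<close> edges at \<open>c\<close>.\<close>
    have "(\<Sum>U\<in>\<U>. (a c U)\<^sup>2) \<le> (\<Sum>U\<in>\<W>. (a c U)\<^sup>2)"
    proof -
      have "(\<Sum>U\<in>\<U>. (a c U)\<^sup>2) = (\<Sum>U\<in>\<U> \<inter> \<W>. (a c U)\<^sup>2)"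
        using fin\<U> zero by (intro sum.mono_neutral_right) auto
      also have "\<dots> \<le> (\<Sum>U\<in>\<W>. (a c U)\<^sup>2)" using fin\<W> by (intro sum_mono2) auto
      finally show ?thesis .
    qed
    also have "\<dots> \<le> (\<Sum>U\<in>\<W>. (?r * d c) ^ (2 * (t - card U)))" by (intro sum_mono a_le)
    also have "\<dots> = (\<Sum>j\<in>{1..t}. \<Sum>U\<in>{U \<in> \<W>. card U = j}. (?r * d c) ^ (2 * (t - card U)))"
      by (rule sum.group[OF fin\<W>, symmetric]) (auto simp: \<W>_def)
    also have "\<dots> \<le> (\<Sum>j\<in>{1..t}. real n ^ t * x c ^ (2 * (t - j)))"
    proof (rule sum_mono)
      fix j assume j: "j \<in> {1..t}"
      hence "{U \<in> \<W>. card U = j} = {U. U \<subseteq> edges_at c ?E \<and> card U = j}" by (auto simp: \<W>_def)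
      hence "card {U \<in> \<W>. card U = j} = card (edges_at c ?E) choose j"
        using n_subsets[OF fin_at[OF finE], of c j] by simp
      also have "\<dots> \<le> card (edges_at c ?E) ^ j" by (rule choose_le_power)
      also have "\<dots> \<le> n ^ j" unfolding edges_at_def by (intro power_mono card_edges_at_le) simp
      finally have c: "real (card {U \<in> \<W>. card U = j}) \<le> real n ^ j" by (simp flip: of_nat_power)
      have "(\<Sum>U\<in>{U \<in> \<W>. card U = j}. (?r * d c) ^ (2 * (t - card U)))
          = real (card {U \<in> \<W>. card U = j}) * (?r * d c) ^ (2 * (t - j))" by simp
      also have "\<dots> \<le> real n ^ j * (?r * d c) ^ (2 * (t - j))" using c r by (intro mult_right_mono) auto
      also have "\<dots> = real n ^ j * (real n ^ (t - j) * x c ^ (2 * (t - j)))"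
      proof -
        have "?r * d c = sqrt n * x c"
          using n by (simp add: x_def d_def edges_at_def vertex_degree_def)
        thus ?thesis by (simp add: power_mult_distrib power_mult)
      qed
      also have "\<dots> = real n ^ t * x c ^ (2 * (t - j))"
        using j by (simp flip: power_add mult.assoc)
      finally show "(\<Sum>U\<in>{U \<in> \<W>. card U = j}. (?r * d c) ^ (2 * (t - card U)))
          \<le> real n ^ t * x c ^ (2 * (t - j))" .
    qed
    also have "\<dots> = real n ^ t * (\<Sum>j\<in>{1..t}. x c ^ (2 * (t - j)))" by (simp add: sum_distrib_left)
    also have "(\<Sum>j\<in>{1..t}. x c ^ (2 * (t - j))) = (\<Sum>i<t. x c ^ (2 * i))"
      by (rule sum.reindex_bij_witness[of _ "\<lambda>i. t - i" "\<lambda>j. t - j"]) auto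
    finally show "(\<Sum>U\<in>\<U>. (a c U)\<^sup>2) \<le> real n ^ t * (\<Sum>i<t. x c ^ (2 * i))" .
  qed
  finally show ?thesis by (simp add: sum_distrib_left mult.assoc)
qed

lemma power_le_choose:
  assumes "t \<le> d"
  shows "real d ^ t \<le> real t ^ t * real (d choose t)"
proof (cases "t = 0")
  case False
  have "(real d / real t) ^ t \<le> real (d choose t)" by (rule binomial_ge_n_over_k_pow_k[OF assms])
  thus ?thesis using False by (simp add: power_divide divide_le_eq mult.commute)
qed simp

text \<open>
  For \<open>x \<le> s\<close> the second summand dominates, otherwise the first one. If \<open>s ^ t\<close> is at most the
  signal, then summing the right-hand side over all vertices gives at most the order of the squared
  gap, and the gain of \<open>s\<^sup>2\<close> on the left makes the variance negligible.
\<close>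

lemma interpolate_power:
  fixes x s :: real
  assumes x: "0 \<le> x" and s: "1 \<le> s" and i: "i < t"
  shows "s\<^sup>2 * x ^ (2 * i) \<le> x ^ (2 * t) + s ^ (2 * t)"
proof (cases "x \<le> s")
  case True
  have "s\<^sup>2 * x ^ (2 * i) \<le> s\<^sup>2 * s ^ (2 * i)" using True x by (intro mult_left_mono power_mono) auto
  also have "\<dots> = s ^ (2 + 2 * i)" by (rule power_add[symmetric])
  also have "\<dots> \<le> s ^ (2 * t)" using s i by (intro power_increasing) auto
  finally show ?thesis using x by (intro add_increasing) auto
next
  case False
  have "s\<^sup>2 * x ^ (2 * i) \<le> x\<^sup>2 * x ^ (2 * i)" using False x s by (intro mult_right_mono power_mono) auto
  also have "\<dots> = x ^ (2 + 2 * i)" by (rule power_add[symmetric])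
  also have "\<dots> \<le> x ^ (2 * t)" using s i False by (intro power_increasing) auto
  finally show ?thesis using s by (intro add_increasing2) auto
qed

text \<open>
  The gap of the signed count of \<open>t\<close>-edge stars divided by the order of magnitude of its standard
  deviation under the null distribution.
\<close>

definition star_signal :: "nat \<Rightarrow> real \<Rightarrow> 'a graph \<Rightarrow> nat \<Rightarrow> real" where
  "star_signal n p H t = tilt p ^ t * card (edge_stars t (snd H)) / sqrt n ^ (t + 1)"

lemma star_signal_nonneg: "0 < p \<Longrightarrow> p < 1 \<Longrightarrow> 0 \<le> star_signal n p H t"
  unfolding star_signal_def
  by (intro divide_nonneg_nonneg mult_nonneg_nonneg) (simp_all add: tilt_pos less_imp_le)

lemma scaled_degree_sum_choose_le:
  fixes n :: nat
  assumes p: "0 < p" "p < 1" and H: "simple_graph H" and t: "1 \<le> t"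
  shows "(\<Sum>c\<in>fst H. tilt p ^ t * real (vertex_degree H c choose t) / sqrt n ^ t)
           \<le> 2 * (tilt p ^ t * card (edge_stars t (snd H)) / sqrt n ^ t)"
proof -
  have "(\<Sum>c\<in>fst H. real (vertex_degree H c choose t)) \<le> 2 * real (card (edge_stars t (snd H)))"
    using of_nat_mono[OF sum_degree_choose_le[OF H t], where 'a = real] by simp
  hence "tilt p ^ t / sqrt n ^ t * (\<Sum>c\<in>fst H. real (vertex_degree H c choose t))
      \<le> tilt p ^ t / sqrt n ^ t * (2 * real (card (edge_stars t (snd H))))"
    using tilt_pos[OF p]
    by (intro mult_left_mono divide_nonneg_nonneg zero_le_power) (simp_all add: less_imp_le)
  thus ?thesis by (simp add: sum_distrib_left sum_divide_distrib mult_ac)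
qed

lemma scaled_degree_power_le_choose:
  assumes p: "0 < p" "p < 1" and d: "t \<le> vertex_degree H c"
  shows "scaled_degree n p H c ^ t \<le> t ^ t * (tilt p ^ t * real (vertex_degree H c choose t) / sqrt n ^ t)"
proof -
  have "scaled_degree n p H c ^ t = tilt p ^ t / sqrt n ^ t * real (vertex_degree H c) ^ t"
    by (simp add: power_divide power_mult_distrib)
  also have "\<dots> \<le> tilt p ^ t / sqrt n ^ t * (real t ^ t * real (vertex_degree H c choose t))"
    using tilt_pos[OF p] by (intro mult_left_mono power_le_choose d) auto
  finally show ?thesis by (simp add: mult_ac)
qed

lemma sum_power2_le_power2_sum:
  fixes f :: "'b \<Rightarrow> real"
  assumes "finite A" "\<And>x. x \<in> A \<Longrightarrow> 0 \<le> f x"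
  shows "(\<Sum>x\<in>A. (f x)\<^sup>2) \<le> (\<Sum>x\<in>A. f x)\<^sup>2"
proof -
  have "(\<Sum>x\<in>A. (f x)\<^sup>2) \<le> (\<Sum>x\<in>A. f x * (\<Sum>y\<in>A. f y))"
    unfolding power2_eq_square
    by (intro sum_mono mult_left_mono member_le_sum) (use assms in auto)
  thus ?thesis by (simp add: sum_distrib_right power2_eq_square)
qed

text \<open>
  The sum of squares of the \<open>t\<close>-th powers is at most the square of their sum, which is the star
  count up to constants. Vertices of degree below \<open>t\<close> are not centres of any star with \<open>t\<close> edges
  and account for the second summand.
\<close>

lemma scaled_degree_sum_power_le:
  assumes p: "0 < p" "p < 1" and n: "0 < n" and t: "1 \<le> t" and r: "tilt p \<le> r" "1 \<le> r"
    and H: "simple_graph H" "card (fst H) \<le> n"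
  defines "y \<equiv> tilt p ^ t * card (edge_stars t (snd H)) / sqrt n ^ t"
  shows "(\<Sum>c\<in>fst H. scaled_degree n p H c ^ (2 * t)) \<le> 4 * real t ^ (2 * t) * y\<^sup>2 + n * (r * t) ^ (2 * t)"
proof -
  let ?x = "scaled_degree n p H" and ?d = "vertex_degree H"
  let ?z = "\<lambda>c. tilt p ^ t * real (?d c choose t) / sqrt n ^ t"
  have V: "finite (fst H)" using H by (simp add: simple_graph_def)
  have r0: "0 < tilt p" by (rule tilt_pos[OF p])
  have z0: "0 \<le> ?z c" for c using r0 by simp
  have x0: "0 \<le> ?x c" for c using r0 by simp
  have sq: "b ^ (2 * t) = (b ^ t)\<^sup>2" for b :: real
    by (simp only: power_mult[symmetric] mult.commute[of 2])
  have "?x c ^ (2 * t) \<le> real t ^ (2 * t) * (?z c)\<^sup>2 + (r * t) ^ (2 * t)" for c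
  proof (cases "t \<le> ?d c")
    case True
    have "(?x c ^ t)\<^sup>2 \<le> (t ^ t * ?z c)\<^sup>2"
      using scaled_degree_power_le_choose[OF p True, of n] x0 by (intro power_mono) auto
    hence "?x c ^ (2 * t) \<le> real t ^ (2 * t) * (?z c)\<^sup>2"
      unfolding sq by (simp only: power_mult_distrib of_nat_power)
    moreover have "0 \<le> (r * t) ^ (2 * t)" using r by simp
    ultimately show ?thesis by linarith
  next
    case False
    have "?x c \<le> tilt p * ?d c / 1" using n r0 by (intro divide_left_mono) auto
    hence "?x c \<le> tilt p * ?d c" by simp
    also have "\<dots> \<le> r * t" using False r r0 by (intro mult_mono) auto
    finally have "?x c ^ (2 * t) \<le> (r * t) ^ (2 * t)" using x0 by (intro power_mono)
    moreover have "0 \<le> real t ^ (2 * t) * (?z c)\<^sup>2" by simp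
    ultimately show ?thesis by linarith
  qed
  hence "(\<Sum>c\<in>fst H. ?x c ^ (2 * t)) \<le> (\<Sum>c\<in>fst H. real t ^ (2 * t) * (?z c)\<^sup>2 + (r * t) ^ (2 * t))"
    by (intro sum_mono)
  also have "\<dots> = real t ^ (2 * t) * (\<Sum>c\<in>fst H. (?z c)\<^sup>2) + card (fst H) * (r * t) ^ (2 * t)"
    by (simp add: sum.distrib sum_distrib_left)
  also have "\<dots> \<le> real t ^ (2 * t) * (2 * y)\<^sup>2 + n * (r * t) ^ (2 * t)"
  proof (intro add_mono mult_left_mono mult_right_mono)
    have "(\<Sum>c\<in>fst H. (?z c)\<^sup>2) \<le> (\<Sum>c\<in>fst H. ?z c)\<^sup>2" by (rule sum_power2_le_power2_sum[OF V z0])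
    also have "\<dots> \<le> (2 * y)\<^sup>2"
      unfolding y_def by (intro power_mono scaled_degree_sum_choose_le p H t sum_nonneg z0)
    finally show "(\<Sum>c\<in>fst H. (?z c)\<^sup>2) \<le> (2 * y)\<^sup>2" .
  qed (use H r in auto)
  finally show ?thesis by (simp add: power_mult_distrib mult_ac)
qed

text \<open>
  Once the signal exceeds \<open>s ^ t\<close>, the standard deviations are smaller than the gap by a factor of
  order \<open>s\<close>. The position of the planted graph does not contribute to the variance, since the
  conditional mean of the star count is the same for all positions.
\<close>

lemma signed_stars_gap_and_variance:
  assumes p: "0 < p" "p < 1" and H: "simple_graph H" "card (fst H) \<le> n" and n: "0 < n"
    and t: "1 \<le> t" "t \<le> T" and r: "tilt p \<le> r" "1 \<le> r" and s: "1 \<le> s"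
    and large: "s ^ t \<le> star_signal n p H t"
  defines "g \<equiv> tilt p ^ t * card (edge_stars t (snd H))"
  shows "measure_pmf.expectation (planted n p H) (signed_stars t n p) = g"
    and "measure_pmf.expectation (erdos_renyi n p) (signed_stars t n p) = 0"
    and "measure_pmf.variance (planted n p H) (signed_stars t n p) \<le> 12 * real T * (r * T) ^ (2 * T) * g\<^sup>2 / s\<^sup>2"
    and "measure_pmf.variance (erdos_renyi n p) (signed_stars t n p) \<le> g\<^sup>2 / s\<^sup>2"
    and "0 < g"
proof -
  let ?E = "potential_edges n" and ?Q = "erdos_renyi n p" and ?f = "signed_stars t n p"
    and ?I = "injections (fst H) {1..n}"
  let ?F = "edge_stars t ?E"
  have V: "finite (fst H)" using H by (simp add: simple_graph_def)
  have tilt: "0 < tilt p" by (rule tilt_pos[OF p])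
  have I: "?I \<noteq> {}" "finite ?I"
    using V H by (intro injections_nonempty finite_injections; simp)+
  hence card_I: "card ?I > 0" by (simp add: card_gt_0_iff)
  have F_sub: "S \<subseteq> ?E" "card S = t" "S \<noteq> {}" if "S \<in> ?F" for S
    using that t by (auto simp: edge_stars_def)
  have big: "s ^ t * sqrt n ^ (t + 1) \<le> g"
    using large n by (simp add: star_signal_def g_def pos_le_divide_eq)
  have "0 < s ^ t * sqrt n ^ (t + 1)" using s n by (intro mult_pos_pos) auto
  thus g0: "0 < g" using big by linarith

  show EQ: "integral\<^sup>L ?Q ?f = 0"
    unfolding signed_stars_eq[OF t(1)]
    using F_sub by (simp add: Bochner_Integration.integral_sum expectation_chi[OF p] del: One_nat_def)

  have position: "(`) \<phi> ` snd H \<subseteq> ?E" "card (edge_stars t ((`) \<phi> ` snd H)) = card (edge_stars t (snd H))"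
    if \<phi>: "\<phi> \<in> ?I" for \<phi>
  proof -
    have inj: "inj_on \<phi> (fst H)" and map: "\<And>v. v \<in> fst H \<Longrightarrow> \<phi> v \<in> {1..n}"
      using \<phi> by (auto simp: injections_def)
    have E: "\<And>e. e \<in> snd H \<Longrightarrow> e \<subseteq> fst H \<and> finite e \<and> card e = 2"
      using H by (auto simp: simple_graph_def nsets_def)
    show "(`) \<phi> ` snd H \<subseteq> ?E"
    proof (rule image_subsetI)
      fix e assume "e \<in> snd H"
      hence e: "e \<subseteq> fst H" "finite e" "card e = 2" using E by auto
      have "card (\<phi> ` e) = 2" using e inj by (simp add: card_image inj_on_subset)
      thus "\<phi> ` e \<in> ?E" using e map by (auto simp: nsets_def)
    qed
    show "card (edge_stars t ((`) \<phi> ` snd H)) = card (edge_stars t (snd H))"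
      by (rule card_edge_stars_image[OF inj _ t(1)]) (use E in auto)
  qed

  have mean: "integral\<^sup>L ?Q (\<lambda>G. ?f (plant ((`) \<phi> ` snd H) G)) = g" if \<phi>: "\<phi> \<in> ?I" for \<phi>
  proof -
    let ?M = "(`) \<phi> ` snd H"
    have "integral\<^sup>L ?Q (\<lambda>G. ?f (plant ?M G)) = (\<Sum>S\<in>?F. tilt p ^ card S * of_bool (S \<subseteq> ?M))"
      unfolding signed_stars_eq[OF t(1)]
      using F_sub by (simp add: Bochner_Integration.integral_sum expectation_chi_plant[OF p] del: One_nat_def)
    also have "\<dots> = (\<Sum>S\<in>?F. if S \<subseteq> ?M then tilt p ^ t else 0)"
      using F_sub by (intro sum.cong) auto
    also have "\<dots> = (\<Sum>S\<in>{S \<in> ?F. S \<subseteq> ?M}. tilt p ^ t)"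
      by (intro sum.inter_filter[symmetric] finite_edge_stars finite_potential_edges)
    also have "{S \<in> ?F. S \<subseteq> ?M} = edge_stars t ?M"
      using position(1)[OF \<phi>] by (auto simp: edge_stars_def)
    finally show ?thesis by (simp add: position(2)[OF \<phi>] g_def)
  qed
  have "integral\<^sup>L (planted n p H) ?f = (\<Sum>\<phi>\<in>?I. g) / card ?I"
    unfolding expectation_planted[OF V H(2)]
    by (intro arg_cong2[where f = "(/)"] sum.cong refl mean)
  thus EP: "integral\<^sup>L (planted n p H) ?f = g" using card_I by simp

  have s_pow: "s\<^sup>2 \<le> s ^ (2 * t)" using s t by (intro power_increasing) auto
  have sq: "b ^ (2 * t) = (b ^ t)\<^sup>2" for b :: real
    by (simp only: power_mult[symmetric] mult.commute[of 2])

  show "measure_pmf.variance ?Q ?f \<le> g\<^sup>2 / s\<^sup>2"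
  proof -
    have "measure_pmf.variance ?Q ?f = integral\<^sup>L ?Q (\<lambda>G. (\<Sum>S\<in>?F. 1 * chi p S G)\<^sup>2)"
      unfolding EQ by (simp add: signed_stars_eq[OF t(1)])
    also have "\<dots> = (\<Sum>S\<in>?F. 1\<^sup>2)"
      by (rule expectation_chi_sum_square[OF p]) (use F_sub in blast)
    also have "\<dots> \<le> real (n ^ (t + 1))"
      using of_nat_mono[OF card_edge_stars_complete_le[OF t(1), of n], where 'a = real] by simp
    finally have "s\<^sup>2 * measure_pmf.variance ?Q ?f \<le> s ^ (2 * t) * real (n ^ (t + 1))"
      using s s_pow by (intro mult_mono) auto
    also have "\<dots> = (s ^ t * sqrt n ^ (t + 1))\<^sup>2"
    proof -
      have "(sqrt n ^ (t + 1))\<^sup>2 = (sqrt n)\<^sup>2 ^ (t + 1)" by (simp only: power_mult[symmetric] mult.commute)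
      thus ?thesis unfolding sq by (simp only: power_mult_distrib) simp
    qed
    also have "\<dots> \<le> g\<^sup>2" using big s by (intro power_mono) auto
    finally show ?thesis using s by (simp add: pos_le_divide_eq mult.commute)
  qed

  define y where "y = g / sqrt n ^ t"
  have y: "s ^ t * sqrt n \<le> y" using big n by (simp add: y_def pos_le_divide_eq mult_ac)
  have "(s ^ t * sqrt n)\<^sup>2 \<le> y\<^sup>2" using y s by (intro power_mono) auto
  hence y2: "s ^ (2 * t) * n \<le> y\<^sup>2" unfolding sq by (simp add: power_mult_distrib)
  have "1 * real n \<le> s ^ (2 * t) * n" using s by (intro mult_right_mono one_le_power) auto
  hence n_le: "real n \<le> y\<^sup>2" using y2 by simp
  have g2: "real n ^ t * y\<^sup>2 = g\<^sup>2"
  proof -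
    have "(sqrt n ^ t)\<^sup>2 = real n ^ t" by (simp only: power_mult[symmetric] mult.commute[of t]) (simp add: power_mult)
    thus ?thesis using n by (simp add: y_def power_divide)
  qed
  define C where "C = (r * T) ^ (2 * T)"
  have "1 * 1 \<le> r * T" using r t by (intro mult_mono) auto
  hence rT: "1 \<le> r * T" by simp
  have C1: "1 \<le> C" unfolding C_def by (intro one_le_power rT)
  have Cle: "b ^ (2 * t) \<le> C" if "0 \<le> b" "b \<le> r * T" for b :: real
  proof -
    have "b ^ (2 * t) \<le> (r * T) ^ (2 * t)" using that by (intro power_mono)
    also have "\<dots> \<le> C" unfolding C_def using rT t by (intro power_increasing) auto
    finally show ?thesis .
  qed
  have C2: "real t ^ (2 * t) \<le> C"
  proof (rule Cle)
    have "1 * real t \<le> r * T" using r t by (intro mult_mono) auto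
    thus "real t \<le> r * T" by simp
  qed simp
  have C3: "(r * t) ^ (2 * t) \<le> C" using r t by (intro Cle mult_left_mono) auto

  have given: "integral\<^sup>L ?Q (\<lambda>G. (?f (plant ((`) \<phi> ` snd H) G) - g)\<^sup>2) \<le> 12 * real T * C * g\<^sup>2 / s\<^sup>2"
    if \<phi>: "\<phi> \<in> ?I" for \<phi>
  proof -
    let ?M = "(`) \<phi> ` snd H"
    let ?x = "scaled_degree n p ({1..n}, ?M)"
    let ?B = "integral\<^sup>L ?Q (\<lambda>G. (?f (plant ?M G) - g)\<^sup>2)"
    have x0: "0 \<le> ?x c" for c using tilt by simp
    have simple: "simple_graph ({1..n}, ?M)" using position(1)[OF \<phi>] by (simp add: simple_graph_def)
    have B: "?B \<le> 2 * real n ^ t * (\<Sum>c\<in>{1..n}. \<Sum>i<t. ?x c ^ (2 * i))"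
      using star_variance_given_position[OF p n t(1) position(1)[OF \<phi>]]
      by (simp only: position(2)[OF \<phi>] g_def)
    have "s\<^sup>2 * (\<Sum>c\<in>{1..n}. \<Sum>i<t. ?x c ^ (2 * i)) = (\<Sum>c\<in>{1..n}. \<Sum>i<t. s\<^sup>2 * ?x c ^ (2 * i))"
      by (simp only: sum_distrib_left)
    also have "\<dots> \<le> (\<Sum>c\<in>{1..n}. \<Sum>i<t. ?x c ^ (2 * t) + s ^ (2 * t))"
      using x0 s by (intro sum_mono interpolate_power) auto
    also have "\<dots> = real t * ((\<Sum>c\<in>{1..n}. ?x c ^ (2 * t)) + s ^ (2 * t) * n)"
      by (simp add: sum.distrib algebra_simps flip: sum_distrib_left)
    also have "\<dots> \<le> real t * ((4 * real t ^ (2 * t) * y\<^sup>2 + n * (r * t) ^ (2 * t)) + y\<^sup>2)"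
      using scaled_degree_sum_power_le[OF p n t(1) r simple] y2
      by (intro mult_left_mono add_mono) (simp_all add: position(2)[OF \<phi>] y_def g_def)
    also have "\<dots> \<le> real t * ((4 * C * y\<^sup>2 + y\<^sup>2 * C) + C * y\<^sup>2)"
      using C1 C2 C3 n_le r by (intro mult_left_mono add_mono mult_mono mult_right_mono) (auto intro: mult_right_mono[of 1 C, simplified])
    also have "\<dots> \<le> real T * ((4 * C * y\<^sup>2 + y\<^sup>2 * C) + C * y\<^sup>2)"
      using t C1 by (intro mult_right_mono add_nonneg_nonneg mult_nonneg_nonneg) auto
    also have "\<dots> = 6 * real T * C * y\<^sup>2" by (simp add: algebra_simps)
    finally have sum: "s\<^sup>2 * (\<Sum>c\<in>{1..n}. \<Sum>i<t. ?x c ^ (2 * i)) \<le> 6 * real T * C * y\<^sup>2" .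
    have "s\<^sup>2 * ?B \<le> s\<^sup>2 * (2 * real n ^ t * (\<Sum>c\<in>{1..n}. \<Sum>i<t. ?x c ^ (2 * i)))"
      by (intro mult_left_mono B) simp
    also have "\<dots> = 2 * real n ^ t * (s\<^sup>2 * (\<Sum>c\<in>{1..n}. \<Sum>i<t. ?x c ^ (2 * i)))" by (simp only: mult_ac)
    also have "\<dots> \<le> 2 * real n ^ t * (6 * real T * C * y\<^sup>2)" by (intro mult_left_mono sum) simp
    also have "\<dots> = 12 * real T * C * (real n ^ t * y\<^sup>2)" by simp
    finally have "s\<^sup>2 * ?B \<le> 12 * real T * C * g\<^sup>2" unfolding g2 .
    thus ?thesis using s by (simp add: pos_le_divide_eq mult.commute)
  qed
  have "measure_pmf.variance (planted n p H) ?f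
      = (\<Sum>\<phi>\<in>?I. integral\<^sup>L ?Q (\<lambda>G. (?f (plant ((`) \<phi> ` snd H) G) - g)\<^sup>2)) / card ?I"
    unfolding EP by (rule expectation_planted[OF V H(2)])
  also have "\<dots> \<le> (\<Sum>\<phi>\<in>?I. 12 * real T * C * g\<^sup>2 / s\<^sup>2) / card ?I"
    by (intro divide_right_mono sum_mono given) auto
  also have "\<dots> = 12 * real T * C * g\<^sup>2 / s\<^sup>2" using card_I by simp
  finally show "measure_pmf.variance (planted n p H) ?f \<le> 12 * real T * (r * T) ^ (2 * T) * g\<^sup>2 / s\<^sup>2"
    unfolding C_def .
qed

section \<open>The two test statistics\<close>

lemma card_edge_stars_1:
  assumes "simple_graph H"
  shows "card (edge_stars 1 (snd H)) = card (snd H)"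
proof -
  have "edge_stars 1 (snd H) = (\<lambda>e. {e}) ` snd H"
  proof (intro equalityI subsetI)
    fix S assume "S \<in> edge_stars 1 (snd H)"
    thus "S \<in> (\<lambda>e. {e}) ` snd H" by (auto simp: edge_stars_def card_1_singleton_iff)
  next
    fix S assume "S \<in> (\<lambda>e. {e}) ` snd H"
    then obtain e where e: "e \<in> snd H" "S = {e}" by blast
    moreover have "e \<noteq> {}" using e(1) assms by (auto simp: simple_graph_def nsets_def)
    ultimately show "S \<in> edge_stars 1 (snd H)" by (auto simp: edge_stars_def)
  qed
  thus ?thesis by (simp add: card_image)
qed

lemma star_signal_1:
  assumes "simple_graph H"
  shows "star_signal n p H 1 = tilt p * card (snd H) / n"
  using card_edge_stars_1[OF assms] by (simp add: star_signal_def)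

lemma scaled_degree_sum_le:
  assumes p: "0 < p" "p < 1" and H: "simple_graph H" and n: "0 < n"
  shows "(\<Sum>y\<in>fst H. scaled_degree n p H y) \<le> 2 * star_signal n p H 1 * sqrt n"
proof -
  have "(\<Sum>y\<in>fst H. scaled_degree n p H y) \<le> 2 * (tilt p * card (edge_stars 1 (snd H)) / sqrt n)"
    using scaled_degree_sum_choose_le[OF p H, of 1 n] by simp
  also have "\<dots> = 2 * star_signal n p H 1 * sqrt n" using n by (simp add: star_signal_def field_simps)
  finally show ?thesis .
qed

text \<open>
  Every moment between the first and the \<open>D\<close>-th is dominated by these two, and these are the
  signals of the edge count and of the count of \<open>D\<close>-edge stars.
\<close>

lemma scaled_degree_moment_le_signals:
  assumes p: "0 < p" "p < 1" and H: "simple_graph H" and n: "0 < n"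
    and r: "tilt p \<le> r" "1 \<le> r" and j: "1 \<le> j" "j \<le> D"
  shows "(\<Sum>y\<in>fst H. scaled_degree n p H y ^ j)
    \<le> 4 * (r * D) ^ D * (star_signal n p H 1 + star_signal n p H D) * sqrt n"
proof -
  let ?x = "scaled_degree n p H" and ?d = "vertex_degree H"
  let ?z = "\<lambda>y. tilt p ^ D * real (?d y choose D) / sqrt n ^ D"
  let ?R = "star_signal n p H" and ?C = "(r * D) ^ D"
  have D: "1 \<le> D" using j by simp
  have r0: "0 < tilt p" by (rule tilt_pos[OF p])
  have z0: "0 \<le> ?z y" for y using r0 by simp
  have x0: "0 \<le> ?x y" for y using r0 by simp
  have "1 * 1 \<le> r * D" using r D by (intro mult_mono) auto
  hence rD: "1 \<le> r * D" by simp
  hence C1: "1 \<le> ?C" by (rule one_le_power)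
  have "1 * real D \<le> r * D" using r by (intro mult_right_mono) auto
  hence DC: "real D ^ D \<le> ?C" by (intro power_mono) auto
  have x: "?x y ^ j \<le> 2 * ?C * ?x y + ?C * ?z y" for y
  proof -
    have le1: "?x y ^ j \<le> ?x y + ?x y ^ D"
    proof (cases "?x y \<le> 1")
      case True
      hence "?x y ^ j \<le> ?x y ^ 1" using j(1) x0 by (intro power_decreasing) auto
      thus ?thesis using x0[of y] by (simp add: add_increasing2)
    next
      case False
      hence "?x y ^ j \<le> ?x y ^ D" using j(2) by (intro power_increasing) auto
      thus ?thesis using x0[of y] by linarith
    qed
    have le2: "?x y ^ D \<le> ?C * ?x y + ?C * ?z y"
    proof (cases "D \<le> ?d y")
      case True
      have "0 \<le> ?C * ?x y" using C1 x0 by (intro mult_nonneg_nonneg) auto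
      moreover have "?x y ^ D \<le> real D ^ D * ?z y" by (rule scaled_degree_power_le_choose[OF p True])
      moreover have "real D ^ D * ?z y \<le> ?C * ?z y" using DC z0 by (intro mult_right_mono) auto
      ultimately show ?thesis by linarith
    next
      case False
      have "?x y \<le> tilt p * ?d y / 1" using n r0 by (intro divide_left_mono) auto
      also have "\<dots> \<le> r * D" using False r r0 by (simp add: mult_mono)
      finally have le: "?x y \<le> r * D" .
      have "?x y ^ D = ?x y ^ (D - 1) * ?x y" by (rule power_minus_mult[symmetric]) (use D in simp)
      also have "\<dots> \<le> (r * D) ^ (D - 1) * ?x y" using le x0 by (intro mult_right_mono power_mono) auto
      also have "\<dots> \<le> ?C * ?x y" using rD x0 by (intro mult_right_mono power_increasing) auto
      finally have "?x y ^ D \<le> ?C * ?x y" .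
      moreover have "0 \<le> ?C * ?z y" using C1 z0 by (intro mult_nonneg_nonneg) auto
      ultimately show ?thesis by linarith
    qed
    have "1 * ?x y \<le> ?C * ?x y" using C1 x0 by (intro mult_right_mono) auto
    thus ?thesis using le1 le2 by linarith
  qed
  have "(\<Sum>y\<in>fst H. ?x y ^ j) \<le> (\<Sum>y\<in>fst H. 2 * ?C * ?x y + ?C * ?z y)" by (intro sum_mono x)
  also have "\<dots> = 2 * ?C * (\<Sum>y\<in>fst H. ?x y) + ?C * (\<Sum>y\<in>fst H. ?z y)"
    by (simp only: sum.distrib sum_distrib_left)
  also have "\<dots> \<le> 2 * ?C * (2 * ?R 1 * sqrt n) + ?C * (2 * ?R D * sqrt n)"
  proof (intro add_mono mult_left_mono scaled_degree_sum_le p H n)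
    have "(\<Sum>y\<in>fst H. ?z y) \<le> 2 * (tilt p ^ D * card (edge_stars D (snd H)) / sqrt n ^ D)"
      by (rule scaled_degree_sum_choose_le[OF p H D])
    also have "\<dots> = 2 * ?R D * sqrt n" using n by (simp add: star_signal_def)
    finally show "(\<Sum>y\<in>fst H. ?z y) \<le> 2 * ?R D * sqrt n" .
  qed (use C1 in auto)
  also have "\<dots> \<le> 4 * ?C * (?R 1 + ?R D) * sqrt n"
  proof -
    have "0 \<le> ?C * ?R D * sqrt n" using C1 by (intro mult_nonneg_nonneg star_signal_nonneg p) auto
    thus ?thesis by (simp add: algebra_simps)
  qed
  finally show ?thesis .
qed

lemma scaled_degree_moment_le_signal_1:
  assumes p: "0 < p" "p < 1" and H: "simple_graph H" and n: "0 < n"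
    and C: "1 \<le> C" "\<And>y. y \<in> fst H \<Longrightarrow> scaled_degree n p H y \<le> C" and j: "1 \<le> j" "j \<le> D"
  shows "(\<Sum>y\<in>fst H. scaled_degree n p H y ^ j) \<le> C ^ D * (2 * star_signal n p H 1) * sqrt n"
proof -
  let ?x = "scaled_degree n p H"
  have x0: "0 \<le> ?x y" for y using tilt_pos[OF p] by simp
  have "?x y ^ j \<le> C ^ D * ?x y" if y: "y \<in> fst H" for y
  proof -
    have "?x y ^ j = ?x y ^ (j - 1) * ?x y" by (rule power_minus_mult[symmetric]) (use j in simp)
    also have "\<dots> \<le> C ^ (j - 1) * ?x y" using C(2)[OF y] x0 by (intro mult_right_mono power_mono) auto
    also have "\<dots> \<le> C ^ D * ?x y" using C(1) j x0 by (intro mult_right_mono power_increasing) auto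
    finally show ?thesis .
  qed
  hence "(\<Sum>y\<in>fst H. ?x y ^ j) \<le> C ^ D * (\<Sum>y\<in>fst H. ?x y)"
    unfolding sum_distrib_left by (intro sum_mono)
  also have "\<dots> \<le> C ^ D * (2 * star_signal n p H 1 * sqrt n)"
    using C(1) by (intro mult_left_mono scaled_degree_sum_le p H n) auto
  finally show ?thesis by (simp add: mult_ac)
qed

lemma vertex_degree_le_max_degree:
  assumes "simple_graph H" "y \<in> fst H"
  shows "vertex_degree H y \<le> max_degree H"
  using assms unfolding max_degree_def simple_graph_def by (intro Max_ge) auto

lemma max_degree_attained:
  assumes "simple_graph H" "0 < max_degree H"
  shows "\<exists>y\<in>fst H. vertex_degree H y = max_degree H"
proof -
  have "max_degree H \<in> insert 0 (vertex_degree H ` fst H)"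
    using assms unfolding max_degree_def simple_graph_def by (intro Max_in) auto
  thus ?thesis using assms(2) by auto
qed

lemma star_signal_ge_max_degree:
  assumes p: "0 < p" "p < 1" and H: "simple_graph H" and n: "0 < n"
    and t: "1 \<le> t" "t \<le> max_degree H"
  shows "(tilt p * max_degree H / sqrt n) ^ t / (2 * real t ^ t * sqrt n) \<le> star_signal n p H t"
proof -
  obtain y where y: "y \<in> fst H" "vertex_degree H y = max_degree H"
    using max_degree_attained[OF H] t by auto
  let ?z = "\<lambda>c. tilt p ^ t * real (vertex_degree H c choose t) / sqrt n ^ t"
  have z0: "0 \<le> ?z c" for c using tilt_pos[OF p] by simp
  have "(tilt p * max_degree H / sqrt n) ^ t \<le> t ^ t * ?z y"
    using scaled_degree_power_le_choose[OF p, of t H y n] t y(2) by simp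
  also have "?z y \<le> (\<Sum>c\<in>fst H. ?z c)"
    using y H z0 by (intro member_le_sum) (auto simp: simple_graph_def)
  also have "\<dots> \<le> 2 * (tilt p ^ t * card (edge_stars t (snd H)) / sqrt n ^ t)"
    by (rule scaled_degree_sum_choose_le[OF p H t(1)])
  also have "\<dots> = 2 * sqrt n * star_signal n p H t" using n by (simp add: star_signal_def)
  finally have "(tilt p * max_degree H / sqrt n) ^ t \<le> t ^ t * (2 * sqrt n * star_signal n p H t)"
    by (simp add: mult_left_mono)
  thus ?thesis using n t by (simp add: pos_divide_le_eq mult_ac)
qed

section \<open>Asymptotics\<close>

lemma bounded_tilt:
  fixes p :: "nat \<Rightarrow> real"
  assumes p: "\<And>n. 0 < p n \<and> p n < 1" and lim: "liminf (\<lambda>n. ereal (p n)) > 0"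
  obtains r where "1 \<le> r" "\<forall>\<^sub>F n in sequentially. tilt (p n) \<le> r"
proof -
  obtain c :: real where c: "0 < ereal c" "ereal c < liminf (\<lambda>n. ereal (p n))"
    using ereal_dense2[OF lim] by auto
  have "\<forall>\<^sub>F n in sequentially. ereal c < ereal (p n)"
    using less_LiminfD[OF c(2)] .
  hence "\<forall>\<^sub>F n in sequentially. tilt (p n) \<le> max 1 (sqrt (1 / c))"
  proof (rule eventually_mono)
    fix n assume "ereal c < ereal (p n)"
    hence "(1 - p n) / p n \<le> 1 / c" using c p[of n] by (intro frac_le) auto
    hence "tilt (p n) \<le> sqrt (1 / c)" unfolding tilt_def by simp
    thus "tilt (p n) \<le> max 1 (sqrt (1 / c))" by simp
  qed
  thus ?thesis using that[of "max 1 (sqrt (1 / c))"] by simp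
qed

text \<open>
  The factor \<open>s\<close> by which the gap exceeds the standard deviations can be chosen arbitrarily large if
  the signal diverges. The number \<open>\<tau> n\<close> of edges may depend on \<open>n\<close> as long as it stays bounded.
\<close>

lemma signed_stars_separate:
  fixes H :: "nat \<Rightarrow> 'a graph" and p :: "nat \<Rightarrow> real"
  assumes H: "\<And>n. simple_graph (H n)" "\<And>n. card (fst (H n)) \<le> n"
    and p: "\<And>n. 0 < p n \<and> p n < 1" and r: "1 \<le> r" "\<forall>\<^sub>F n in sequentially. tilt (p n) \<le> r"
    and \<tau>: "\<forall>\<^sub>F n in sequentially. 1 \<le> \<tau> n \<and> \<tau> n \<le> T"
    and signal: "filterlim (\<lambda>n. star_signal n (p n) (H n) (\<tau> n)) at_top sequentially"
  shows "strongly_separates (\<lambda>n. planted n (p n) (H n)) (\<lambda>n. erdos_renyi n (p n))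
           (\<lambda>n. signed_stars (\<tau> n) n (p n))"
proof -
  define g where "g n = tilt (p n) ^ \<tau> n * card (edge_stars (\<tau> n) (snd (H n)))" for n
  define C where "C = 12 * real (max 1 T) * (r * max 1 T) ^ (2 * max 1 T)"
  have "1 * 1 \<le> r * real (max 1 T)" using r by (intro mult_mono) auto
  hence "1 \<le> (r * real (max 1 T)) ^ (2 * max 1 T)" by (intro one_le_power) simp
  hence "1 * 1 \<le> 12 * real (max 1 T) * (r * max 1 T) ^ (2 * max 1 T)" by (intro mult_mono) auto
  hence C: "1 \<le> C" by (simp add: C_def)
  let ?f = "\<lambda>n. signed_stars (\<tau> n) n (p n)"
  let ?P = "\<lambda>n. planted n (p n) (H n)" and ?Q = "\<lambda>n. erdos_renyi n (p n)"
  let ?gap = "\<lambda>n. \<bar>measure_pmf.expectation (?P n) (?f n) - measure_pmf.expectation (?Q n) (?f n)\<bar>"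
  let ?sd = "\<lambda>n. max (sqrt (measure_pmf.variance (?P n) (?f n))) (sqrt (measure_pmf.variance (?Q n) (?f n)))"
  have key: "\<forall>\<^sub>F n in sequentially. 0 < ?gap n \<and> ?sd n \<le> sqrt C / s * ?gap n" if s: "1 \<le> s" for s
  proof -
    have "\<forall>\<^sub>F n in sequentially. s ^ T \<le> star_signal n (p n) (H n) (\<tau> n)"
      using signal by (simp add: filterlim_at_top)
    thus ?thesis
      using \<tau> r(2) eventually_gt_at_top[of 0]
    proof eventually_elim
      case (elim n)
      have pn: "0 < p n" "p n < 1" using p by auto
      have t: "1 \<le> \<tau> n" "\<tau> n \<le> max 1 T" using elim by auto
      have "s ^ \<tau> n \<le> s ^ T" using s elim by (intro power_increasing) auto
      hence large: "s ^ \<tau> n \<le> star_signal n (p n) (H n) (\<tau> n)" using elim by simp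
      note bounds = signed_stars_gap_and_variance[OF pn H elim(4) t elim(3) r(1) s large, folded g_def C_def]
      have gap: "?gap n = g n" using bounds(1,2,5) by simp
      have "measure_pmf.variance (?P n) (?f n) \<le> C * (g n)\<^sup>2 / s\<^sup>2" by (rule bounds(3))
      moreover have "measure_pmf.variance (?Q n) (?f n) \<le> C * (g n)\<^sup>2 / s\<^sup>2"
      proof (rule order_trans[OF bounds(4)])
        have "1 * (g n)\<^sup>2 \<le> C * (g n)\<^sup>2" using C by (intro mult_right_mono) auto
        thus "(g n)\<^sup>2 / s\<^sup>2 \<le> C * (g n)\<^sup>2 / s\<^sup>2" by (simp add: divide_right_mono)
      qed
      moreover have "sqrt (C * (g n)\<^sup>2 / s\<^sup>2) = sqrt C / s * g n"
        using bounds(5) s by (simp add: real_sqrt_mult real_sqrt_divide)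
      ultimately have "?sd n \<le> sqrt C / s * g n" using real_sqrt_le_mono by (metis max.bounded_iff)
      thus ?case unfolding gap using bounds(5) by simp
    qed
  qed
  have "\<forall>\<^sub>F n in sequentially. ?gap n \<noteq> 0"
    using key[OF order_refl] by (rule eventually_mono) auto
  moreover have "?sd \<in> o(?gap)"
  proof (rule landau_o.smallI)
    fix c :: real assume c: "0 < c"
    define s where "s = max 1 (sqrt C / c)"
    have s: "1 \<le> s" "sqrt C / c \<le> s" by (simp_all add: s_def)
    have "sqrt C / s \<le> c" using s c by (simp add: divide_le_eq mult.commute)
    show "\<forall>\<^sub>F n in sequentially. norm (?sd n) \<le> c * norm (?gap n)"
      using key[OF s(1)]
    proof (rule eventually_mono)
      fix n assume n: "0 < ?gap n \<and> ?sd n \<le> sqrt C / s * ?gap n"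
      have "0 \<le> measure_pmf.variance (?Q n) (?f n)" by (rule measure_pmf.variance_positive)
      hence "0 \<le> ?sd n" by (simp add: le_max_iff_disj)
      hence "norm (?sd n) \<le> sqrt C / s * ?gap n" using n by simp
      also have "\<dots> \<le> c * ?gap n" using \<open>sqrt C / s \<le> c\<close> by (intro mult_right_mono) auto
      finally show "norm (?sd n) \<le> c * norm (?gap n)" by simp
    qed
  qed
  ultimately show ?thesis unfolding strongly_separates_def Let_def by blast
qed

text \<open>
  Separation makes the squared gap exceed any multiple of the null variance, while their ratio is at
  most the advantage.
\<close>

lemma advantage_unbounded:
  fixes H :: "nat \<Rightarrow> 'a graph" and p :: "nat \<Rightarrow> real"
  assumes H: "\<And>n. simple_graph (H n)" "\<And>n. card (fst (H n)) \<le> n"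
    and p: "\<And>n. 0 < p n \<and> p n < 1"
    and f: "f \<in> polynomial_tests D"
    and sep: "strongly_separates (\<lambda>n. planted n (p n) (H n)) (\<lambda>n. erdos_renyi n (p n)) f"
  shows "\<forall>\<^sub>F n in sequentially. B < advantage n (p n) (H n) (D n)"
proof -
  let ?P = "\<lambda>n. planted n (p n) (H n)" and ?Q = "\<lambda>n. erdos_renyi n (p n)"
  let ?gap = "\<lambda>n. \<bar>measure_pmf.expectation (?P n) (f n) - measure_pmf.expectation (?Q n) (f n)\<bar>"
  let ?sd = "\<lambda>n. max (sqrt (measure_pmf.variance (?P n) (f n))) (sqrt (measure_pmf.variance (?Q n) (f n)))"
  \<comment> \<open>With \<open>b > 1\<close>, the bound \<open>b\<^sup>2\<close> that separation provides exceeds \<open>B\<close>.\<close>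
  define b where "b = max 1 B + 1"
  have b: "1 < b" "B < b" by (simp_all add: b_def)
  have small: "?sd \<in> o(?gap)" and nonzero: "\<forall>\<^sub>F n in sequentially. ?gap n \<noteq> 0"
    using sep unfolding strongly_separates_def Let_def by blast+
  have "\<forall>\<^sub>F n in sequentially. norm (?sd n) \<le> (1 / b) * norm (?gap n)"
    using b by (intro landau_o.smallD[OF small]) simp
  with nonzero show ?thesis
  proof eventually_elim
    case (elim n)
    let ?v = "measure_pmf.variance (?Q n) (f n)"
    have pn: "0 < p n" "p n < 1" using p by auto
    have V: "finite (fst (H n))" using H by (simp add: simple_graph_def)
    obtain q where q: "mpoly_vars q \<subseteq> potential_edges n" "mpoly_degree_le q (D n)"
      "\<And>G. f n G = mpoly_eval q (\<lambda>e. of_bool (G e))"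
      using f unfolding polynomial_tests_def by blast
    obtain c where c: "\<And>G. f n G = (\<Sum>S\<in>low_degree_sets n (D n). c S * chi (p n) S G)"
      using polynomial_fourier_expansion[OF pn q(1,2)] q(3) by auto
    have gap: "(?gap n)\<^sup>2 \<le> ?v * advantage n (p n) (H n) (D n)"
      using gap_le_variance_times_advantage[OF pn V H(2) c] by simp
    have v0: "0 \<le> ?v" by (rule measure_pmf.variance_positive)
    have "sqrt ?v \<le> (1 / b) * ?gap n" using elim by simp
    hence "(sqrt ?v)\<^sup>2 \<le> ((1 / b) * ?gap n)\<^sup>2" using v0 by (intro power_mono) auto
    hence v: "b\<^sup>2 * ?v \<le> (?gap n)\<^sup>2" using v0 b by (simp add: power_mult_distrib power_divide divide_simps mult.commute)
    have "0 < (?gap n)\<^sup>2" using elim by simp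
    hence "?v \<noteq> 0" using gap by auto
    hence "0 < ?v" using v0 unfolding less_le by metis
    moreover have "?v * b\<^sup>2 \<le> ?v * advantage n (p n) (H n) (D n)" using v gap by (simp add: mult.commute)
    ultimately have "b\<^sup>2 \<le> advantage n (p n) (H n) (D n)" by simp
    moreover have "b * 1 \<le> b * b" using b by (intro mult_left_mono) auto
    ultimately have "b \<le> advantage n (p n) (H n) (D n)" unfolding power2_eq_square by linarith
    thus ?case using b(2) by linarith
  qed
qed

lemma advantage_0 [simp]: "advantage n p H 0 = 0"
proof -
  have "low_degree_sets n 0 = {{}}"
    using finite_edge_set(1)[of _ n] by (auto simp: low_degree_sets_def simp del: One_nat_def)
  thus ?thesis by (simp add: advantage_def)
qed

lemma advantage_bounded:
  fixes r w :: real
  assumes r: "1 \<le> r" and w: "0 \<le> w"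
  shows "\<exists>B. \<forall>n p D. \<forall>H :: 'a graph. 0 < p \<longrightarrow> p < 1 \<longrightarrow> simple_graph H \<longrightarrow> card (fst H) \<le> n \<longrightarrow>
           0 < n \<longrightarrow> 4 * D0 \<le> n \<longrightarrow> D \<le> D0 \<longrightarrow> tilt p \<le> r \<longrightarrow>
           (\<forall>j. 1 \<le> j \<longrightarrow> j \<le> D \<longrightarrow> (\<Sum>y\<in>fst H. scaled_degree n p H y ^ j) \<le> w * sqrt n) \<longrightarrow>
           advantage n p H D \<le> B"
proof -
  define b :: "nat \<Rightarrow> real" where
    "b D = 16 ^ D * (1 + r ^ (2 * D) * (D + 1)\<^sup>2 * ((D + 2) * 2 ^ 2 ^ (D + 1)) * w\<^sup>2) ^ D" for D
  have b0: "0 \<le> b D" for D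
    unfolding b_def using r w by (intro mult_nonneg_nonneg zero_le_power add_nonneg_nonneg) auto
  show ?thesis
  proof (intro exI[of _ "\<Sum>D\<le>D0. b D"] allI impI)
    fix n p D and H :: "'a graph"
    assume as: "0 < p" "p < 1" "simple_graph H" "card (fst H) \<le> n" "0 < n" "4 * D0 \<le> n" "D \<le> D0" "tilt p \<le> r"
      "\<forall>j. 1 \<le> j \<longrightarrow> j \<le> D \<longrightarrow> (\<Sum>y\<in>fst H. scaled_degree n p H y ^ j) \<le> w * sqrt n"
    have "advantage n p H D \<le> b D"
      unfolding b_def using as r w by (intro advantage_le) auto
    also have "\<dots> \<le> (\<Sum>D\<le>D0. b D)" using as(7) b0 by (intro member_le_sum) auto
    finally show "advantage n p H D \<le> (\<Sum>D\<le>D0. b D)" .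
  qed
qed

text \<open>
  The moments of the scaled degrees control the advantage, which diverges if some test of bounded
  degree separates. Hence every statistic \<open>R\<close> that controls the moments diverges as well.
\<close>

lemma separation_imp_signal:
  fixes H :: "nat \<Rightarrow> 'a graph" and p :: "nat \<Rightarrow> real"
  assumes H: "\<And>n. simple_graph (H n)" "\<And>n. card (fst (H n)) \<le> n"
    and p: "\<And>n. 0 < p n \<and> p n < 1" and r: "1 \<le> r" "\<forall>\<^sub>F n in sequentially. tilt (p n) \<le> r"
    and D: "\<forall>\<^sub>F n in sequentially. D n \<le> D0"
    and f: "f \<in> polynomial_tests D"
    and sep: "strongly_separates (\<lambda>n. planted n (p n) (H n)) (\<lambda>n. erdos_renyi n (p n)) f"
    and c: "0 \<le> c"
    and moments: "\<forall>\<^sub>F n in sequentially. \<forall>j. 1 \<le> j \<longrightarrow> j \<le> D n \<longrightarrow>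
      (\<Sum>y\<in>fst (H n). scaled_degree n (p n) (H n) y ^ j) \<le> c * R n * sqrt n"
  shows "filterlim R at_top sequentially"
  unfolding filterlim_at_top_gt[where c = 0]
proof (intro allI impI)
  fix Z :: real assume Z: "0 < Z"
  hence cZ: "0 \<le> c * Z" using c by simp
  obtain B where B: "\<And>n p D. \<And>H :: 'a graph. \<lbrakk>0 < p; p < 1; simple_graph H; card (fst H) \<le> n; 0 < n;
      4 * D0 \<le> n; D \<le> D0; tilt p \<le> r;
      \<forall>j. 1 \<le> j \<longrightarrow> j \<le> D \<longrightarrow> (\<Sum>y\<in>fst H. scaled_degree n p H y ^ j) \<le> c * Z * sqrt n\<rbrakk>
      \<Longrightarrow> advantage n p H D \<le> B"
    using advantage_bounded[OF r(1) cZ, of D0, where 'a = 'a] by blast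
  have "\<forall>\<^sub>F n in sequentially. B < advantage n (p n) (H n) (D n)"
    by (rule advantage_unbounded[OF H p f sep])
  thus "\<forall>\<^sub>F n in sequentially. Z \<le> R n"
    using moments r(2) D eventually_gt_at_top[of 0] eventually_ge_at_top[of "4 * D0"]
  proof eventually_elim
    case (elim n)
    show ?case
    proof (rule ccontr)
      assume "\<not> Z \<le> R n"
      hence "c * R n * sqrt n \<le> c * Z * sqrt n"
        using c by (intro mult_right_mono mult_left_mono) auto
      hence "\<forall>j. 1 \<le> j \<longrightarrow> j \<le> D n \<longrightarrow>
          (\<Sum>y\<in>fst (H n). scaled_degree n (p n) (H n) y ^ j) \<le> c * Z * sqrt n"
        using elim(2) order_trans by blast
      hence "advantage n (p n) (H n) (D n) \<le> B"
        using elim H p by (intro B) auto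
      thus False using elim(1) by simp
    qed
  qed
qed

lemma tilt_over_sqrt:
  assumes "0 < p" "p < 1" "0 < n"
  shows "tilt p / sqrt n = 1 / (real n * (p / (1 - p))) powr (1/2)"
proof -
  have "0 \<le> real n * (p / (1 - p))" using assms by simp
  hence "(real n * (p / (1 - p))) powr (1/2) = sqrt (real n * (p / (1 - p)))"
    by (rule powr_half_sqrt)
  thus ?thesis by (simp add: tilt_def real_sqrt_mult real_sqrt_divide)
qed

lemma star_signal_1_eq:
  assumes "simple_graph H" "0 < p" "p < 1"
  shows "star_signal n p H 1 = card (snd H) / (n * (p / (1 - p)) powr (1/2))"
proof -
  have "(p / (1 - p)) powr (1/2) = sqrt (p / (1 - p))" using assms by (intro powr_half_sqrt) auto
  thus ?thesis using assms
    by (simp add: star_signal_1[OF assms(1)] tilt_def real_sqrt_divide mult.commute del: One_nat_def)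
qed

lemma signal_1_at_top_iff:
  assumes H: "\<And>n. simple_graph (H n)" and p: "\<And>n. 0 < p n \<and> p n < 1"
  shows "filterlim (\<lambda>n. star_signal n (p n) (H n) 1) at_top sequentially \<longleftrightarrow>
    (\<lambda>n. real (card (snd (H n)))) \<in> \<omega>(\<lambda>n. real n * (p n / (1 - p n)) powr (1/2))"
proof -
  have pos: "0 < real n * (p n / (1 - p n)) powr (1/2)" if "0 < n" for n
    using that p[of n] by simp
  have iff: "Z \<le> star_signal n (p n) (H n) 1 \<longleftrightarrow>
      Z * norm (real n * (p n / (1 - p n)) powr (1/2)) \<le> norm (real (card (snd (H n))))" if "0 < n" for Z n
  proof -
    have "Z \<le> star_signal n (p n) (H n) 1 \<longleftrightarrow>
        Z * (real n * (p n / (1 - p n)) powr (1/2)) \<le> real (card (snd (H n)))"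
      using star_signal_1_eq[OF H, of "p n" n n] p[of n] pos[OF that] by (simp only: pos_le_divide_eq)
    thus ?thesis using pos[OF that] by simp
  qed
  have ev: "(\<forall>\<^sub>F n in sequentially. Z \<le> star_signal n (p n) (H n) 1) \<longleftrightarrow>
      (\<forall>\<^sub>F n in sequentially. Z * norm (real n * (p n / (1 - p n)) powr (1/2)) \<le> norm (real (card (snd (H n)))))" for Z
    by (rule eventually_cong[OF eventually_gt_at_top[of 0]]) (rule iff)
  show ?thesis
    unfolding filterlim_at_top_gt[where c = 0] smallomega_def ev by simp
qed

text \<open>
  The stars centred at a single vertex of maximal degree already suffice: they contribute at least
  the \<open>(\<epsilon> * t)\<close>-th power of \<open>n * p / (1 - p)\<close>, up to constants, against a loss of \<open>sqrt n\<close>.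
\<close>

lemma star_signal_large_degree:
  fixes H :: "nat \<Rightarrow> 'a graph" and p :: "nat \<Rightarrow> real"
  assumes H: "\<And>n. simple_graph (H n)"
    and p: "\<And>n. 0 < p n \<and> p n < 1" and r: "1 \<le> r" "\<forall>\<^sub>F n in sequentially. tilt (p n) \<le> r"
    and \<epsilon>: "0 < \<epsilon>" "1 \<le> \<epsilon> * t"
    and \<Delta>: "\<forall>\<^sub>F n in sequentially.
      real (max_degree (H n)) \<ge> (real n * (p n / (1 - p n))) powr (1/2 + \<epsilon>)"
  shows "filterlim (\<lambda>n. star_signal n (p n) (H n) t) at_top sequentially"
proof -
  have t: "1 \<le> t" using \<epsilon> by (cases t) auto
  let ?c = "1 / (2 * r\<^sup>2 * real t ^ t)"
  have c: "0 < ?c" using r t by simp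
  have lim: "filterlim (\<lambda>n. ?c * sqrt (real n)) at_top sequentially"
    by (intro filterlim_tendsto_pos_mult_at_top[OF tendsto_const c]
         filterlim_compose[OF sqrt_at_top] filterlim_real_sequentially)
  show ?thesis
  proof (rule filterlim_at_top_mono[OF lim])
    have "\<forall>\<^sub>F n in sequentially. r * t \<le> sqrt (real n)"
      using filterlim_compose[OF sqrt_at_top filterlim_real_sequentially] by (simp add: filterlim_at_top)
    thus "\<forall>\<^sub>F n in sequentially. ?c * sqrt (real n) \<le> star_signal n (p n) (H n) t"
      using r(2) \<Delta> eventually_gt_at_top[of 0]
    proof eventually_elim
      case (elim n)
      have pn: "0 < p n" "p n < 1" using p by auto
      define u where "u = real n * (p n / (1 - p n))"
      have u0: "0 < u" using pn elim by (simp add: u_def)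
      have tilt0: "0 < tilt (p n)" by (rule tilt_pos[OF pn])
      have "(tilt (p n))\<^sup>2 \<le> r\<^sup>2" using elim tilt0 by (intro power_mono) auto
      hence "(1 - p n) / p n \<le> r\<^sup>2" using pn by (simp add: tilt_def)
      hence "1 / r\<^sup>2 \<le> p n / (1 - p n)" using pn r by (simp add: field_simps)
      hence "real n * (1 / r\<^sup>2) \<le> u" unfolding u_def by (intro mult_left_mono) auto
      hence u: "real n / r\<^sup>2 \<le> u" by simp
      have "(real t)\<^sup>2 * r\<^sup>2 \<le> real n"
      proof -
        have "(r * t)\<^sup>2 \<le> (sqrt (real n))\<^sup>2" using elim r by (intro power_mono) auto
        thus ?thesis by (simp add: power_mult_distrib mult.commute)
      qed
      hence "(real t)\<^sup>2 \<le> real n / r\<^sup>2" using r by (simp add: pos_le_divide_eq)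
      hence tu: "(real t)\<^sup>2 \<le> u" using u by simp
      hence "1 \<le> u" using t by (smt (verit) one_le_power of_nat_1 of_nat_mono)
      have sqrt_u: "u powr (1/2) = sqrt u" using u0 by (simp add: powr_half_sqrt)
      have "real t \<le> sqrt u" using tu by (rule real_le_rsqrt)
      also have "\<dots> = u powr (1/2)" by (simp add: sqrt_u)
      also have "\<dots> \<le> u powr (1/2 + \<epsilon>)" using \<open>1 \<le> u\<close> \<epsilon> by (intro powr_mono) auto
      also have "\<dots> \<le> max_degree (H n)" using elim by (simp add: u_def)
      finally have t_le: "t \<le> max_degree (H n)" by simp
      have "u powr \<epsilon> = u powr (1/2 + \<epsilon>) / u powr (1/2)" using u0 by (simp add: powr_add)
      also have "\<dots> \<le> max_degree (H n) / u powr (1/2)"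
        using elim by (intro divide_right_mono) (auto simp: u_def)
      also have "\<dots> = tilt (p n) * max_degree (H n) / sqrt n"
        using tilt_over_sqrt[OF pn elim(4)] unfolding u_def
        by (metis (no_types, opaque_lifting) mult.commute mult_1 times_divide_eq_left)
      finally have x: "u powr \<epsilon> \<le> tilt (p n) * max_degree (H n) / sqrt n" .
      have "real n / r\<^sup>2 \<le> u powr 1" using u u0 by simp
      also have "\<dots> \<le> u powr (\<epsilon> * t)" using \<open>1 \<le> u\<close> \<epsilon> by (intro powr_mono) auto
      also have "\<dots> = (u powr \<epsilon>) ^ t" using u0 by (simp add: powr_powr flip: powr_realpow)
      also have "\<dots> \<le> (tilt (p n) * max_degree (H n) / sqrt n) ^ t" using x by (intro power_mono) auto
      finally have "real n / r\<^sup>2 / (2 * real t ^ t * sqrt n)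
          \<le> (tilt (p n) * max_degree (H n) / sqrt n) ^ t / (2 * real t ^ t * sqrt n)"
        by (intro divide_right_mono) auto
      also have "\<dots> \<le> star_signal n (p n) (H n) t"
        by (rule star_signal_ge_max_degree[OF pn H elim(4) t t_le])
      also have "real n / r\<^sup>2 / (2 * real t ^ t * sqrt n) = ?c * sqrt (real n)"
        using elim(4) r t by (simp add: field_simps)
      finally show ?case .
    qed
  qed
qed

theorem theorem3p2:
  fixes H :: "nat \<Rightarrow> 'a graph" and p :: "nat \<Rightarrow> real"
  assumes "\<And>n. simple_graph (H n)"
    and "\<And>n. card (fst (H n)) \<le> n"
    and "\<And>n. 0 < p n \<and> p n < 1"
    and "liminf (\<lambda>n. ereal (p n)) > 0"
  shows
    "let P = (\<lambda>n. planted n (p n) (H n));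
         Q = (\<lambda>n. erdos_renyi n (p n));
         \<Delta> = (\<lambda>n. real (max_degree (H n)));
         m = (\<lambda>n. real (card (snd (H n))))
     in
       ((\<Delta> \<in> O(\<lambda>n. (real n * (p n / (1 - p n))) powr (1/2))) \<longrightarrow>
          optimal_test P Q constant_degree_tests (\<lambda>n. signed_edges n (p n)) \<and>
          ((\<exists>f\<in>constant_degree_tests. strongly_separates P Q f) \<longleftrightarrow>
             m \<in> \<omega>(\<lambda>n. real n * (p n / (1 - p n)) powr (1/2)))) \<and>
       (\<forall>\<epsilon>>0.
          (\<forall>\<^sub>F n in sequentially. \<Delta> n \<ge> (real n * (p n / (1 - p n))) powr (1/2 + \<epsilon>)) \<longrightarrow>
          (\<exists>t\<^sub>0. \<forall>t\<ge>t\<^sub>0. optimal_test P Q constant_degree_tests (\<lambda>n. signed_stars t n (p n))) \<and>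
          strongly_separates P Q (\<lambda>n. signed_stars (nat \<lceil>3 / (2 * \<epsilon>)\<rceil> + 1) n (p n))) \<and>
       (\<forall>D :: nat \<Rightarrow> nat. (\<lambda>n. real (D n)) \<in> O(\<lambda>_. 1) \<longrightarrow>
          (\<exists>T. (\<forall>n. T n = signed_edges n (p n) \<or> T n = signed_stars (D n) n (p n)) \<and>
               optimal_test P Q (polynomial_tests D) T))"
  unfolding Let_def
proof (intro conjI allI impI)
  note H = assms(1,2) and p = assms(3)
  let ?P = "\<lambda>n. planted n (p n) (H n)" and ?Q = "\<lambda>n. erdos_renyi n (p n)"
  let ?R = "\<lambda>n. star_signal n (p n) (H n)"
  have R0: "0 \<le> ?R n t" for n t using star_signal_nonneg p by blast
  obtain r where r: "1 \<le> r" "\<forall>\<^sub>F n in sequentially. tilt (p n) \<le> r"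
    using bounded_tilt[OF assms(3,4)] by blast
  have bounded: "\<exists>D0. \<forall>\<^sub>F n in sequentially. D n \<le> D0" if D: "(\<lambda>n. real (D n)) \<in> O(\<lambda>_. 1)" for D :: "nat \<Rightarrow> nat"
  proof -
    obtain c where "\<forall>\<^sub>F n in sequentially. norm (real (D n)) \<le> c * norm (1 :: real)"
      using landau_o.bigE[OF D] by blast
    hence "\<forall>\<^sub>F n in sequentially. D n \<le> nat \<lceil>c\<rceil>"
      by (rule eventually_mono) (simp, linarith)
    thus ?thesis by blast
  qed
  have edges: "strongly_separates ?P ?Q (\<lambda>n. signed_edges n (p n))"
    if "filterlim (\<lambda>n. ?R n 1) at_top sequentially"
    using signed_stars_separate[OF H p r, of "\<lambda>_. 1" 1] that
    by (simp add: signed_edges_def signed_stars_def del: One_nat_def)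
  have edges_constant: "(\<lambda>n. signed_edges n (p n)) \<in> constant_degree_tests"
    unfolding constant_degree_tests_def
    by (rule UN_I[of "\<lambda>_. 1"]) (simp_all add: signed_edges_polynomial del: One_nat_def)

  {
    assume \<Delta>: "(\<lambda>n. real (max_degree (H n))) \<in> O(\<lambda>n. (real n * (p n / (1 - p n))) powr (1/2))"
    have signal: "filterlim (\<lambda>n. ?R n 1) at_top sequentially"
      if f: "f \<in> constant_degree_tests" "strongly_separates ?P ?Q f" for f
    proof -
      obtain D where D: "(\<lambda>n. real (D n)) \<in> O(\<lambda>_. 1)" "f \<in> polynomial_tests D"
        using f(1) by (auto simp: constant_degree_tests_def)
      obtain D0 where D0: "\<forall>\<^sub>F n in sequentially. D n \<le> D0" using bounded[OF D(1)] by blast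
      obtain c where c: "\<forall>\<^sub>F n in sequentially. norm (real (max_degree (H n)))
          \<le> c * norm ((real n * (p n / (1 - p n))) powr (1/2))"
        using landau_o.bigE[OF \<Delta>] by blast
      define C where "C = max 1 c"
      have C: "1 \<le> C" "c \<le> C" by (simp_all add: C_def)
      have "\<forall>\<^sub>F n in sequentially. \<forall>j. 1 \<le> j \<longrightarrow> j \<le> D n \<longrightarrow>
          (\<Sum>y\<in>fst (H n). scaled_degree n (p n) (H n) y ^ j) \<le> 2 * C ^ D0 * ?R n 1 * sqrt n"
        using c D0 eventually_gt_at_top[of 0]
      proof eventually_elim
        case (elim n)
        have pn: "0 < p n" "p n < 1" using p by auto
        let ?u = "(real n * (p n / (1 - p n))) powr (1/2)"
        have u: "0 < ?u" using pn elim by simp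
        have x: "scaled_degree n (p n) (H n) y \<le> C" if y: "y \<in> fst (H n)" for y
        proof -
          have "real (vertex_degree (H n) y) \<le> real (max_degree (H n))"
            using vertex_degree_le_max_degree[OF H(1) y] by simp
          also have "\<dots> \<le> c * ?u" using elim u by simp
          also have "\<dots> \<le> C * ?u" using C u by (intro mult_right_mono) auto
          finally have "vertex_degree (H n) y / ?u \<le> C" using u by (simp add: pos_divide_le_eq)
          moreover have "scaled_degree n (p n) (H n) y = vertex_degree (H n) y / ?u"
            using tilt_over_sqrt[OF pn elim(3)]
            by (metis (no_types, opaque_lifting) mult.commute mult_1 times_divide_eq_left)
          ultimately show ?thesis by simp
        qed
        show ?case
        proof (intro allI impI)
          fix j assume j: "1 \<le> j" "j \<le> D n"
          hence "j \<le> D0" using elim by simp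
          from scaled_degree_moment_le_signal_1[OF pn H(1) elim(3) C(1) x j(1) this]
          show "(\<Sum>y\<in>fst (H n). scaled_degree n (p n) (H n) y ^ j) \<le> 2 * C ^ D0 * ?R n 1 * sqrt n"
            by (simp add: mult_ac)
        qed
      qed
      thus ?thesis
        using C by (intro separation_imp_signal[OF H p r D0 D(2) f(2), of "2 * C ^ D0"]) auto
    qed
    show "optimal_test ?P ?Q constant_degree_tests (\<lambda>n. signed_edges n (p n))"
      unfolding optimal_test_def using edges signal by blast
    show "(\<exists>f\<in>constant_degree_tests. strongly_separates ?P ?Q f) \<longleftrightarrow>
        (\<lambda>n. real (card (snd (H n)))) \<in> \<omega>(\<lambda>n. real n * (p n / (1 - p n)) powr (1/2))"
      unfolding signal_1_at_top_iff[OF H(1) p, symmetric]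
      using edges edges_constant signal by blast
  }
  {
    fix \<epsilon> :: real
    assume \<epsilon>: "0 < \<epsilon>" and \<Delta>: "\<forall>\<^sub>F n in sequentially.
      real (max_degree (H n)) \<ge> (real n * (p n / (1 - p n))) powr (1/2 + \<epsilon>)"
    let ?t = "nat \<lceil>3 / (2 * \<epsilon>)\<rceil> + 1"
    have sep: "strongly_separates ?P ?Q (\<lambda>n. signed_stars t n (p n))" if t: "?t \<le> t" for t
    proof -
      have "3 / (2 * \<epsilon>) \<le> real t" using t by linarith
      hence "3 / 2 \<le> \<epsilon> * t" using \<epsilon> by (simp add: field_simps)
      hence "filterlim (\<lambda>n. ?R n t) at_top sequentially"
        using \<epsilon> \<Delta> by (intro star_signal_large_degree[OF H(1) p r]) auto
      thus ?thesis using t by (intro signed_stars_separate[OF H p r, of _ t]) auto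
    qed
    show "strongly_separates ?P ?Q (\<lambda>n. signed_stars ?t n (p n))" by (rule sep) simp
    show "\<exists>t\<^sub>0. \<forall>t\<ge>t\<^sub>0. optimal_test ?P ?Q constant_degree_tests (\<lambda>n. signed_stars t n (p n))"
      using sep unfolding optimal_test_def by blast
  }
  {
    fix D :: "nat \<Rightarrow> nat"
    assume D: "(\<lambda>n. real (D n)) \<in> O(\<lambda>_. 1)"
    obtain D0 where D0: "\<forall>\<^sub>F n in sequentially. D n \<le> D0" using bounded[OF D] by blast
    \<comment> \<open>For each \<open>n\<close>, the statistic with the larger signal is taken.\<close>
    define \<tau> where "\<tau> n = (if ?R n (D n) \<le> ?R n 1 then 1 else D n)" for n
    show "\<exists>T. (\<forall>n. T n = signed_edges n (p n) \<or> T n = signed_stars (D n) n (p n)) \<and>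
               optimal_test ?P ?Q (polynomial_tests D) T"
    proof (intro exI[of _ "\<lambda>n. signed_stars (\<tau> n) n (p n)"] conjI allI)
      show "signed_stars (\<tau> n) n (p n) = signed_edges n (p n) \<or>
            signed_stars (\<tau> n) n (p n) = signed_stars (D n) n (p n)" for n
        by (simp add: \<tau>_def signed_edges_def signed_stars_def)
      show "optimal_test ?P ?Q (polynomial_tests D) (\<lambda>n. signed_stars (\<tau> n) n (p n))"
        unfolding optimal_test_def
      proof
        assume "\<exists>f\<in>polynomial_tests D. strongly_separates ?P ?Q f"
        then obtain f where f: "f \<in> polynomial_tests D" "strongly_separates ?P ?Q f" by blast
        \<comment> \<open>Tests of degree 0 are constant, so \<open>D n = 0\<close> can only happen finitely often.\<close>
        have "\<forall>\<^sub>F n in sequentially. 0 < advantage n (p n) (H n) (D n)"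
          by (rule advantage_unbounded[OF H p f])
        hence D1: "\<forall>\<^sub>F n in sequentially. 1 \<le> D n"
          by (rule eventually_mono) (metis advantage_0 less_irrefl less_one not_le)
        let ?c = "8 * (r * max 1 D0) ^ D0"
        have "\<forall>\<^sub>F n in sequentially. \<forall>j. 1 \<le> j \<longrightarrow> j \<le> D n \<longrightarrow>
            (\<Sum>y\<in>fst (H n). scaled_degree n (p n) (H n) y ^ j) \<le> ?c * ?R n (\<tau> n) * sqrt n"
          using D0 D1 r(2) eventually_gt_at_top[of 0]
        proof eventually_elim
          case (elim n)
          have pn: "0 < p n" "p n < 1" using p by auto
          have "1 * 1 \<le> r * real (max 1 D0)" using r by (intro mult_mono) auto
          hence r1: "1 \<le> r * real (max 1 D0)" by simp
          have "(r * D n) ^ D n \<le> (r * max 1 D0) ^ D n"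
            using r elim by (intro power_mono mult_left_mono) auto
          also have "\<dots> \<le> (r * max 1 D0) ^ D0" using r1 elim by (intro power_increasing) auto
          finally have c: "(r * D n) ^ D n \<le> (r * max 1 D0) ^ D0" .
          have R: "?R n 1 + ?R n (D n) \<le> 2 * ?R n (\<tau> n)" by (simp add: \<tau>_def)
          show ?case
          proof (intro allI impI)
            fix j assume j: "1 \<le> j" "j \<le> D n"
            have "(\<Sum>y\<in>fst (H n). scaled_degree n (p n) (H n) y ^ j)
                \<le> 4 * (r * D n) ^ D n * (?R n 1 + ?R n (D n)) * sqrt n"
              by (rule scaled_degree_moment_le_signals[OF pn H(1) elim(4,3) r(1) j])
            also have "\<dots> \<le> 4 * (r * max 1 D0) ^ D0 * (2 * ?R n (\<tau> n)) * sqrt n"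
              using c R R0 r r1 by (intro mult_right_mono mult_mono mult_left_mono add_nonneg_nonneg mult_nonneg_nonneg) auto
            finally show "(\<Sum>y\<in>fst (H n). scaled_degree n (p n) (H n) y ^ j) \<le> ?c * ?R n (\<tau> n) * sqrt n"
              by (simp add: mult_ac)
          qed
        qed
        hence signal: "filterlim (\<lambda>n. ?R n (\<tau> n)) at_top sequentially"
          using r by (intro separation_imp_signal[OF H p r D0 f, of ?c]) auto
        have "\<forall>\<^sub>F n in sequentially. 1 \<le> \<tau> n \<and> \<tau> n \<le> max 1 D0"
          using D0 D1 by eventually_elim (auto simp: \<tau>_def)
        thus "strongly_separates ?P ?Q (\<lambda>n. signed_stars (\<tau> n) n (p n))"
          by (rule signed_stars_separate[OF H p r _ signal])
      qed
    qed
  }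
qed

end
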